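(* Let $(R,\mathfrak m)$ be a regular local ring (respectively, a standard graded polynomial ring over a field with homogeneous maximal ideal $\mathfrak m$), let $I\subset R$ be a proper ideal, and let $\mathfrak a\subseteq I$ be a complete intersection ideal (homogeneous in the graded case). Let $K_\bullet$ be the Koszul complex resolving $R/\mathfrak a$, $F_\bullet$ the minimal free resolution of $R/I$, and $\Phi_i:K_i\to F_{i-1}\otimes_R K_1$ ($i\ge2$) the maps defined in the context. Then the maps $\Phi_k$, $k\geq 2$, form a morphism from the complex $$\cdots\to K_k\xrightarrow{d^K_k}K_{k-1}\to\cdots\xrightarrow{d^K_3}K_2\to 0$$ (with $K_k$ in degree $k-1$) to the complex $$\cdots\to F_{k}\otimes K_1\xrightarrow{d^F_{k}\otimes 1}F_{k-1}\otimes K_1\to\cdots\xrightarrow{d^F_2\otimes1}F_1\otimes K_1\xrightarrow{-d^F_1\otimes d^K_1}R$$ (with $F_k\otimes K_1$ in degree $k$ for $k\ge 1$ and $R$ in degree $0$), and the mapping cone of this morphism is a free resolution of $R/\mathfrak a I$. If $\mathfrak a\subseteq\mathfrak m I$, then this resolution is minimal.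
   Context: A complete intersection ideal is an ideal generated by a regular sequence. $K_\bullet=\bigwedge^\bullet K_1$ is the Koszul complex on a regular sequence minimally generating $\mathfrak a$, with basis $f_1,\dots,f_n$ of $K_1$; for $\sigma=\{\sigma_1<\dots<\sigma_i\}$ put $f_\sigma=f_{\sigma_1}\wedge\cdots\wedge f_{\sigma_i}$, and $d^K(f_\sigma)=\sum_{j}(-1)^{j-1}d^K_1(f_{\sigma_j})f_{\sigma\setminus\sigma_j}$. The complex $F_\bullet$ (with $F_0=R$) is equipped with any (not necessarily associative) DG-algebra product $\cdot_F$: unitary, $F_iF_j\subseteq F_{i+j}$, satisfying the Leibniz rule $d(xy)=d(x)y+(-1)^{|x|}x\,d(y)$, graded commutative, with squares of odd-degree elements zero; such a product always exists. $L_1:K_1\to F_1$ is a degree-one comparison map over the identity of $R$, i.e. $d_1^F\circ L_1=d_1^K$. For $i>1$, $L_i:K_i\to F_i$ is the $R$-linear map $f_\sigma\mapsto L_1(f_{\sigma_1})\cdot_F\cdots\cdot_FL_1(f_{\sigma_i})$, the product being evaluated from left to right, i.e. $(\cdots((L_1(f_{\sigma_1})\cdot_FL_1(f_{\sigma_2}))\cdot_F\cdots)\cdot_FL_1(f_{\sigma_{i-1}}))\cdot_FL_1(f_{\sigma_i})$. For $i>1$, $\Phi_i:K_i\to F_{i-1}\otimes K_1$ is the $R$-linear map $$f_\sigma\mapsto\sum_{r\in\sigma}\operatorname{sgn}(r\in\sigma)\,L_{i-1}(f_{\sigma\setminus r})\otimes f_r,$$ where $\operatorname{sgn}(r\in\sigma)$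 is the sign of the permutation reordering the sequence $(\sigma\setminus r,\,r)$ (elements of $\sigma\setminus r$ in ascending order, followed by $r$) into ascending order. *)

theory Defs
  imports
    Complex_Main
    "HOL-Library.Function_Algebras"
    "HOL-Library.Extended_Nat"
    "HOL-Combinatorics.Permutations"
begin

section \<open>Ideals of a commutative ring\<close>

text \<open>The ring is a type of class \<^class>\<open>comm_ring_1\<close>. Its ideals are the submodules of the ring
  acting on itself, so the notions of \<^locale>\<open>module\<close> are used for them.\<close>

lemma module_mult: "module ((*) :: 'a::comm_ring_1 \<Rightarrow> 'a \<Rightarrow> 'a)"
  by unfold_locales (simp_all add: distrib_left distrib_right mult.assoc)

abbreviation is_ideal :: "'a::comm_ring_1 set \<Rightarrow> bool" where
  "is_ideal \<equiv> module.subspace (*)"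

abbreviation ideal_gen :: "'a::comm_ring_1 set \<Rightarrow> 'a set" where
  "ideal_gen \<equiv> module.span (*)"

definition ideal_mult :: "'a::comm_ring_1 set \<Rightarrow> 'a set \<Rightarrow> 'a set" where
  "ideal_mult I J = ideal_gen {x * y | x y. x \<in> I \<and> y \<in> J}"

definition prime_ideal :: "'a::comm_ring_1 set \<Rightarrow> bool" where
  "prime_ideal P \<longleftrightarrow> is_ideal P \<and> P \<noteq> UNIV \<and> (\<forall>x y. x * y \<in> P \<longrightarrow> x \<in> P \<or> y \<in> P)"

definition maximal_ideal :: "'a::comm_ring_1 set \<Rightarrow> bool" where
  "maximal_ideal M \<longleftrightarrow> is_ideal M \<and> M \<noteq> UNIV \<and>
     (\<forall>J. is_ideal J \<and> M \<subseteq> J \<and> J \<noteq> UNIV \<longrightarrow> J = M)"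

definition noetherian :: "'a::comm_ring_1 itself \<Rightarrow> bool" where
  "noetherian _ \<longleftrightarrow> (\<forall>J :: 'a set. is_ideal J \<longrightarrow> (\<exists>S. finite S \<and> J = ideal_gen S))"

definition krull_dim :: "'a::comm_ring_1 itself \<Rightarrow> enat" where
  "krull_dim _ = Sup {enat l | l. \<exists>P :: nat \<Rightarrow> 'a set.
     (\<forall>i\<le>l. prime_ideal (P i)) \<and> (\<forall>i<l. P i \<subset> P (Suc i))}"

text \<open>Only meaningful for finitely generated ideals.\<close>

definition min_number_gens :: "'a::comm_ring_1 set \<Rightarrow> nat" where
  "min_number_gens J = (LEAST k. \<exists>S. finite S \<and> card S = k \<and> J = ideal_gen S)"

definition regular_local_ring :: "'a::comm_ring_1 set \<Rightarrow> bool" where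
  "regular_local_ring \<mm> \<longleftrightarrow>
     noetherian TYPE('a) \<and>
     maximal_ideal \<mm> \<and> (\<forall>M. maximal_ideal M \<longrightarrow> M = \<mm>) \<and>
     enat (min_number_gens \<mm>) = krull_dim TYPE('a)"

definition regular_sequence :: "nat \<Rightarrow> (nat \<Rightarrow> 'a::comm_ring_1) \<Rightarrow> bool" where
  "regular_sequence n g \<longleftrightarrow>
     (\<forall>i\<in>{1..n}. \<forall>x. g i * x \<in> ideal_gen (g ` {1..<i}) \<longrightarrow> x \<in> ideal_gen (g ` {1..<i})) \<and>
     ideal_gen (g ` {1..n}) \<noteq> UNIV"

definition minimally_generates :: "nat \<Rightarrow> (nat \<Rightarrow> 'a::comm_ring_1) \<Rightarrow> 'a set \<Rightarrow> bool" where
  "minimally_generates n g \<aa> \<longleftrightarrow>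
     ideal_gen (g ` {1..n}) = \<aa> \<and> (\<forall>j\<in>{1..n}. ideal_gen (g ` ({1..n} - {j})) \<noteq> \<aa>)"


section \<open>Standard graded polynomial rings\<close>

text \<open>The ring is the polynomial ring over its subfield \<open>k\<close> in the elements \<open>X 1, \<dots>, X N\<close>.\<close>

definition subfield :: "'a::comm_ring_1 set \<Rightarrow> bool" where
  "subfield k \<longleftrightarrow> 0 \<in> k \<and> 1 \<in> k \<and> (\<forall>x\<in>k. \<forall>y\<in>k. x - y \<in> k \<and> x * y \<in> k) \<and>
     (\<forall>x\<in>k. x \<noteq> 0 \<longrightarrow> (\<exists>y\<in>k. x * y = 1))"

definition exponents :: "nat \<Rightarrow> (nat \<Rightarrow> nat) set" where
  "exponents N = {\<alpha>. \<forall>i. i \<notin> {1..N} \<longrightarrow> \<alpha> i = 0}"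

definition monomial :: "nat \<Rightarrow> (nat \<Rightarrow> 'a::comm_ring_1) \<Rightarrow> (nat \<Rightarrow> nat) \<Rightarrow> 'a" where
  "monomial N X \<alpha> = (\<Prod>i = 1..N. X i ^ \<alpha> i)"

definition polynomial_ring :: "'a::comm_ring_1 set \<Rightarrow> nat \<Rightarrow> (nat \<Rightarrow> 'a) \<Rightarrow> bool" where
  "polynomial_ring k N X \<longleftrightarrow> subfield k \<and>
     (\<forall>p. \<exists>!c. range c \<subseteq> k \<and> finite {\<alpha>. c \<alpha> \<noteq> 0} \<and> {\<alpha>. c \<alpha> \<noteq> 0} \<subseteq> exponents N \<and>
                p = (\<Sum>\<alpha> | c \<alpha> \<noteq> 0. c \<alpha> * monomial N X \<alpha>))"

text \<open>The graded piece of degree \<open>j\<close>; it is \<open>0\<close> for negative \<open>j\<close>.\<close>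

definition homog :: "'a::comm_ring_1 set \<Rightarrow> nat \<Rightarrow> (nat \<Rightarrow> 'a) \<Rightarrow> int \<Rightarrow> 'a set" where
  "homog k N X j =
     {\<Sum>\<alpha> | \<alpha> \<in> exponents N \<and> int (\<Sum>i = 1..N. \<alpha> i) = j. c \<alpha> * monomial N X \<alpha> | c. range c \<subseteq> k}"

definition homogeneous_ideal :: "'a::comm_ring_1 set \<Rightarrow> nat \<Rightarrow> (nat \<Rightarrow> 'a) \<Rightarrow> 'a set \<Rightarrow> bool" where
  "homogeneous_ideal k N X J \<longleftrightarrow> is_ideal J \<and> J = ideal_gen (J \<inter> (\<Union>j. homog k N X j))"


section \<open>Based free modules, tensor products and linear maps\<close>

text \<open>A free module of finite rank is given together with a finite basis \<open>A\<close>; its elements are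
  coefficient functions vanishing outside of \<open>A\<close>.\<close>

definition smul :: "'a::comm_ring_1 \<Rightarrow> ('b \<Rightarrow> 'a) \<Rightarrow> ('b \<Rightarrow> 'a)" (infixr "\<odot>" 75) where
  "c \<odot> x = (\<lambda>b. c * x b)"

global_interpretation fun_module: module "smul :: 'a::comm_ring_1 \<Rightarrow> ('b \<Rightarrow> 'a) \<Rightarrow> ('b \<Rightarrow> 'a)"
  by unfold_locales (simp_all add: fun_eq_iff smul_def distrib_left distrib_right mult.assoc)

definition free_on :: "'b set \<Rightarrow> ('b \<Rightarrow> 'a::comm_ring_1) set" where
  "free_on A = {x. \<forall>b. b \<notin> A \<longrightarrow> x b = 0}"

definition bvec :: "'b \<Rightarrow> ('b \<Rightarrow> 'a::comm_ring_1)" where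
  "bvec b = (\<lambda>b'. if b' = b then 1 else 0)"

definition linear_on ::
    "'b set \<Rightarrow> 'c set \<Rightarrow> (('b \<Rightarrow> 'a::comm_ring_1) \<Rightarrow> ('c \<Rightarrow> 'a)) \<Rightarrow> bool" where
  "linear_on A C f \<longleftrightarrow> f ` free_on A \<subseteq> free_on C \<and>
     (\<forall>x\<in>free_on A. \<forall>y\<in>free_on A. f (x + y) = f x + f y) \<and>
     (\<forall>c. \<forall>x\<in>free_on A. f (c \<odot> x) = c \<odot> f x)"

text \<open>The linear map on the free module with basis \<open>A\<close> that maps each \<open>a \<in> A\<close> to \<open>\<phi> a\<close>.\<close>

definition lin_ext :: "'b set \<Rightarrow> ('b \<Rightarrow> ('c \<Rightarrow> 'a::comm_ring_1)) \<Rightarrow> ('b \<Rightarrow> 'a) \<Rightarrow> ('c \<Rightarrow> 'a)" where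
  "lin_ext A \<phi> x = (\<Sum>a\<in>A. x a \<odot> \<phi> a)"

text \<open>The tensor product of the free modules with bases \<open>A\<close> and \<open>C\<close> is the free module with basis
  \<open>A \<times> C\<close>; its universal property is \<open>tensor_universal\<close> below.\<close>

definition tens :: "('b \<Rightarrow> 'a::comm_ring_1) \<Rightarrow> ('c \<Rightarrow> 'a) \<Rightarrow> ('b \<times> 'c \<Rightarrow> 'a)" where
  "tens x y = (\<lambda>(b, c). x b * y c)"

definition tensor_map ::
    "'b set \<Rightarrow> 'c set \<Rightarrow> (('b \<Rightarrow> 'a::comm_ring_1) \<Rightarrow> ('d \<Rightarrow> 'a)) \<Rightarrow> (('c \<Rightarrow> 'a) \<Rightarrow> ('e \<Rightarrow> 'a))
      \<Rightarrow> ('b \<times> 'c \<Rightarrow> 'a) \<Rightarrow> ('d \<times> 'e \<Rightarrow> 'a)" where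
  "tensor_map A C f h = lin_ext (A \<times> C) (\<lambda>(a, c). tens (f (bvec a)) (h (bvec c)))"

lemma sum_fun_apply: "(\<Sum>a\<in>A. f a) b = (\<Sum>a\<in>A. f a (b :: 'b) :: 'a::comm_ring_1)"
  by (induction A rule: infinite_finite_induct) auto

lemma lin_ext_apply: "lin_ext A \<phi> x c = (\<Sum>a\<in>A. x a * \<phi> a c)"
  by (simp add: lin_ext_def sum_fun_apply smul_def)

lemma bvec_in_free_on: "b \<in> A \<Longrightarrow> bvec b \<in> free_on A"
  by (auto simp: bvec_def free_on_def)

lemma lin_ext_bvec_self:
  assumes "finite A" "x \<in> free_on A"
  shows "lin_ext A bvec x = x"
proof
  fix c
  have "lin_ext A bvec x c = (\<Sum>a\<in>A. if a = c then x a else 0)"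
    unfolding lin_ext_apply bvec_def by (rule sum.cong) auto
  then show "lin_ext A bvec x c = x c"
    using assms by (auto simp: free_on_def)
qed

lemma lin_ext_bvec:
  assumes "finite A" "a \<in> A"
  shows "lin_ext A \<phi> (bvec a) = \<phi> a"
proof
  fix c
  have "lin_ext A \<phi> (bvec a) c = (\<Sum>a'\<in>A. if a' = a then \<phi> a' c else 0)"
    unfolding lin_ext_apply bvec_def by (rule sum.cong) auto
  then show "lin_ext A \<phi> (bvec a) c = \<phi> a c"
    using assms by simp
qed

lemma linear_on_lin_ext:
  fixes \<phi> :: "'b \<Rightarrow> ('c \<Rightarrow> 'a::comm_ring_1)"
  assumes "\<And>a. a \<in> A \<Longrightarrow> \<phi> a \<in> free_on C"
  shows "linear_on A C (lin_ext A \<phi>)"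
  unfolding linear_on_def
proof (intro conjI allI ballI)
  show "lin_ext A \<phi> ` free_on A \<subseteq> free_on C"
    using assms by (simp add: free_on_def lin_ext_apply image_subset_iff)
next
  fix x y :: "'b \<Rightarrow> 'a"
  show "lin_ext A \<phi> (x + y) = lin_ext A \<phi> x + lin_ext A \<phi> y"
    by (rule ext) (simp add: lin_ext_apply distrib_right sum.distrib)
next
  fix c and x :: "'b \<Rightarrow> 'a"
  show "lin_ext A \<phi> (c \<odot> x) = c \<odot> lin_ext A \<phi> x"
    by (rule ext) (simp add: lin_ext_apply smul_def sum_distrib_left mult.assoc)
qed

lemma linear_on_eq_lin_ext:
  fixes f :: "('b \<Rightarrow> 'a::comm_ring_1) \<Rightarrow> ('c \<Rightarrow> 'a)"
  assumes "finite A" "linear_on A C f" "x \<in> free_on A"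
  shows "f x = lin_ext A (\<lambda>a. f (bvec a)) x"
proof -
  have z: "f 0 = 0"
  proof -
    have "(0 :: 'b \<Rightarrow> 'a) \<in> free_on A" by (simp add: free_on_def)
    then have "f (0 \<odot> 0) = 0 \<odot> f 0" using assms(2) unfolding linear_on_def by blast
    then show ?thesis by (simp add: smul_def zero_fun_def)
  qed
  have "f (\<Sum>a\<in>S. x a \<odot> bvec a) = (\<Sum>a\<in>S. x a \<odot> f (bvec a))" if "S \<subseteq> A" for S
    using finite_subset[OF that assms(1)] that
  proof (induction S rule: finite_induct)
    case empty
    then show ?case by (simp only: sum.empty z)
  next
    case (insert s S)
    have 1: "(\<Sum>a\<in>S. x a \<odot> bvec a) \<in> free_on A"
      using insert.prems by (auto simp: free_on_def sum_fun_apply smul_def bvec_def intro!: sum.neutral)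
    have 2: "bvec s \<in> free_on A" "x s \<odot> bvec s \<in> free_on A"
      using insert.prems by (auto simp: free_on_def smul_def bvec_def)
    have "f (\<Sum>a\<in>insert s S. x a \<odot> bvec a) = f (x s \<odot> bvec s + (\<Sum>a\<in>S. x a \<odot> bvec a))"
      using insert.hyps by simp
    also have "\<dots> = f (x s \<odot> bvec s) + f (\<Sum>a\<in>S. x a \<odot> bvec a)"
      using assms(2) 1 2 unfolding linear_on_def by blast
    also have "f (x s \<odot> bvec s) = x s \<odot> f (bvec s)"
      using assms(2) 2 unfolding linear_on_def by blast
    finally show ?case using insert by simp
  qed
  from this[of A] show ?thesis
    using lin_ext_bvec_self[OF assms(1,3)] by (simp add: lin_ext_def)
qed

definition bilinear_on ::
    "'b set \<Rightarrow> 'c set \<Rightarrow> 'd set \<Rightarrow> (('b \<Rightarrow> 'a::comm_ring_1) \<Rightarrow> ('c \<Rightarrow> 'a) \<Rightarrow> ('d \<Rightarrow> 'a)) \<Rightarrow> bool" where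
  "bilinear_on A C D \<beta> \<longleftrightarrow>
     (\<forall>y\<in>free_on C. linear_on A D (\<lambda>x. \<beta> x y)) \<and> (\<forall>x\<in>free_on A. linear_on C D (\<beta> x))"

lemma bilinear_tens: "bilinear_on A C (A \<times> C) tens"
  unfolding bilinear_on_def linear_on_def
proof (intro conjI allI ballI)
  show "(\<lambda>x. tens x y) ` free_on A \<subseteq> free_on (A \<times> C)" if "y \<in> free_on C" for y :: "'b \<Rightarrow> 'c"
    using that by (auto simp: tens_def free_on_def)
  show "tens x ` free_on C \<subseteq> free_on (A \<times> C)" if "x \<in> free_on A" for x :: "'a \<Rightarrow> 'c"
    using that by (auto simp: tens_def free_on_def)
qed (simp_all add: fun_eq_iff tens_def smul_def distrib_left distrib_right mult.assoc mult.left_commute)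

lemma tensor_universal:
  fixes \<beta> :: "('b \<Rightarrow> 'a::comm_ring_1) \<Rightarrow> ('c \<Rightarrow> 'a) \<Rightarrow> ('d \<Rightarrow> 'a)"
  assumes "finite A" "finite C" "bilinear_on A C D \<beta>"
  shows "\<exists>h. linear_on (A \<times> C) D h \<and> (\<forall>x\<in>free_on A. \<forall>y\<in>free_on C. h (tens x y) = \<beta> x y)"
    and "linear_on (A \<times> C) D h \<Longrightarrow> linear_on (A \<times> C) D h' \<Longrightarrow>
         \<forall>x\<in>free_on A. \<forall>y\<in>free_on C. h (tens x y) = h' (tens x y) \<Longrightarrow>
         z \<in> free_on (A \<times> C) \<Longrightarrow> h z = h' z"
proof -
  let ?h = "lin_ext (A \<times> C) (\<lambda>(a, c). \<beta> (bvec a) (bvec c))"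
  have mem: "\<beta> (bvec a) (bvec c) \<in> free_on D" if "a \<in> A" "c \<in> C" for a c
    using assms(3) that unfolding bilinear_on_def linear_on_def by (blast intro: bvec_in_free_on)
  have lin: "linear_on (A \<times> C) D ?h"
    by (rule linear_on_lin_ext) (use mem in auto)
  have "?h (tens x y) = \<beta> x y" if xy: "x \<in> free_on A" "y \<in> free_on C" for x y
  proof -
    have "\<beta> x y = lin_ext A (\<lambda>a. \<beta> (bvec a) y) x"
      using linear_on_eq_lin_ext[OF assms(1), of D "\<lambda>x. \<beta> x y"] assms(3) xy
      unfolding bilinear_on_def by blast
    also have "\<dots> = lin_ext A (\<lambda>a. lin_ext C (\<lambda>c. \<beta> (bvec a) (bvec c)) y) x"
      unfolding lin_ext_def[of A]
    proof (rule sum.cong)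
      fix a assume "a \<in> A"
      then have "linear_on C D (\<beta> (bvec a))"
        using assms(3) by (simp add: bilinear_on_def bvec_in_free_on)
      from linear_on_eq_lin_ext[OF assms(2) this xy(2)]
      show "x a \<odot> \<beta> (bvec a) y = x a \<odot> lin_ext C (\<lambda>c. \<beta> (bvec a) (bvec c)) y" by simp
    qed simp
    also have "\<dots> = ?h (tens x y)"
    proof
      fix e
      have "lin_ext A (\<lambda>a. lin_ext C (\<lambda>c. \<beta> (bvec a) (bvec c)) y) x e =
          (\<Sum>a\<in>A. \<Sum>c\<in>C. x a * y c * \<beta> (bvec a) (bvec c) e)"
        unfolding lin_ext_apply sum_distrib_left mult.assoc ..
      also have "\<dots> = (\<Sum>(a, c)\<in>A \<times> C. x a * y c * \<beta> (bvec a) (bvec c) e)"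
        by (rule sum.cartesian_product)
      also have "\<dots> = ?h (tens x y) e"
        unfolding lin_ext_apply tens_def by (intro sum.cong) auto
      finally show "lin_ext A (\<lambda>a. lin_ext C (\<lambda>c. \<beta> (bvec a) (bvec c)) y) x e = ?h (tens x y) e" .
    qed
    finally show ?thesis by simp
  qed
  with lin show "\<exists>h. linear_on (A \<times> C) D h \<and> (\<forall>x\<in>free_on A. \<forall>y\<in>free_on C. h (tens x y) = \<beta> x y)"
    by blast
next
  assume h: "linear_on (A \<times> C) D h" "linear_on (A \<times> C) D h'"
    "\<forall>x\<in>free_on A. \<forall>y\<in>free_on C. h (tens x y) = h' (tens x y)" "z \<in> free_on (A \<times> C)"
  have fin: "finite (A \<times> C)" using assms by simp
  have b: "bvec p = tens (bvec (fst p)) (bvec (snd p))" for p :: "'b \<times> 'c"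
    by (cases p) (auto simp: fun_eq_iff bvec_def tens_def)
  have "h (bvec p) = h' (bvec p)" if "p \<in> A \<times> C" for p
    unfolding b using h(3) that by (simp add: bvec_in_free_on mem_Times_iff)
  then show "h z = h' z"
    unfolding linear_on_eq_lin_ext[OF fin h(1,4)] linear_on_eq_lin_ext[OF fin h(2,4)] lin_ext_def
    by (intro sum.cong) auto
qed


section \<open>Complexes, free resolutions and mapping cones\<close>

text \<open>A complex of based free modules \<open>\<cdots> \<rightarrow> C\<^sub>1 \<rightarrow> C\<^sub>0\<close> consists of bases \<open>B i\<close> and maps
  \<open>d i : C\<^sub>i \<rightarrow> C\<^sub>i\<^sub>-\<^sub>1\<close>. As \<open>0 - 1 = 0\<close> on the naturals, the map \<open>C\<^sub>0 \<rightarrow> 0\<close> is represented by \<open>d 0 = 0\<close>,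
  from \<open>C\<^sub>0\<close> to itself.\<close>

definition free_complex :: "(nat \<Rightarrow> 'b set) \<Rightarrow> (nat \<Rightarrow> ('b \<Rightarrow> 'a::comm_ring_1) \<Rightarrow> ('b \<Rightarrow> 'a)) \<Rightarrow> bool" where
  "free_complex B d \<longleftrightarrow>
     (\<forall>i. finite (B i)) \<and> (\<forall>i. linear_on (B i) (B (i - 1)) (d i)) \<and>
     (\<forall>x\<in>free_on (B 0). d 0 x = 0) \<and> (\<forall>i. \<forall>x\<in>free_on (B (i + 1)). d i (d (i + 1) x) = 0)"

text \<open>A free resolution of the quotient of the ring by \<open>J\<close> whose term in degree \<open>0\<close> is the ring
  itself, with basis \<open>{u}\<close> and \<open>u\<close> corresponding to \<open>1\<close>; the augmentation is the quotient map.\<close>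

definition free_resolution ::
    "'b \<Rightarrow> (nat \<Rightarrow> 'b set) \<Rightarrow> (nat \<Rightarrow> ('b \<Rightarrow> 'a::comm_ring_1) \<Rightarrow> ('b \<Rightarrow> 'a)) \<Rightarrow> 'a set \<Rightarrow> bool" where
  "free_resolution u B d J \<longleftrightarrow>
     free_complex B d \<and> B 0 = {u} \<and>
     (\<forall>i\<ge>1. d (i + 1) ` free_on (B (i + 1)) = {x \<in> free_on (B i). d i x = 0}) \<and>
     d 1 ` free_on (B 1) = {x \<in> free_on {u}. x u \<in> J}"

definition minimal_complex ::
    "'a set \<Rightarrow> (nat \<Rightarrow> 'b set) \<Rightarrow> (nat \<Rightarrow> ('b \<Rightarrow> 'a::comm_ring_1) \<Rightarrow> ('b \<Rightarrow> 'a)) \<Rightarrow> bool" where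
  "minimal_complex \<mm> B d \<longleftrightarrow> (\<forall>i\<ge>1. d i ` free_on (B i) \<subseteq>
     fun_module.span {r \<odot> x | r x. r \<in> \<mm> \<and> x \<in> free_on (B (i - 1))})"

definition minimal_free_resolution ::
    "'a set \<Rightarrow> 'b \<Rightarrow> (nat \<Rightarrow> 'b set) \<Rightarrow> (nat \<Rightarrow> ('b \<Rightarrow> 'a::comm_ring_1) \<Rightarrow> ('b \<Rightarrow> 'a)) \<Rightarrow> 'a set \<Rightarrow> bool" where
  "minimal_free_resolution \<mm> u B d J \<longleftrightarrow> free_resolution u B d J \<and> minimal_complex \<mm> B d"

definition complex_morphism ::
    "(nat \<Rightarrow> 's set) \<Rightarrow> (nat \<Rightarrow> ('s \<Rightarrow> 'a::comm_ring_1) \<Rightarrow> ('s \<Rightarrow> 'a)) \<Rightarrow>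
     (nat \<Rightarrow> 't set) \<Rightarrow> (nat \<Rightarrow> ('t \<Rightarrow> 'a) \<Rightarrow> ('t \<Rightarrow> 'a)) \<Rightarrow> (nat \<Rightarrow> ('s \<Rightarrow> 'a) \<Rightarrow> ('t \<Rightarrow> 'a)) \<Rightarrow> bool" where
  "complex_morphism BS dS BT dT \<phi> \<longleftrightarrow>
     free_complex BS dS \<and> free_complex BT dT \<and>
     (\<forall>j. linear_on (BS j) (BT j) (\<phi> j)) \<and>
     (\<forall>j\<ge>1. \<forall>x\<in>free_on (BS j). dT j (\<phi> j x) = \<phi> (j - 1) (dS j x))"

text \<open>The mapping cone of \<open>\<phi> : S \<rightarrow> T\<close> has the term \<open>T\<^sub>j \<oplus> S\<^sub>j\<^sub>-\<^sub>1\<close> in degree \<open>j\<close> and the differential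
  \<open>(t, s) \<mapsto> (d t + \<phi> s, - d s)\<close>.\<close>

definition cone_basis :: "(nat \<Rightarrow> 's set) \<Rightarrow> (nat \<Rightarrow> 't set) \<Rightarrow> nat \<Rightarrow> ('t + 's) set" where
  "cone_basis BS BT j = Inl ` BT j \<union> (if j = 0 then {} else Inr ` BS (j - 1))"

definition cone_diff ::
    "(nat \<Rightarrow> ('s \<Rightarrow> 'a::comm_ring_1) \<Rightarrow> ('s \<Rightarrow> 'a)) \<Rightarrow> (nat \<Rightarrow> ('t \<Rightarrow> 'a) \<Rightarrow> ('t \<Rightarrow> 'a)) \<Rightarrow>
     (nat \<Rightarrow> ('s \<Rightarrow> 'a) \<Rightarrow> ('t \<Rightarrow> 'a)) \<Rightarrow> nat \<Rightarrow> ('t + 's \<Rightarrow> 'a) \<Rightarrow> ('t + 's \<Rightarrow> 'a)" where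
  "cone_diff dS dT \<phi> j z =
     (if j = 0 then 0
      else case_sum (dT j (z \<circ> Inl) + \<phi> (j - 1) (z \<circ> Inr)) (- dS (j - 1) (z \<circ> Inr)))"


section \<open>Gradings\<close>

text \<open>\<open>H j\<close> is the degree \<open>j\<close> piece of the ring, and \<open>\<delta> b\<close> is the degree of the basis element \<open>b\<close>.\<close>

definition homog_vec :: "(int \<Rightarrow> 'a::comm_ring_1 set) \<Rightarrow> 'b set \<Rightarrow> ('b \<Rightarrow> int) \<Rightarrow> int \<Rightarrow> ('b \<Rightarrow> 'a) set" where
  "homog_vec H A \<delta> j = {x \<in> free_on A. \<forall>b\<in>A. x b \<in> H (j - \<delta> b)}"

definition degree_preserving ::
    "(int \<Rightarrow> 'a::comm_ring_1 set) \<Rightarrow> 'b set \<Rightarrow> ('b \<Rightarrow> int) \<Rightarrow> 'c set \<Rightarrow> ('c \<Rightarrow> int) \<Rightarrow>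
     (('b \<Rightarrow> 'a) \<Rightarrow> ('c \<Rightarrow> 'a)) \<Rightarrow> bool" where
  "degree_preserving H A \<delta> C \<delta>' f \<longleftrightarrow> (\<forall>j. f ` homog_vec H A \<delta> j \<subseteq> homog_vec H C \<delta>' j)"

definition graded_complex ::
    "(int \<Rightarrow> 'a::comm_ring_1 set) \<Rightarrow> (nat \<Rightarrow> 'b set) \<Rightarrow> (nat \<Rightarrow> 'b \<Rightarrow> int) \<Rightarrow>
     (nat \<Rightarrow> ('b \<Rightarrow> 'a) \<Rightarrow> ('b \<Rightarrow> 'a)) \<Rightarrow> bool" where
  "graded_complex H B \<delta> d \<longleftrightarrow>
     (\<forall>i\<ge>1. degree_preserving H (B i) (\<delta> i) (B (i - 1)) (\<delta> (i - 1)) (d i))"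

definition graded_product ::
    "(int \<Rightarrow> 'a::comm_ring_1 set) \<Rightarrow> (nat \<Rightarrow> 'b set) \<Rightarrow> (nat \<Rightarrow> 'b \<Rightarrow> int) \<Rightarrow>
     (nat \<Rightarrow> nat \<Rightarrow> ('b \<Rightarrow> 'a) \<Rightarrow> ('b \<Rightarrow> 'a) \<Rightarrow> ('b \<Rightarrow> 'a)) \<Rightarrow> bool" where
  "graded_product H B \<delta> mul \<longleftrightarrow>
     (\<forall>i j p q. \<forall>x\<in>homog_vec H (B i) (\<delta> i) p. \<forall>y\<in>homog_vec H (B j) (\<delta> j) q.
        mul i j x y \<in> homog_vec H (B (i + j)) (\<delta> (i + j)) (p + q))"

definition cone_degree :: "(nat \<Rightarrow> 's \<Rightarrow> int) \<Rightarrow> (nat \<Rightarrow> 't \<Rightarrow> int) \<Rightarrow> nat \<Rightarrow> 't + 's \<Rightarrow> int" where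
  "cone_degree \<delta>S \<delta>T j = case_sum (\<delta>T j) (\<delta>S (j - 1))"


section \<open>The Koszul complex\<close>

text \<open>The basis element \<open>f\<^sub>\<sigma>\<close> of \<open>K\<^sub>k\<close> is \<^term>\<open>bvec \<sigma>\<close>, for a subset \<open>\<sigma>\<close> of \<open>{1..n}\<close> with \<open>k\<close> elements.
  In particular \<open>K\<^sub>0\<close> is the ring, with basis \<open>{{}}\<close>, and \<open>f\<^sub>r\<close> is \<open>bvec {r}\<close>.\<close>

definition koszul_basis :: "nat \<Rightarrow> nat \<Rightarrow> nat set set" where
  "koszul_basis n k = {\<sigma>. \<sigma> \<subseteq> {1..n} \<and> card \<sigma> = k}"

text \<open>List indices start at \<open>0\<close>, so the sign of the summand for \<open>\<sigma>\<^sub>j\<^sub>+\<^sub>1\<close> is \<open>(-1)\<^sup>j\<close>.\<close>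

definition koszul_diff ::
    "nat \<Rightarrow> (nat \<Rightarrow> 'a::comm_ring_1) \<Rightarrow> nat \<Rightarrow> (nat set \<Rightarrow> 'a) \<Rightarrow> (nat set \<Rightarrow> 'a)" where
  "koszul_diff n g k = lin_ext (koszul_basis n k)
     (\<lambda>\<sigma>. \<Sum>j<card \<sigma>. let r = sorted_list_of_set \<sigma> ! j in ((-1) ^ j * g r) \<odot> bvec (\<sigma> - {r}))"

definition koszul_degree :: "(nat \<Rightarrow> int) \<Rightarrow> nat set \<Rightarrow> int" where
  "koszul_degree e \<sigma> = (\<Sum>r\<in>\<sigma>. e r)"


section \<open>Products on the resolution and the comparison maps\<close>

text \<open>\<open>mul i j\<close> is the restriction of the product to \<open>F\<^sub>i \<times> F\<^sub>j\<close>. The product is not assumed to be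
  associative. When \<open>i = 0\<close> or \<open>j = 0\<close>, the corresponding summand of the Leibniz rule vanishes, because
  \<open>d 0 = 0\<close>.\<close>

definition dg_product ::
    "'b \<Rightarrow> (nat \<Rightarrow> 'b set) \<Rightarrow> (nat \<Rightarrow> ('b \<Rightarrow> 'a::comm_ring_1) \<Rightarrow> ('b \<Rightarrow> 'a)) \<Rightarrow>
     (nat \<Rightarrow> nat \<Rightarrow> ('b \<Rightarrow> 'a) \<Rightarrow> ('b \<Rightarrow> 'a) \<Rightarrow> ('b \<Rightarrow> 'a)) \<Rightarrow> bool" where
  "dg_product u B d mul \<longleftrightarrow>
     (\<forall>i j. bilinear_on (B i) (B j) (B (i + j)) (mul i j)) \<and>
     (\<forall>i. \<forall>x\<in>free_on (B i). mul 0 i (bvec u) x = x \<and> mul i 0 x (bvec u) = x) \<and>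
     (\<forall>i j. \<forall>x\<in>free_on (B i). \<forall>y\<in>free_on (B j).
        d (i + j) (mul i j x y) = mul (i - 1) j (d i x) y + (-1) ^ i \<odot> mul i (j - 1) x (d j y)) \<and>
     (\<forall>i j. \<forall>x\<in>free_on (B i). \<forall>y\<in>free_on (B j). mul i j x y = (-1) ^ (i * j) \<odot> mul j i y x) \<and>
     (\<forall>i. odd i \<longrightarrow> (\<forall>x\<in>free_on (B i). mul i i x x = 0))"

text \<open>\<open>left_product mul i x [y\<^sub>1, \<dots>, y\<^sub>m] = (\<cdots>((x y\<^sub>1) y\<^sub>2) \<cdots>) y\<^sub>m\<close> for \<open>x\<close> of degree \<open>i\<close> and
  \<open>y\<^sub>1, \<dots>, y\<^sub>m\<close> of degree \<open>1\<close>.\<close>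

primrec left_product ::
    "(nat \<Rightarrow> nat \<Rightarrow> ('b \<Rightarrow> 'a) \<Rightarrow> ('b \<Rightarrow> 'a) \<Rightarrow> ('b \<Rightarrow> 'a)) \<Rightarrow> nat \<Rightarrow> ('b \<Rightarrow> 'a) \<Rightarrow> ('b \<Rightarrow> 'a) list \<Rightarrow> ('b \<Rightarrow> 'a)"
where
  "left_product mul i x [] = x"
| "left_product mul i x (y # ys) = left_product mul (i + 1) (mul i 1 x y) ys"

text \<open>The maps \<open>L\<^sub>i\<close> for \<open>i \<ge> 1\<close>.\<close>

definition comparison_map ::
    "nat \<Rightarrow> (nat \<Rightarrow> nat \<Rightarrow> ('b \<Rightarrow> 'a::comm_ring_1) \<Rightarrow> ('b \<Rightarrow> 'a) \<Rightarrow> ('b \<Rightarrow> 'a)) \<Rightarrow>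
     ((nat set \<Rightarrow> 'a) \<Rightarrow> ('b \<Rightarrow> 'a)) \<Rightarrow> nat \<Rightarrow> (nat set \<Rightarrow> 'a) \<Rightarrow> ('b \<Rightarrow> 'a)" where
  "comparison_map n mul L1 i =
     (if i = 1 then L1
      else lin_ext (koszul_basis n i)
        (\<lambda>\<sigma>. let xs = map (\<lambda>r. L1 (bvec {r})) (sorted_list_of_set \<sigma>)
              in left_product mul 1 (hd xs) (tl xs)))"

definition removal_sign :: "nat \<Rightarrow> nat set \<Rightarrow> int" where
  "removal_sign r \<sigma> =
     (let xs = sorted_list_of_set (\<sigma> - {r}) @ [r]
      in sign (THE p. p permutes {..<length xs} \<and> permute_list p xs = sorted_list_of_set \<sigma>))"

definition Phi ::
    "nat \<Rightarrow> (nat \<Rightarrow> nat \<Rightarrow> ('b \<Rightarrow> 'a::comm_ring_1) \<Rightarrow> ('b \<Rightarrow> 'a) \<Rightarrow> ('b \<Rightarrow> 'a)) \<Rightarrow>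
     ((nat set \<Rightarrow> 'a) \<Rightarrow> ('b \<Rightarrow> 'a)) \<Rightarrow> nat \<Rightarrow> (nat set \<Rightarrow> 'a) \<Rightarrow> ('b \<times> nat set \<Rightarrow> 'a)" where
  "Phi n mul L1 i = lin_ext (koszul_basis n i)
     (\<lambda>\<sigma>. \<Sum>r\<in>\<sigma>. of_int (removal_sign r \<sigma>) \<odot>
        tens (comparison_map n mul L1 (i - 1) (bvec (\<sigma> - {r}))) (bvec {r}))"


section \<open>The two complexes\<close>

text \<open>The truncated Koszul complex, with \<open>K\<^sub>j\<^sub>+\<^sub>1\<close> in degree \<open>j \<ge> 1\<close> and \<open>0\<close> in degree \<open>0\<close>.\<close>

definition source_basis :: "nat \<Rightarrow> nat \<Rightarrow> nat set set" where
  "source_basis n j = (if j = 0 then {} else koszul_basis n (j + 1))"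

definition source_diff ::
    "nat \<Rightarrow> (nat \<Rightarrow> 'a::comm_ring_1) \<Rightarrow> nat \<Rightarrow> (nat set \<Rightarrow> 'a) \<Rightarrow> (nat set \<Rightarrow> 'a)" where
  "source_diff n g j = (if j \<le> 1 then 0 else koszul_diff n g (j + 1))"

text \<open>The complex with \<open>F\<^sub>j \<otimes> K\<^sub>1\<close> in degree \<open>j \<ge> 1\<close> and the ring in degree \<open>0\<close>. The basis of the ring
  is \<^term>\<open>None\<close>; the bases of the other terms are embedded by \<^term>\<open>Some\<close>.\<close>

definition target_basis :: "nat \<Rightarrow> (nat \<Rightarrow> 'b set) \<Rightarrow> nat \<Rightarrow> ('b \<times> nat set) option set" where
  "target_basis n B j = (if j = 0 then {None} else Some ` (B j \<times> koszul_basis n 1))"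

text \<open>The tensor product \<open>d\<^sub>1\<^sup>F \<otimes> d\<^sub>1\<^sup>K\<close> has values in \<open>F\<^sub>0 \<otimes> K\<^sub>0\<close>, which is identified with the ring
  through its only basis element \<open>(u, {})\<close>.\<close>

definition target_diff ::
    "nat \<Rightarrow> (nat \<Rightarrow> 'a::comm_ring_1) \<Rightarrow> 'b \<Rightarrow> (nat \<Rightarrow> 'b set) \<Rightarrow> (nat \<Rightarrow> ('b \<Rightarrow> 'a) \<Rightarrow> ('b \<Rightarrow> 'a)) \<Rightarrow>
     nat \<Rightarrow> (('b \<times> nat set) option \<Rightarrow> 'a) \<Rightarrow> (('b \<times> nat set) option \<Rightarrow> 'a)" where
  "target_diff n g u B d j x =
     (if j = 0 then 0
      else if j = 1 then
        case_option (- tensor_map (B 1) (koszul_basis n 1) (d 1) (koszul_diff n g 1) (x \<circ> Some) (u, {})) 0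
      else case_option 0 (tensor_map (B j) (koszul_basis n 1) (d j) id (x \<circ> Some)))"

definition target_degree ::
    "(nat \<Rightarrow> 'b \<Rightarrow> int) \<Rightarrow> (nat \<Rightarrow> int) \<Rightarrow> nat \<Rightarrow> ('b \<times> nat set) option \<Rightarrow> int" where
  "target_degree \<delta> e j = case_option 0 (\<lambda>(b, \<sigma>). \<delta> j b + koszul_degree e \<sigma>)"

text \<open>\<open>\<Phi>\<^sub>k\<close> is the component in degree \<open>k - 1\<close>.\<close>

definition Phi_morphism ::
    "nat \<Rightarrow> (nat \<Rightarrow> nat \<Rightarrow> ('b \<Rightarrow> 'a::comm_ring_1) \<Rightarrow> ('b \<Rightarrow> 'a) \<Rightarrow> ('b \<Rightarrow> 'a)) \<Rightarrow>
     ((nat set \<Rightarrow> 'a) \<Rightarrow> ('b \<Rightarrow> 'a)) \<Rightarrow> nat \<Rightarrow> (nat set \<Rightarrow> 'a) \<Rightarrow> (('b \<times> nat set) option \<Rightarrow> 'a)" where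
  "Phi_morphism n mul L1 j x = (if j = 0 then 0 else case_option 0 (Phi n mul L1 (j + 1) x))"

end

theory Submission
  imports Defs
begin

text \<open>Let \<open>T\<close> be the target complex. Since \<open>F\<close> is exact, the homology of \<open>T\<close> lives in degrees \<open>0\<close> and \<open>1\<close>:
  \<open>H\<^sub>0(T) = R/\<aa>I\<close>, and \<open>d\<^sub>1\<^sup>F \<otimes> 1\<close> identifies \<open>H\<^sub>1(T)\<close> with the cycles of \<open>K\<^sub>1\<close> that have coefficients
  in \<open>I\<close>. As \<open>K\<close> is exact and \<open>\<aa> \<subseteq> I\<close>, these are all the cycles of \<open>K\<^sub>1\<close>, i.e. the cokernel of
  \<open>K\<^sub>3 \<rightarrow> K\<^sub>2\<close>, which is the only homology of the source complex. The identification is the one induced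
  by \<open>\<Phi>\<^sub>2\<close>, because \<open>(d\<^sub>1\<^sup>F \<otimes> 1) \<Phi>\<^sub>2 = d\<^sub>2\<^sup>K\<close>. Hence the cone has homology only in degree \<open>0\<close>.

  That \<open>\<Phi>\<close> is a morphism reduces to the chain map property of the \<open>L\<^sub>i\<close>: the coefficient of
  \<open>\<Phi>\<^sub>i\<close> at \<open>f\<^sub>r\<close> is \<open>L\<^sub>i\<^sub>-\<^sub>1\<close> composed with the right contraction by \<open>f\<^sub>r\<close>, which commutes with \<open>d\<^sup>K\<close>.
  For left-ordered products, the Leibniz rule needs no associativity.

  For minimality, \<open>d\<^sub>1\<^sup>F(L\<^sub>1(f\<^sub>r)) \<in> \<aa> \<subseteq> \<mm>I = d\<^sub>1\<^sup>F(\<mm>F\<^sub>1)\<close>, so \<open>L\<^sub>1(f\<^sub>r) \<in> \<mm>F\<^sub>1 + d\<^sub>2\<^sup>F(F\<^sub>2) = \<mm>F\<^sub>1\<close>.\<close>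

section \<open>Based free modules\<close>

text \<open>The target is handled one slice at a time: F_j \<otimes> K_1 consists of n copies of
  F_j, one for each f_r, and in degrees j \<ge> 2 the differential acts on each copy as d^F. Lifting
  in F slice by slice settles everything except the interaction of the copies inside the target,
  which happens only in d_1 \<otimes> d_1. That map factors through K_1, so the interaction is
  governed by the Koszul complex. The long exact sequence of a cone is replaced by a chase on pairs
  (t, s): a Koszul preimage s' is chosen so that all slices of t - \<Phi> s' are cycles of F, which
  can then be lifted. The other obstacle is indices. The definition of d^K refers to positions in
  sorted lists and to the homological degree; it is replaced by one operator on all functions, whose
  signs count smaller elements. Since vectors are total functions, an equation at every index often
  needs membership in \<open>free_on\<close> to settle the indices outside the basis.\<close>

lemma subspace_free_on: "fun_module.subspace (free_on A)"
  by (auto simp: fun_module.subspace_def free_on_def smul_def)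

lemmas free_on_add = fun_module.subspace_add[OF subspace_free_on]
  and free_on_smul = fun_module.subspace_scale[OF subspace_free_on]
  and free_on_sum = fun_module.subspace_sum[OF subspace_free_on]
  and free_on_zero = fun_module.subspace_0[OF subspace_free_on]
  and free_on_diff = fun_module.subspace_diff[OF subspace_free_on]
  and free_on_uminus = fun_module.subspace_neg[OF subspace_free_on]

lemma linear_on_mem: "linear_on A C f \<Longrightarrow> x \<in> free_on A \<Longrightarrow> f x \<in> free_on C"
  by (auto simp: linear_on_def)

lemma linear_on_add: "linear_on A C f \<Longrightarrow> x \<in> free_on A \<Longrightarrow> y \<in> free_on A \<Longrightarrow> f (x + y) = f x + f y"
  by (auto simp: linear_on_def)

lemma linear_on_smul: "linear_on A C f \<Longrightarrow> x \<in> free_on A \<Longrightarrow> f (c \<odot> x) = c \<odot> f x"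
  by (auto simp: linear_on_def)

lemma linear_on_zero:
  assumes "linear_on A C f"
  shows "f 0 = 0"
  using linear_on_smul[OF assms free_on_zero, of 0] by simp

lemma linear_on_uminus:
  assumes "linear_on A C f" "x \<in> free_on A"
  shows "f (- x) = - f x"
  using linear_on_smul[OF assms, of "-1"] by simp

lemma linear_on_diff:
  assumes "linear_on A C f" "x \<in> free_on A" "y \<in> free_on A"
  shows "f (x - y) = f x - f y"
  using linear_on_add[OF assms(1,2) free_on_uminus[OF assms(3)]] linear_on_uminus[OF assms(1,3)]
  by simp

lemma linear_on_sum:
  assumes "linear_on A C f" "\<And>i. i \<in> S \<Longrightarrow> x i \<in> free_on A"
  shows "f (\<Sum>i\<in>S. c i \<odot> x i) = (\<Sum>i\<in>S. c i \<odot> f (x i))"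
  using assms(2)
proof (induction S rule: infinite_finite_induct)
  case (insert i S)
  then have "c i \<odot> x i \<in> free_on A" "(\<Sum>i\<in>S. c i \<odot> x i) \<in> free_on A"
    by (auto intro!: free_on_smul free_on_sum)
  then show ?case
    using insert by (simp only: sum.insert linear_on_add[OF assms(1)] linear_on_smul[OF assms(1)] insert_iff simp_thms)
qed (auto simp: linear_on_zero[OF assms(1)])

lemma linear_on_0: "linear_on A C 0"
  by (simp add: linear_on_def free_on_zero image_subset_iff)

text \<open>The predicate \<open>linear_on\<close> constrains a function only on
  \<open>free_on A\<close>, so linearity may be checked on any function that agrees with it
  there.\<close>

lemma linear_on_cong:
  assumes "linear_on A C f" "\<And>x. x \<in> free_on A \<Longrightarrow> f' x = f x"
  shows "linear_on A C f'"
  using assms unfolding linear_on_def image_subset_iff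
  by (simp add: free_on_add free_on_smul)

lemma linear_on_expand:
  assumes "finite A" "linear_on A C f" "x \<in> free_on A"
  shows "f x c = (\<Sum>a\<in>A. x a * f (bvec a) c)"
  using linear_on_eq_lin_ext[OF assms] by (simp add: lin_ext_apply)

lemma linear_on_eqI:
  assumes "finite A" "linear_on A C f" "linear_on A C h" "x \<in> free_on A"
    "\<And>a. a \<in> A \<Longrightarrow> f (bvec a) = h (bvec a)"
  shows "f x = h x"
  using assms by (intro ext) (simp add: linear_on_expand)

text \<open>The coefficients are indexed by \<open>A\<close> and not by the image of
  \<open>g\<close>, so repeated values of \<open>g\<close> cause no trouble and \<open>c\<close> can
  serve as the coordinates of a vector of K_1.\<close>

lemma ideal_gen_imageE:
  assumes "finite A" "x \<in> ideal_gen (g ` A)"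
  obtains c where "x = (\<Sum>r\<in>A. g r * c r)"
proof -
  have "ideal_gen (g ` A) \<subseteq> range (\<lambda>c. \<Sum>r\<in>A. g r * c r)"
  proof (rule module.span_minimal[OF module_mult])
    have "g a = (\<Sum>r\<in>A. g r * (if r = a then 1 else 0))" if "a \<in> A" for a
      using that assms(1) by (simp add: if_distrib cong: if_cong)
    then show "g ` A \<subseteq> range (\<lambda>c. \<Sum>r\<in>A. g r * c r)"
      by auto
    show "is_ideal (range (\<lambda>c. \<Sum>r\<in>A. g r * c r))"
      unfolding module.subspace_def[OF module_mult]
    proof (intro conjI ballI allI)
      show "0 \<in> range (\<lambda>c. \<Sum>r\<in>A. g r * c r)" by (rule range_eqI[where x="\<lambda>_. 0"]) simp
    next
      fix x y assume "x \<in> range (\<lambda>c. \<Sum>r\<in>A. g r * c r)" "y \<in> range (\<lambda>c. \<Sum>r\<in>A. g r * c r)"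
      then obtain c c' where "x = (\<Sum>r\<in>A. g r * c r)" "y = (\<Sum>r\<in>A. g r * c' r)" by auto
      then have "x + y = (\<Sum>r\<in>A. g r * (c r + c' r))"
        by (simp add: sum.distrib distrib_left)
      then show "x + y \<in> range (\<lambda>c. \<Sum>r\<in>A. g r * c r)" by (rule range_eqI[where x="\<lambda>r. c r + c' r"])
    next
      fix b x assume "x \<in> range (\<lambda>c. \<Sum>r\<in>A. g r * c r)"
      then obtain c where "x = (\<Sum>r\<in>A. g r * c r)" by auto
      then have "b * x = (\<Sum>r\<in>A. g r * (b * c r))"
        by (simp add: sum_distrib_left mult.left_commute)
      then show "b * x \<in> range (\<lambda>c. \<Sum>r\<in>A. g r * c r)" by (rule range_eqI[where x="\<lambda>r. b * c r"])
    qed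
  qed
  then show ?thesis using assms(2) that by blast
qed

lemma ideal_gen_image_sum: "(\<Sum>r\<in>A. g r * c r) \<in> ideal_gen (g ` A)"
  by (subst mult.commute)
    (intro module.span_sum[OF module_mult] module.span_scale[OF module_mult] module.span_base[OF module_mult] imageI)


section \<open>The Koszul complex in coordinates\<close>

text \<open>A formula for \<^const>\<open>koszul_diff\<close> that is uniform in the homological degree, by
  \<open>koszul_diff_eq_koszul_op\<close> below.\<close>

definition koszul_op :: "nat \<Rightarrow> (nat \<Rightarrow> 'a::comm_ring_1) \<Rightarrow> (nat set \<Rightarrow> 'a) \<Rightarrow> (nat set \<Rightarrow> 'a)" where
  "koszul_op n g x \<tau> = (\<Sum>r\<in>{1..n} - \<tau>. (-1) ^ card {s \<in> \<tau>. s < r} * (g r * x (insert r \<tau>)))"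

text \<open>With the next lemma, this presents the Koszul complex on n + 1 elements as the cone of
  multiplication by \<open>g (Suc n)\<close> on the one on n elements: indices without
  \<open>Suc n\<close> see both halves of x, indices with \<open>Suc n\<close> only the second half.
  The inductions on n rest on these two formulas.\<close>

lemma koszul_op_Suc:
  assumes "Suc n \<notin> \<tau>"
  shows "koszul_op (Suc n) g x \<tau> =
    koszul_op n g x \<tau> + (-1) ^ card {s \<in> \<tau>. s < Suc n} * (g (Suc n) * x (insert (Suc n) \<tau>))"
proof -
  have "{1..Suc n} - \<tau> = insert (Suc n) ({1..n} - \<tau>)" using assms by auto
  then show ?thesis by (simp add: koszul_op_def add.commute)
qed

lemma koszul_op_Suc_insert:
  assumes "Suc n \<notin> \<tau>"
  shows "koszul_op (Suc n) g x (insert (Suc n) \<tau>) = koszul_op n g (\<lambda>\<rho>. x (insert (Suc n) \<rho>)) \<tau>"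
proof -
  have "{1..Suc n} - insert (Suc n) \<tau> = {1..n} - \<tau>" using assms by auto
  \<comment> \<open>The new element exceeds every r, so it changes no sign.\<close>
  moreover have "{s \<in> insert (Suc n) \<tau>. s < r} = {s \<in> \<tau>. s < r}" if "r \<in> {1..n}" for r
    using that by auto
  ultimately show ?thesis
    unfolding koszul_op_def by (intro sum.cong) (auto simp: insert_commute)
qed

lemma koszul_op_cong:
  assumes "\<And>r. r \<in> {1..n} - \<tau> \<Longrightarrow> x (insert r \<tau>) = y (insert r \<tau>)"
  shows "koszul_op n g x \<tau> = koszul_op n g y \<tau>"
  using assms by (simp add: koszul_op_def)

lemma koszul_op_add: "koszul_op n g (x + y) = koszul_op n g x + koszul_op n g y"
  by (rule ext) (simp add: koszul_op_def distrib_left sum.distrib)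

lemma koszul_op_smul: "koszul_op n g (c \<odot> x) = c \<odot> koszul_op n g x"
  by (rule ext) (simp add: koszul_op_def smul_def sum_distrib_left mult_ac)

lemma koszul_op_zero: "koszul_op n g 0 = 0"
  by (rule ext) (simp add: koszul_op_def)

lemma koszul_basis_0: "koszul_basis n 0 = {{}}"
  by (auto simp: koszul_basis_def card_eq_0_iff dest: finite_subset)

lemma koszul_op_free_on:
  assumes "x \<in> free_on (koszul_basis n (Suc k))"
  shows "koszul_op n g x \<in> free_on (koszul_basis n k)"
  unfolding free_on_def
proof (intro CollectI allI impI)
  fix \<tau> assume \<tau>: "\<tau> \<notin> koszul_basis n k"
  have "insert r \<tau> \<notin> koszul_basis n (Suc k)" if "r \<in> {1..n} - \<tau>" for r
    using \<tau> that by (auto simp: koszul_basis_def card_insert_if dest: finite_subset)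
  then show "koszul_op n g x \<tau> = 0"
    using assms by (simp add: koszul_op_def free_on_def)
qed

lemma koszul_op_free_on_0:
  assumes "x \<in> free_on (koszul_basis n 0)"
  shows "koszul_op n g x = 0"
proof
  fix \<tau>
  have "insert r \<tau> \<notin> koszul_basis n 0" for r
    by (simp add: koszul_basis_0)
  then show "koszul_op n g x \<tau> = 0 \<tau>"
    using assms by (simp add: koszul_op_def free_on_def)
qed

text \<open>In the induction on n, only the terms mixing \<open>Suc n\<close> with a smaller r need
  an argument. They cancel because inserting r raises the number of elements below
  \<open>Suc n\<close> by one.\<close>

lemma koszul_op_koszul_op:
  assumes "finite \<tau>"
  shows "koszul_op n g (koszul_op n g x) \<tau> = 0"
  using assms
proof (induction n arbitrary: x \<tau>)
  case 0
  then show ?case by (simp add: koszul_op_def)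
next
  case (Suc n)
  define y where "y = (\<lambda>\<rho>. x (insert (Suc n) \<rho>))"
  show ?case
  proof (cases "Suc n \<in> \<tau>")
    case True
    then obtain \<rho> where \<rho>: "\<tau> = insert (Suc n) \<rho>" "Suc n \<notin> \<rho>" by (metis mk_disjoint_insert)
    have "koszul_op (Suc n) g (koszul_op (Suc n) g x) \<tau> =
        koszul_op n g (\<lambda>\<rho>. koszul_op (Suc n) g x (insert (Suc n) \<rho>)) \<rho>"
      using \<rho> by (simp add: koszul_op_Suc_insert)
    also have "\<dots> = koszul_op n g (koszul_op n g y) \<rho>"
      using \<rho> by (intro koszul_op_cong) (auto simp: koszul_op_Suc_insert y_def)
    finally show ?thesis using Suc \<rho> by simp
  next
    case False
    have "koszul_op n g (koszul_op (Suc n) g x) \<tau> =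
        koszul_op n g (koszul_op n g x + (- ((-1) ^ card {s \<in> \<tau>. s < Suc n}) * g (Suc n)) \<odot> y) \<tau>"
    proof (rule koszul_op_cong)
      fix r assume r: "r \<in> {1..n} - \<tau>"
      then have "{s \<in> insert r \<tau>. s < Suc n} = insert r {s \<in> \<tau>. s < Suc n}" by auto
      then have "card {s \<in> insert r \<tau>. s < Suc n} = Suc (card {s \<in> \<tau>. s < Suc n})"
        using r \<open>finite \<tau>\<close> by simp
      then show "koszul_op (Suc n) g x (insert r \<tau>) =
          (koszul_op n g x + (- ((-1) ^ card {s \<in> \<tau>. s < Suc n}) * g (Suc n)) \<odot> y) (insert r \<tau>)"
        using r False by (simp add: koszul_op_Suc y_def smul_def mult.assoc)
    qed
    also have "\<dots> = - ((-1) ^ card {s \<in> \<tau>. s < Suc n}) * g (Suc n) * koszul_op n g y \<tau>"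
      using Suc by (simp only: koszul_op_add koszul_op_smul) (simp add: smul_def)
    finally show ?thesis
      using False by (simp add: koszul_op_Suc[of n \<tau>] koszul_op_Suc_insert y_def mult.assoc)
  qed
qed

text \<open>Induction on \<open>n\<close>, with \<open>x = x\<^sub>0 + y \<and> f\<^sub>n\<^sub>+\<^sub>1\<close> where \<open>x\<^sub>0\<close> and \<open>y\<close> do not involve \<open>f\<^sub>n\<^sub>+\<^sub>1\<close>: first \<open>y\<close> is
  a boundary, then so is what remains of \<open>x\<close>. Regularity enters only when \<open>y\<close> has degree \<open>0\<close>.\<close>

lemma koszul_op_exact:
  assumes "\<forall>i\<in>{1..n}. \<forall>x. g i * x \<in> ideal_gen (g ` {1..<i}) \<longrightarrow> x \<in> ideal_gen (g ` {1..<i})"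
    and "x \<in> free_on (koszul_basis n (Suc k))" "koszul_op n g x = 0"
  shows "\<exists>y\<in>free_on (koszul_basis n (Suc (Suc k))). koszul_op n g y = x"
  using assms
proof (induction n arbitrary: x k)
  case 0
  then have "x = 0"
    by (auto simp: free_on_def koszul_basis_def fun_eq_iff)
  then show ?case
    using koszul_op_zero free_on_zero by blast
next
  case (Suc n)
  let ?m = "Suc n"
  note x = Suc.prems(2,3)
  define x0 where "x0 = (\<lambda>\<tau>. if ?m \<in> \<tau> then 0 else x \<tau>)"
  define y where "y = (\<lambda>\<tau>. if ?m \<in> \<tau> then 0 else x (insert ?m \<tau>))"
  have reg: "\<forall>i\<in>{1..n}. \<forall>x. g i * x \<in> ideal_gen (g ` {1..<i}) \<longrightarrow> x \<in> ideal_gen (g ` {1..<i})"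
    using Suc.prems(1) by auto
  have m: "{1..?m} = insert ?m {1..n}" by auto
  have kb: "insert ?m \<tau> \<in> koszul_basis ?m (Suc j) \<longleftrightarrow> \<tau> \<in> koszul_basis n j" if "?m \<notin> \<tau>" for \<tau> j
  proof -
    have "insert ?m \<tau> \<subseteq> {1..?m} \<longleftrightarrow> \<tau> \<subseteq> {1..n}"
      using that unfolding m by (simp add: subset_insert)
    moreover have "card (insert ?m \<tau>) = Suc (card \<tau>)" if "\<tau> \<subseteq> {1..n}"
      using finite_subset[OF that] \<open>?m \<notin> \<tau>\<close> by simp
    ultimately show ?thesis by (auto simp del: card_insert_disjoint simp: koszul_basis_def)
  qed
  have kb': "\<tau> \<in> koszul_basis ?m j \<longleftrightarrow> \<tau> \<in> koszul_basis n j" if "?m \<notin> \<tau>" for \<tau> j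
    using that unfolding koszul_basis_def m by (simp add: subset_insert)
  have kb'': "?m \<notin> \<tau>" if "\<tau> \<in> koszul_basis n j" for \<tau> j
    using that by (auto simp: koszul_basis_def)
  have x0: "x0 \<in> free_on (koszul_basis n (Suc k))"
    using x(1) kb' by (auto simp: free_on_def x0_def)
  have y: "y \<in> free_on (koszul_basis n k)"
    using x(1) kb by (auto simp: free_on_def y_def)
  \<comment> \<open>The part of the cycle condition that does not involve the last basis
    element.\<close>
  have eq: "koszul_op n g x \<tau> + (-1) ^ card {s \<in> \<tau>. s < ?m} * (g ?m * y \<tau>) = 0" if "?m \<notin> \<tau>" for \<tau>
    using koszul_op_Suc[OF that, of g x] x(2) that by (simp add: y_def)
  have Dy: "koszul_op n g y = 0"
  proof
    fix \<tau>
    have "koszul_op n g y \<tau> = koszul_op ?m g x (insert ?m \<tau>)" if "?m \<notin> \<tau>"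
      unfolding koszul_op_Suc_insert[OF that] by (rule koszul_op_cong) (use that in \<open>auto simp: y_def\<close>)
    moreover have "koszul_op n g y \<tau> = koszul_op n g 0 \<tau>" if "?m \<in> \<tau>"
      by (rule koszul_op_cong) (use that in \<open>auto simp: y_def\<close>)
    ultimately show "koszul_op n g y \<tau> = 0 \<tau>"
      using x(2) by (auto simp: koszul_op_zero)
  qed
  have "\<exists>y'\<in>free_on (koszul_basis n (Suc k)). koszul_op n g y' = y"
  proof (cases k)
    case 0
    have "g ?m * y {} = (\<Sum>r\<in>{1..n}. g r * (- x {r}))"
      using eq[of "{}"] by (simp add: koszul_op_def eq_neg_iff_add_eq_0 add.commute sum_negf)
    then have "g ?m * y {} \<in> ideal_gen (g ` {1..<?m})"
      using ideal_gen_image_sum[of g "\<lambda>r. - x {r}" "{1..n}"] by (simp add: atLeastLessThanSuc_atLeastAtMost)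
    moreover have "?m \<in> {1..?m}" by simp
    ultimately have "y {} \<in> ideal_gen (g ` {1..<?m})"
      using Suc.prems(1) by blast
    then have "y {} \<in> ideal_gen (g ` {1..n})"
      by (simp add: atLeastLessThanSuc_atLeastAtMost)
    then obtain c where c: "y {} = (\<Sum>r\<in>{1..n}. g r * c r)"
      by (rule ideal_gen_imageE[OF finite_atLeastAtMost])
    \<comment> \<open>The vector of K_1 with coordinates c; \<open>the_elem\<close> reads the index
      off a singleton.\<close>
    define y' where "y' = (\<lambda>\<tau>. if \<tau> \<in> koszul_basis n 1 then c (the_elem \<tau>) else 0)"
    have "y' {r} = c r" if "r \<in> {1..n}" for r
      using that by (simp add: y'_def koszul_basis_def)
    then have "koszul_op n g y' {} = y {}"
      unfolding c by (simp add: koszul_op_def)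
    moreover have y': "y' \<in> free_on (koszul_basis n (Suc k))"
      using 0 by (simp add: y'_def free_on_def)
    moreover have "koszul_op n g y' \<in> free_on {{}}" "y \<in> free_on {{}}"
      using koszul_op_free_on[OF y', of g] y 0 by (simp_all add: koszul_basis_0)
    ultimately have "koszul_op n g y' \<tau> = y \<tau>" for \<tau>
      by (cases "\<tau> = {}") (simp_all add: free_on_def)
    then have "koszul_op n g y' = y" ..
    then show ?thesis using y' by blast
  next
    case (Suc k')
    then show ?thesis using Suc.IH[OF reg _ Dy] y by simp
  qed
  then obtain y' where y': "y' \<in> free_on (koszul_basis n (Suc k))" "koszul_op n g y' = y" by blast
  \<comment> \<open>This is x minus the boundary of y' \<and> f_(n+1). As y' lives on sets with k +
    1 elements, its product with \<open>g ?m\<close> enters that boundary with sign (-1)^(k+1),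
    hence (-1)^k here.\<close>
  define w where "w = x0 + ((-1) ^ k * g ?m) \<odot> y'"
  have w: "w \<in> free_on (koszul_basis n (Suc k))"
    unfolding w_def by (intro free_on_add free_on_smul x0 y'(1))
  have "koszul_op n g w = koszul_op n g x0 + ((-1) ^ k * g ?m) \<odot> y"
    by (simp add: w_def koszul_op_add koszul_op_smul y'(2))
  also have "\<dots> = 0"
  proof
    fix \<tau>
    show "(koszul_op n g x0 + ((-1) ^ k * g ?m) \<odot> y) \<tau> = 0 \<tau>"
    proof (cases "\<tau> \<in> koszul_basis n k")
      case True
      note m = kb''[OF True]
      have "{s \<in> \<tau>. s < ?m} = \<tau>" "card \<tau> = k"
        using True by (auto simp: koszul_basis_def)
      moreover have "koszul_op n g x0 \<tau> = koszul_op n g x \<tau>"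
        by (rule koszul_op_cong) (use m in \<open>auto simp: x0_def\<close>)
      ultimately show ?thesis
        using eq[OF m] by (simp add: smul_def mult.assoc)
    next
      case False
      then show ?thesis
        using y koszul_op_free_on[OF x0, of g] by (simp add: free_on_def smul_def)
    qed
  qed
  finally obtain x' where x': "x' \<in> free_on (koszul_basis n (Suc (Suc k)))" "koszul_op n g x' = w"
    using Suc.IH[OF reg w] by blast
  \<comment> \<open>The preimage is x' + y' \<and> f_(n+1): the second summand accounts for x - w,
    the first for w.\<close>
  define z where "z = (\<lambda>\<tau>. if ?m \<in> \<tau> then y' (\<tau> - {?m}) else x' \<tau>)"
  have "z \<tau> = 0" if "\<tau> \<notin> koszul_basis ?m (Suc (Suc k))" for \<tau>
  proof (cases "?m \<in> \<tau>")
    case True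
    then have "\<tau> - {?m} \<notin> koszul_basis n (Suc k)"
      using kb[of "\<tau> - {?m}" "Suc k"] that by (simp add: insert_absorb)
    then show ?thesis using y'(1) True by (simp add: z_def free_on_def)
  next
    case False
    then show ?thesis using kb' that x'(1) by (simp add: z_def free_on_def)
  qed
  moreover have "koszul_op ?m g z \<tau> = x \<tau>" for \<tau>
  proof (cases "?m \<in> \<tau>")
    case True
    then obtain \<rho> where \<rho>: "\<tau> = insert ?m \<rho>" "?m \<notin> \<rho>" by (metis mk_disjoint_insert)
    have "koszul_op n g (\<lambda>\<rho>. z (insert ?m \<rho>)) \<rho> = koszul_op n g y' \<rho>"
      by (rule koszul_op_cong) (use \<rho> in \<open>auto simp: z_def\<close>)
    then show ?thesis
      using \<rho> y'(2) by (simp add: koszul_op_Suc_insert y_def)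
  next
    case False
    have 1: "koszul_op n g z \<tau> = w \<tau>"
      unfolding x'(2)[symmetric] by (rule koszul_op_cong) (use False in \<open>auto simp: z_def\<close>)
    have "(-1) ^ card {s \<in> \<tau>. s < ?m} * (g ?m * y' \<tau>) = - ((-1) ^ k * g ?m * y' \<tau>)"
    proof (cases "\<tau> \<in> koszul_basis n (Suc k)")
      case True
      then have "{s \<in> \<tau>. s < ?m} = \<tau>" "card \<tau> = Suc k"
        by (auto simp: koszul_basis_def)
      then show ?thesis by (simp add: mult.assoc)
    next
      case False
      then show ?thesis using y'(1) by (simp add: free_on_def)
    qed
    then show ?thesis
      using False 1 by (simp add: koszul_op_Suc z_def w_def x0_def smul_def)
  qed
  ultimately show ?case
    by (intro bexI[of _ z]) (auto simp: free_on_def)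
qed

text \<open>Right contraction by \<open>f\<^sub>r\<close>; the sign is that of moving \<open>r\<close> to the last position.\<close>

definition contract :: "nat \<Rightarrow> (nat set \<Rightarrow> 'a::comm_ring_1) \<Rightarrow> (nat set \<Rightarrow> 'a)" where
  "contract r x \<tau> = (if r \<in> \<tau> then 0 else (-1) ^ card {s \<in> \<tau>. r < s} * x (insert r \<tau>))"

lemma contract_free_on:
  assumes "x \<in> free_on (koszul_basis n (Suc k))"
  shows "contract r x \<in> free_on (koszul_basis n k)"
proof -
  have "insert r \<tau> \<notin> koszul_basis n (Suc k)" if "\<tau> \<notin> koszul_basis n k" "r \<notin> \<tau>" for \<tau>
    using that by (auto simp: koszul_basis_def card_insert_if dest: finite_subset)
  then show ?thesis
    using assms by (simp add: free_on_def contract_def)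
qed

text \<open>If r < s, then s joins the elements above r and r joins the elements below s; otherwise
  neither count changes. So the two signs change together and the operators commute. A contraction
  from the left would anticommute with the differential, which is also a left contraction.\<close>

lemma koszul_op_contract:
  assumes "finite \<tau>"
  shows "koszul_op n g (contract r x) \<tau> = contract r (koszul_op n g x) \<tau>"
proof (cases "r \<in> \<tau>")
  case False
  \<comment> \<open>The summand s = r vanishes because the contraction is 0 on sets that contain
    r.\<close>
  have "koszul_op n g (contract r x) \<tau> =
      (\<Sum>s\<in>{1..n} - insert r \<tau>. (-1) ^ card {t \<in> \<tau>. t < s} * (g s * contract r x (insert s \<tau>)))"
    unfolding koszul_op_def by (rule sum.mono_neutral_right) (auto simp: contract_def)
  also have "\<dots> = (\<Sum>s\<in>{1..n} - insert r \<tau>. (-1) ^ card {t \<in> \<tau>. r < t} *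
      ((-1) ^ card {t \<in> insert r \<tau>. t < s} * (g s * x (insert s (insert r \<tau>)))))"
  proof (rule sum.cong)
    fix s assume s: "s \<in> {1..n} - insert r \<tau>"
    have "{t \<in> insert s \<tau>. r < t} = (if r < s then insert s {t \<in> \<tau>. r < t} else {t \<in> \<tau>. r < t})"
      "{t \<in> insert r \<tau>. t < s} = (if r < s then insert r {t \<in> \<tau>. t < s} else {t \<in> \<tau>. t < s})"
      by auto
    then have sgn: "(-1) ^ card {t \<in> \<tau>. t < s} * (-1) ^ card {t \<in> insert s \<tau>. r < t} =
        ((-1) ^ card {t \<in> \<tau>. r < t} * (-1) ^ card {t \<in> insert r \<tau>. t < s} :: 'a)"
      using s False assms by simp
    have ctr: "contract r x (insert s \<tau>) =
        (-1) ^ card {t \<in> insert s \<tau>. r < t} * x (insert s (insert r \<tau>))"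
      using s False by (simp add: contract_def insert_commute)
    have comm: "p * (v * (q * y)) = p' * (q' * (v * y))" if "p * q = p' * q'" for p q p' q' v y :: 'a
    proof -
      have "p * (v * (q * y)) = p * q * (v * y)" "p' * (q' * (v * y)) = p' * q' * (v * y)"
        by (simp_all only: mult_ac)
      then show ?thesis using that by simp
    qed
    show "(-1) ^ card {t \<in> \<tau>. t < s} * (g s * contract r x (insert s \<tau>)) =
        (-1) ^ card {t \<in> \<tau>. r < t} * ((-1) ^ card {t \<in> insert r \<tau>. t < s} * (g s * x (insert s (insert r \<tau>))))"
      unfolding ctr by (rule comm[OF sgn])
  qed simp
  also have "\<dots> = contract r (koszul_op n g x) \<tau>"
    using False by (simp add: contract_def koszul_op_def sum_distrib_left)
  finally show ?thesis .
qed (simp add: koszul_op_def contract_def)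

section \<open>Positions in sorted lists and the Koszul differential\<close>

lemma nth_sorted_list_of_set_card_less:
  fixes A :: "'b::linorder set"
  assumes "finite A" "i < card A"
  shows "card {s \<in> A. s < sorted_list_of_set A ! i} = i"
proof -
  let ?xs = "sorted_list_of_set A"
  have len: "length ?xs = card A" by simp
  have lt: "?xs ! j < ?xs ! i \<longleftrightarrow> j < i" if "j < card A" for j
    using strict_sorted_list_of_set[of A] that assms(2) len
    by (metis linorder_neqE_nat order_less_asym sorted_wrt_nth_less)
  have "{s \<in> A. s < ?xs ! i} = (\<lambda>j. ?xs ! j) ` {..<i}"
  proof (intro subset_antisym subsetI)
    fix s assume s: "s \<in> {s \<in> A. s < ?xs ! i}"
    then obtain j where "j < card A" "s = ?xs ! j"
      using assms(1) len by (metis (no_types, lifting) in_set_conv_nth mem_Collect_eq set_sorted_list_of_set)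
    then show "s \<in> (\<lambda>j. ?xs ! j) ` {..<i}"
      using s lt by simp
  next
    fix s assume "s \<in> (\<lambda>j. ?xs ! j) ` {..<i}"
    then obtain j where j: "j < i" "s = ?xs ! j" by auto
    then have "j < card A" using assms(2) by simp
    then have "s \<in> set ?xs" using j(2) len by (metis nth_mem)
    then show "s \<in> {s \<in> A. s < ?xs ! i}"
      using j lt \<open>j < card A\<close> assms(1) by simp
  qed
  moreover have "inj_on (\<lambda>j. ?xs ! j) {..<i}"
    using assms(2) len by (auto simp: inj_on_def nth_eq_iff_index_eq)
  ultimately show ?thesis by (simp add: card_image)
qed

text \<open>Turns the list positions in \<open>koszul_diff\<close> into counts of smaller elements,
  which are the exponents in \<open>koszul_op\<close>.\<close>

lemma sum_sorted_list_of_set: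
  fixes A :: "'b::linorder set" and f :: "nat \<Rightarrow> 'b \<Rightarrow> 'c::comm_monoid_add"
  assumes "finite A"
  shows "(\<Sum>j<card A. f j (sorted_list_of_set A ! j)) = (\<Sum>r\<in>A. f (card {s \<in> A. s < r}) r)"
proof -
  let ?xs = "sorted_list_of_set A"
  have "(\<Sum>j<card A. f j (?xs ! j)) = (\<Sum>j<card A. f (card {s \<in> A. s < ?xs ! j}) (?xs ! j))"
    using assms by (simp add: nth_sorted_list_of_set_card_less)
  also have "\<dots> = (\<Sum>r\<in>A. f (card {s \<in> A. s < r}) r)"
  proof (rule sum.reindex_bij_betw)
    show "bij_betw (\<lambda>j. ?xs ! j) {..<card A} A"
      using assms bij_betw_nth[of ?xs "{..<card A}" A] by simp
  qed
  finally show ?thesis .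
qed

lemma koszul_diff_bvec:
  assumes "\<sigma> \<in> koszul_basis n k"
  shows "koszul_diff n g k (bvec \<sigma>) = (\<Sum>r\<in>\<sigma>. ((-1) ^ card {s \<in> \<sigma>. s < r} * g r) \<odot> bvec (\<sigma> - {r}))"
proof -
  have "finite (koszul_basis n k)" "finite \<sigma>"
    using assms by (auto simp: koszul_basis_def intro: finite_subset)
  then show ?thesis
    using assms sum_sorted_list_of_set[of \<sigma> "\<lambda>j r. ((-1) ^ j * g r) \<odot> bvec (\<sigma> - {r})"]
    by (simp add: koszul_diff_def lin_ext_bvec Let_def)
qed

lemma finite_koszul_basis: "finite (koszul_basis n k)"
  by (auto simp: koszul_basis_def)

lemma koszul_op_bvec:
  assumes "\<sigma> \<in> koszul_basis n k"
  shows "koszul_op n g (bvec \<sigma>) = (\<Sum>r\<in>\<sigma>. ((-1) ^ card {s \<in> \<sigma>. s < r} * g r) \<odot> bvec (\<sigma> - {r}))"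
proof
  fix \<tau>
  have \<sigma>: "finite \<sigma>" "\<sigma> \<subseteq> {1..n}"
    using assms by (auto simp: koszul_basis_def intro: finite_subset)
  \<comment> \<open>On both sides only those r with \<tau> = \<sigma> - {r} contribute.\<close>
  have "koszul_op n g (bvec \<sigma>) \<tau> =
      (\<Sum>r\<in>{r\<in>\<sigma>. \<tau> = \<sigma> - {r}}. (-1) ^ card {s \<in> \<tau>. s < r} * (g r * bvec \<sigma> (insert r \<tau>)))"
    unfolding koszul_op_def by (rule sum.mono_neutral_right) (use \<sigma> in \<open>auto simp: bvec_def\<close>)
  also have "\<dots> = (\<Sum>r\<in>{r\<in>\<sigma>. \<tau> = \<sigma> - {r}}. (-1) ^ card {s \<in> \<sigma>. s < r} * g r * bvec (\<sigma> - {r}) \<tau>)"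
  proof (rule sum.cong)
    fix r assume "r \<in> {r\<in>\<sigma>. \<tau> = \<sigma> - {r}}"
    then have "\<tau> = \<sigma> - {r}" "{s \<in> \<tau>. s < r} = {s \<in> \<sigma>. s < r}" "insert r \<tau> = \<sigma>" by auto
    then show "(-1) ^ card {s \<in> \<tau>. s < r} * (g r * bvec \<sigma> (insert r \<tau>)) =
        (-1) ^ card {s \<in> \<sigma>. s < r} * g r * bvec (\<sigma> - {r}) \<tau>"
      by (simp add: bvec_def)
  qed simp
  also have "\<dots> = (\<Sum>r\<in>\<sigma>. (-1) ^ card {s \<in> \<sigma>. s < r} * g r * bvec (\<sigma> - {r}) \<tau>)"
    by (rule sum.mono_neutral_left) (use \<sigma> in \<open>auto simp: bvec_def\<close>)
  finally show "koszul_op n g (bvec \<sigma>) \<tau> =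
      (\<Sum>r\<in>\<sigma>. ((-1) ^ card {s \<in> \<sigma>. s < r} * g r) \<odot> bvec (\<sigma> - {r})) \<tau>"
    by (simp add: sum_fun_apply smul_def)
qed

lemma koszul_basis_remove: "\<sigma> \<in> koszul_basis n k \<Longrightarrow> r \<in> \<sigma> \<Longrightarrow> \<sigma> - {r} \<in> koszul_basis n (k - 1)"
  by (auto simp: koszul_basis_def card_Diff_singleton_if)

lemma linear_on_koszul_diff: "linear_on (koszul_basis n k) (koszul_basis n (k - 1)) (koszul_diff n g k)"
proof (rule linear_on_cong[OF linear_on_lin_ext])
  fix \<sigma> assume \<sigma>: "\<sigma> \<in> koszul_basis n k"
  then show "koszul_diff n g k (bvec \<sigma>) \<in> free_on (koszul_basis n (k - 1))"
    unfolding koszul_diff_bvec[OF \<sigma>]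
    by (intro free_on_sum free_on_smul bvec_in_free_on koszul_basis_remove)
next
  fix x :: "nat set \<Rightarrow> 'a"
  show "koszul_diff n g k x = lin_ext (koszul_basis n k) (\<lambda>\<sigma>. koszul_diff n g k (bvec \<sigma>)) x"
    unfolding koszul_diff_def
    by (simp add: lin_ext_def lin_ext_bvec[unfolded lin_ext_def] finite_koszul_basis cong: sum.cong)
qed

lemma linear_on_koszul_op: "linear_on (koszul_basis n k) (koszul_basis n (k - 1)) (koszul_op n g)"
  unfolding linear_on_def
proof (intro conjI ballI allI)
  show "koszul_op n g ` free_on (koszul_basis n k) \<subseteq> free_on (koszul_basis n (k - 1))"
    by (cases k) (auto simp: koszul_op_free_on koszul_op_free_on_0 free_on_zero)
qed (simp_all only: koszul_op_add koszul_op_smul)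

text \<open>The restriction to K_k matters: on other functions \<open>koszul_diff\<close> drops the
  coefficients outside the basis, while \<open>koszul_op\<close> keeps them.\<close>

lemma koszul_diff_eq_koszul_op:
  assumes "x \<in> free_on (koszul_basis n k)"
  shows "koszul_diff n g k x = koszul_op n g x"
  by (rule linear_on_eqI[OF finite_koszul_basis linear_on_koszul_diff linear_on_koszul_op assms])
    (simp add: koszul_diff_bvec koszul_op_bvec)

section \<open>The sign of a removal\<close>

text \<open>The cycle \<open>q \<mapsto> q + l\<close>, \<open>i \<mapsto> i - 1\<close> for \<open>q < i \<le> q + l\<close>.\<close>

primrec shift_perm :: "nat \<Rightarrow> nat \<Rightarrow> nat \<Rightarrow> nat" where
  "shift_perm q 0 = id"
| "shift_perm q (Suc l) = transpose (q + l) (q + Suc l) \<circ> shift_perm q l"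

lemma shift_perm_apply:
  "shift_perm q l i = (if i < q \<or> q + l < i then i else if i = q then q + l else i - 1)"
  by (induction l arbitrary: i) (auto simp: transpose_def)

lemma shift_perm_permutes: "shift_perm q l permutes {..q + l}"
proof (induction l)
  case (Suc l)
  have "shift_perm q l permutes {..q + Suc l}"
    by (rule permutes_subset[OF Suc]) auto
  then show ?case
    unfolding shift_perm.simps by (rule permutes_compose) (auto intro!: permutes_swap_id)
next
  case 0
  then show ?case unfolding shift_perm.simps by (rule permutes_id)
qed

lemma sign_shift_perm: "sign (shift_perm q l) = (-1) ^ l"
proof (induction l)
  case (Suc l)
  have "permutation (shift_perm q l)"
    using shift_perm_permutes permutation_permutes by blast
  then have "sign (transpose (q + l) (q + Suc l) \<circ> shift_perm q l) =
      sign (transpose (q + l) (q + Suc l)) * sign (shift_perm q l)"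
    by (intro sign_compose permutation_swap_id)
  then show ?case
    unfolding shift_perm.simps by (simp only: Suc sign_swap_id) simp
qed simp

lemma sorted_list_of_set_split:
  fixes \<sigma> :: "'b::linorder set"
  assumes "finite \<sigma>" "r \<in> \<sigma>"
  shows "sorted_list_of_set \<sigma> =
    sorted_list_of_set {s\<in>\<sigma>. s < r} @ r # sorted_list_of_set {s\<in>\<sigma>. r < s}"
    and "sorted_list_of_set (\<sigma> - {r}) =
    sorted_list_of_set {s\<in>\<sigma>. s < r} @ sorted_list_of_set {s\<in>\<sigma>. r < s}"
proof -
  let ?a = "sorted_list_of_set {s\<in>\<sigma>. s < r}" and ?b = "sorted_list_of_set {s\<in>\<sigma>. r < s}"
  have fin: "finite {s\<in>\<sigma>. s < r}" "finite {s\<in>\<sigma>. r < s}" using assms by auto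
  have "set (?a @ r # ?b) = \<sigma>" "set (?a @ ?b) = \<sigma> - {r}"
    using assms fin by auto
  moreover have "sorted_wrt (<) (?a @ r # ?b)" "sorted_wrt (<) (?a @ ?b)"
    using fin by (auto simp: sorted_wrt_append strict_sorted_list_of_set)
  ultimately show "sorted_list_of_set \<sigma> = ?a @ r # ?b" "sorted_list_of_set (\<sigma> - {r}) = ?a @ ?b"
    by (metis sorted_list_of_set.idem_if_sorted_distinct strict_sorted_iff)+
qed

text \<open>Bringing r from the end of the list back to its place moves it past the elements larger
  than r, one adjacent transposition for each. The definite description in
  \<open>removal_sign\<close> denotes this cycle because the entries are distinct and a permutation
  of an initial segment is the identity beyond it.\<close>

lemma removal_sign_eq:
  assumes "finite \<sigma>" "r \<in> \<sigma>"
  shows "removal_sign r \<sigma> = (-1) ^ card {s \<in> \<sigma>. r < s}"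
proof -
  let ?a = "sorted_list_of_set {s\<in>\<sigma>. s < r}" and ?b = "sorted_list_of_set {s\<in>\<sigma>. r < s}"
  let ?q = "length ?a" and ?l = "length ?b"
  define xs where "xs = sorted_list_of_set (\<sigma> - {r}) @ [r]"
  have xs: "xs = ?a @ ?b @ [r]"
    using sorted_list_of_set_split(2)[OF assms] by (simp add: xs_def)
  have len: "length xs = Suc (?q + ?l)" by (simp add: xs)
  have dist: "distinct xs" using assms(1) by (simp add: xs_def)
  have perm: "shift_perm ?q ?l permutes {..<length xs}"
    using shift_perm_permutes[of ?q ?l] by (simp only: len lessThan_Suc_atMost)
  have list: "permute_list (shift_perm ?q ?l) xs = sorted_list_of_set \<sigma>"
  proof (rule nth_equalityI)
    show "length (permute_list (shift_perm ?q ?l) xs) = length (sorted_list_of_set \<sigma>)"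
      unfolding sorted_list_of_set_split(1)[OF assms] by (simp add: xs)
    fix i assume "i < length (permute_list (shift_perm ?q ?l) xs)"
    then have i: "i < length xs" by simp
    \<comment> \<open>Position \<open>?q\<close> reads the last entry, which is r; each later
      position reads one place earlier.\<close>
    have "xs ! shift_perm ?q ?l i = (?a @ r # ?b) ! i"
      using i unfolding len by (auto simp: xs nth_append shift_perm_apply nth_Cons' simp del: length_sorted_list_of_set)
    then show "permute_list (shift_perm ?q ?l) xs ! i = sorted_list_of_set \<sigma> ! i"
      using sorted_list_of_set_split(1)[OF assms] permute_list_nth[OF perm i] by simp
  qed
  have "(THE p. p permutes {..<length xs} \<and> permute_list p xs = sorted_list_of_set \<sigma>) = shift_perm ?q ?l"
  proof (rule the_equality)
    show "shift_perm ?q ?l permutes {..<length xs} \<and> permute_list (shift_perm ?q ?l) xs = sorted_list_of_set \<sigma>"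
      using perm list by simp
    fix p assume p: "p permutes {..<length xs} \<and> permute_list p xs = sorted_list_of_set \<sigma>"
    show "p = shift_perm ?q ?l"
    proof
      fix i
      show "p i = shift_perm ?q ?l i"
      proof (cases "i < length xs")
        case True
        then have "xs ! p i = xs ! shift_perm ?q ?l i"
          using p list perm by (metis permute_list_nth)
        moreover have "p i < length xs" "shift_perm ?q ?l i < length xs"
          using p perm True by (auto dest!: permutes_in_image[of _ _ i])
        ultimately show ?thesis
          using dist by (simp add: nth_eq_iff_index_eq)
      next
        case False
        then show ?thesis
          using p perm by (simp add: permutes_def)
      qed
    qed
  qed
  then show ?thesis
    using assms(1) by (simp add: removal_sign_def Let_def xs_def[symmetric] sign_shift_perm)
qed

section \<open>Comparison maps\<close>

lemma contract_bvec:
  assumes "finite \<sigma>" "r \<in> \<sigma>"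
  shows "contract r (bvec \<sigma>) = (-1) ^ card {s \<in> \<sigma>. r < s} \<odot> bvec (\<sigma> - {r})"
proof
  fix \<tau>
  show "contract r (bvec \<sigma>) \<tau> = ((-1) ^ card {s \<in> \<sigma>. r < s} \<odot> bvec (\<sigma> - {r})) \<tau>"
  proof (cases "\<tau> = \<sigma> - {r}")
    case True
    then have "{s \<in> \<tau>. r < s} = {s \<in> \<sigma>. r < s}" "insert r \<tau> = \<sigma>" "r \<notin> \<tau>"
      using assms by auto
    with True show ?thesis by (simp add: contract_def bvec_def smul_def)
  next
    case False
    then have "insert r \<tau> \<noteq> \<sigma>" if "r \<notin> \<tau>"
      using that by auto
    with False show ?thesis by (simp add: contract_def bvec_def smul_def)
  qed
qed

lemma contract_bvec_notin: "r \<notin> \<sigma> \<Longrightarrow> contract r (bvec \<sigma>) = 0"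
  by (auto simp: contract_def bvec_def fun_eq_iff)

lemma linear_on_contract: "linear_on (koszul_basis n (Suc k)) (koszul_basis n k) (contract r)"
  unfolding linear_on_def
  by (auto simp: contract_free_on image_subset_iff fun_eq_iff contract_def smul_def distrib_left
      mult.left_commute)

lemma linear_on_comp:
  assumes "linear_on A C f" "linear_on C D h"
  shows "linear_on A D (\<lambda>x. h (f x))"
  using assms unfolding linear_on_def image_subset_iff by simp

text \<open>Collecting the terms with a fixed c presents the tensor product as a sum of copies of
  the first factor, and f acts on each copy.\<close>

lemma tensor_map_apply:
  assumes "finite A" "finite C" "linear_on A D f" "y \<in> free_on (A \<times> C)"
  shows "tensor_map A C f h y (b, e) = (\<Sum>c\<in>C. f (\<lambda>a. y (a, c)) b * h (bvec c) e)"
proof -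
  have "tensor_map A C f h y (b, e) = (\<Sum>(a, c)\<in>A \<times> C. y (a, c) * (f (bvec a) b * h (bvec c) e))"
    unfolding tensor_map_def lin_ext_apply by (intro sum.cong) (auto simp: tens_def)
  also have "\<dots> = (\<Sum>a\<in>A. \<Sum>c\<in>C. y (a, c) * (f (bvec a) b * h (bvec c) e))"
    by (rule sum.cartesian_product[symmetric])
  also have "\<dots> = (\<Sum>c\<in>C. \<Sum>a\<in>A. y (a, c) * (f (bvec a) b * h (bvec c) e))"
    by (rule sum.swap)
  also have "\<dots> = (\<Sum>c\<in>C. f (\<lambda>a. y (a, c)) b * h (bvec c) e)"
  proof (rule sum.cong)
    fix c
    have "(\<lambda>a. y (a, c)) \<in> free_on A" using assms(4) by (simp add: free_on_def)
    then have "f (\<lambda>a. y (a, c)) b = (\<Sum>a\<in>A. y (a, c) * f (bvec a) b)"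
      by (rule linear_on_expand[OF assms(1,3)])
    then show "(\<Sum>a\<in>A. y (a, c) * (f (bvec a) b * h (bvec c) e)) = f (\<lambda>a. y (a, c)) b * h (bvec c) e"
      by (simp add: sum_distrib_right mult.assoc)
  qed simp
  finally show ?thesis .
qed

lemma tensor_map_id_apply:
  assumes "finite A" "finite C" "linear_on A D f" "y \<in> free_on (A \<times> C)"
  shows "tensor_map A C f id y (b, e) = (if e \<in> C then f (\<lambda>a. y (a, e)) b else 0)"
proof -
  have "tensor_map A C f id y (b, e) = (\<Sum>c\<in>C. if c = e then f (\<lambda>a. y (a, c)) b else 0)"
    unfolding tensor_map_apply[OF assms] by (rule sum.cong) (auto simp: bvec_def)
  then show ?thesis using assms(2) by simp
qed

section \<open>Left-ordered products of degree-one elements\<close>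

lemma left_product_snoc:
  "left_product mul i x (ys @ [y]) = mul (i + length ys) 1 (left_product mul i x ys) y"
  by (induction ys arbitrary: i x) simp_all

lemma sorted_list_of_set_insert_max:
  fixes \<tau> :: "'b::linorder set"
  assumes "finite \<tau>" "\<forall>s\<in>\<tau>. s < m"
  shows "sorted_list_of_set (insert m \<tau>) = sorted_list_of_set \<tau> @ [m]"
proof -
  have "{s \<in> insert m \<tau>. s < m} = \<tau>" "{s \<in> insert m \<tau>. m < s} = {}"
    using assms(2) by auto
  then show ?thesis
    using sorted_list_of_set_split(1)[of "insert m \<tau>" m] assms(1) by simp
qed

lemma koszul_basis_1: "koszul_basis n 1 = (\<lambda>r. {r}) ` {1..n}"
  by (auto simp: koszul_basis_def card_1_singleton_iff)

lemma tens_mem: "x \<in> free_on A \<Longrightarrow> y \<in> free_on C \<Longrightarrow> tens x y \<in> free_on (A \<times> C)"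
  by (auto simp: tens_def free_on_def)

text \<open>The data shared by all claims. Regularity, minimality and gradings are assumed in the
  lemmas that use them.\<close>

locale dg_resolution =
  fixes n :: nat and g :: "nat \<Rightarrow> 'a::comm_ring_1"
    and u :: 'b and B :: "nat \<Rightarrow> 'b set" and d :: "nat \<Rightarrow> ('b \<Rightarrow> 'a) \<Rightarrow> ('b \<Rightarrow> 'a)"
    and mul :: "nat \<Rightarrow> nat \<Rightarrow> ('b \<Rightarrow> 'a) \<Rightarrow> ('b \<Rightarrow> 'a) \<Rightarrow> ('b \<Rightarrow> 'a)"
    and L1 :: "(nat set \<Rightarrow> 'a) \<Rightarrow> ('b \<Rightarrow> 'a)"
    and I :: "'a set"
  assumes resolution: "free_resolution u B d I"
    and product: "dg_product u B d mul"
    and L1: "linear_on (koszul_basis n 1) (B 1) L1"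
      "\<forall>x\<in>free_on (koszul_basis n 1). d 1 (L1 x) u = koszul_diff n g 1 x {}"
begin

lemma B_0: "B 0 = {u}"
  and finite_B: "finite (B i)"
  and linear_d: "linear_on (B i) (B (i - 1)) (d i)"
  and d_0: "x \<in> free_on (B 0) \<Longrightarrow> d 0 x = 0"
  and d_d: "x \<in> free_on (B (Suc i)) \<Longrightarrow> d i (d (Suc i) x) = 0"
  using resolution by (auto simp: free_resolution_def free_complex_def)

lemma d_exact:
  assumes "i \<ge> 1" "x \<in> free_on (B i)" "d i x = 0"
  shows "\<exists>y\<in>free_on (B (Suc i)). d (Suc i) y = x"
proof -
  have "d (i + 1) ` free_on (B (i + 1)) = {x \<in> free_on (B i). d i x = 0}"
    using resolution assms(1) unfolding free_resolution_def by blast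
  then show ?thesis using assms(2,3) by force
qed

lemma d_1_image: "d 1 ` free_on (B 1) = {x \<in> free_on {u}. x u \<in> I}"
  using resolution by (simp add: free_resolution_def)

lemma linear_mul_left: "y \<in> free_on (B j) \<Longrightarrow> linear_on (B i) (B (i + j)) (\<lambda>x. mul i j x y)"
  and linear_mul_right: "x \<in> free_on (B i) \<Longrightarrow> linear_on (B j) (B (i + j)) (mul i j x)"
  and mul_unit_left: "x \<in> free_on (B i) \<Longrightarrow> mul 0 i (bvec u) x = x"
  and mul_unit_right: "x \<in> free_on (B i) \<Longrightarrow> mul i 0 x (bvec u) = x"
  and leibniz: "x \<in> free_on (B i) \<Longrightarrow> y \<in> free_on (B j) \<Longrightarrow>
      d (i + j) (mul i j x y) = mul (i - 1) j (d i x) y + (-1) ^ i \<odot> mul i (j - 1) x (d j y)"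
  using product unfolding dg_product_def bilinear_on_def by blast+

lemma mul_mem: "x \<in> free_on (B i) \<Longrightarrow> y \<in> free_on (B j) \<Longrightarrow> mul i j x y \<in> free_on (B (i + j))"
  using linear_on_mem[OF linear_mul_left] .

lemma bvec_u: "bvec u \<in> free_on (B 0)"
  by (simp add: B_0 bvec_in_free_on)

lemma free_on_B_0: "x \<in> free_on (B 0) \<Longrightarrow> x = x u \<odot> bvec u"
  by (auto simp: B_0 free_on_def smul_def bvec_def fun_eq_iff)

lemma d_1_L1:
  assumes "x \<in> free_on (koszul_basis n 1)"
  shows "d 1 (L1 x) = koszul_op n g x {} \<odot> bvec u"
proof -
  have "d 1 (L1 x) \<in> free_on (B 0)"
    using linear_on_mem[OF linear_d linear_on_mem[OF L1(1) assms]] by simp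
  from free_on_B_0[OF this] show ?thesis
    using L1(2) assms by (simp add: koszul_diff_eq_koszul_op)
qed

lemma koszul_op_bvec_singleton: "r \<in> {1..n} \<Longrightarrow> koszul_op n g (bvec {r}) {} = g r"
  by (subst koszul_op_bvec[of _ _ 1])
    (auto simp: koszul_basis_def smul_def bvec_def cong: conj_cong)

lemma L1_gen_mem: "r \<in> {1..n} \<Longrightarrow> L1 (bvec {r}) \<in> free_on (B 1)"
  and d_L1_gen: "r \<in> {1..n} \<Longrightarrow> d 1 (L1 (bvec {r})) = g r \<odot> bvec u"
proof -
  assume r: "r \<in> {1..n}"
  then have "bvec {r} \<in> free_on (koszul_basis n 1)"
    by (intro bvec_in_free_on) (simp add: koszul_basis_def)
  with r show "L1 (bvec {r}) \<in> free_on (B 1)" "d 1 (L1 (bvec {r})) = g r \<odot> bvec u"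
    using linear_on_mem[OF L1(1)] d_1_L1[of "bvec {r}"] koszul_op_bvec_singleton by simp_all
qed

text \<open>Starting from the unit includes the empty product, so inductions can begin at the empty
  set and a single factor is an instance of the general step. For nonempty \<sigma> the value is
  L_i(f_\<sigma>), with i the size of \<sigma>.\<close>

definition gen_prod :: "nat set \<Rightarrow> 'b \<Rightarrow> 'a" where
  "gen_prod \<sigma> = left_product mul 0 (bvec u) (map (\<lambda>r. L1 (bvec {r})) (sorted_list_of_set \<sigma>))"

lemma gen_prod_empty: "gen_prod {} = bvec u"
  by (simp add: gen_prod_def)

lemma gen_prod_insert:
  assumes "finite \<tau>" "\<forall>s\<in>\<tau>. s < m"
  shows "gen_prod (insert m \<tau>) = mul (card \<tau>) 1 (gen_prod \<tau>) (L1 (bvec {m}))"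
  by (simp add: gen_prod_def sorted_list_of_set_insert_max[OF assms] left_product_snoc)

lemma gen_prod_mem:
  assumes "finite \<sigma>" "\<sigma> \<subseteq> {1..n}"
  shows "gen_prod \<sigma> \<in> free_on (B (card \<sigma>))"
  using assms
proof (induction \<sigma> rule: finite_linorder_max_induct)
  case empty
  then show ?case by (simp add: gen_prod_empty bvec_u)
next
  case (insert m \<tau>)
  then have "m \<notin> \<tau>" by auto
  then show ?case
    using insert mul_mem[OF _ L1_gen_mem, of "gen_prod \<tau>" "card \<tau>" m]
    by (simp add: gen_prod_insert)
qed

text \<open>The Leibniz rule splits off the factor of largest index m. In the first summand,
  linearity in the left argument distributes multiplication by L_1(f_m) over the induction
  hypothesis, and the resulting products are again left-ordered because removing r < m leaves m
  last.\<close>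

lemma d_gen_prod:
  assumes "finite \<sigma>" "\<sigma> \<subseteq> {1..n}"
  shows "d (card \<sigma>) (gen_prod \<sigma>) =
    (\<Sum>r\<in>\<sigma>. ((-1) ^ card {s \<in> \<sigma>. s < r} * g r) \<odot> gen_prod (\<sigma> - {r}))"
  using assms
proof (induction \<sigma> rule: finite_linorder_max_induct)
  case empty
  then show ?case by (simp add: gen_prod_empty bvec_u d_0)
next
  case (insert m \<tau>)
  let ?q = "card \<tau>" and ?y = "L1 (bvec {m})"
  have m: "m \<notin> \<tau>" "m \<in> {1..n}" and \<tau>: "\<tau> \<subseteq> {1..n}" using insert by auto
  have mem: "gen_prod \<tau> \<in> free_on (B ?q)" using gen_prod_mem insert.hyps(1) \<tau> .
  have y: "?y \<in> free_on (B 1)" "d 1 ?y = g m \<odot> bvec u"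
    using L1_gen_mem d_L1_gen m(2) by auto
  have "d (card (insert m \<tau>)) (gen_prod (insert m \<tau>)) = d (?q + 1) (mul ?q 1 (gen_prod \<tau>) ?y)"
    using insert m(1) by (simp add: gen_prod_insert)
  also have "\<dots> = mul (?q - 1) 1 (d ?q (gen_prod \<tau>)) ?y + (-1) ^ ?q \<odot> mul ?q 0 (gen_prod \<tau>) (d 1 ?y)"
    using leibniz[OF mem y(1)] by simp
  also have "mul ?q 0 (gen_prod \<tau>) (d 1 ?y) = g m \<odot> gen_prod \<tau>"
    unfolding y(2) using linear_on_smul[OF linear_mul_right[OF mem] bvec_u] mul_unit_right[OF mem] by simp
  \<comment> \<open>For empty \<tau> the truncated \<open>?q - 1\<close> is 0 and both sides are
    0.\<close>
  also have "mul (?q - 1) 1 (d ?q (gen_prod \<tau>)) ?y =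
      (\<Sum>r\<in>\<tau>. ((-1) ^ card {s \<in> \<tau>. s < r} * g r) \<odot> mul (?q - 1) 1 (gen_prod (\<tau> - {r})) ?y)"
    unfolding insert.IH[OF \<tau>]
  proof (rule linear_on_sum[OF linear_mul_left[OF y(1)]])
    fix r assume "r \<in> \<tau>"
    then show "gen_prod (\<tau> - {r}) \<in> free_on (B (?q - 1))"
      using gen_prod_mem[of "\<tau> - {r}"] insert.hyps(1) \<tau> by (auto simp: card_Diff_singleton)
  qed
  also have "\<dots> = (\<Sum>r\<in>\<tau>. ((-1) ^ card {s \<in> insert m \<tau>. s < r} * g r) \<odot> gen_prod (insert m \<tau> - {r}))"
  proof (rule sum.cong)
    fix r assume r: "r \<in> \<tau>"
    then have "{s \<in> insert m \<tau>. s < r} = {s \<in> \<tau>. s < r}" "insert m \<tau> - {r} = insert m (\<tau> - {r})"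
      using insert.hyps(2) m(1) by auto
    moreover have "gen_prod (insert m (\<tau> - {r})) = mul (?q - 1) 1 (gen_prod (\<tau> - {r})) ?y"
      using gen_prod_insert[of "\<tau> - {r}" m] insert.hyps r by (simp add: card_Diff_singleton)
    ultimately show "((-1) ^ card {s \<in> \<tau>. s < r} * g r) \<odot> mul (?q - 1) 1 (gen_prod (\<tau> - {r})) ?y =
        ((-1) ^ card {s \<in> insert m \<tau>. s < r} * g r) \<odot> gen_prod (insert m \<tau> - {r})"
      by simp
  qed simp
  also have "(-1) ^ ?q \<odot> g m \<odot> gen_prod \<tau> =
      ((-1) ^ card {s \<in> insert m \<tau>. s < m} * g m) \<odot> gen_prod (insert m \<tau> - {m})"
  proof -
    have "{s \<in> insert m \<tau>. s < m} = \<tau>" "insert m \<tau> - {m} = \<tau>"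
      using insert.hyps(2) m(1) by auto
    then show ?thesis by simp
  qed
  finally show ?case
    unfolding sum.insert[OF insert.hyps(1) m(1)] by (simp only: add.commute)
qed

text \<open>The left unit law removes the initial unit of \<open>gen_prod\<close>. Degree 0 is
  excluded because \<open>comparison_map\<close> would there take \<open>hd\<close> of an empty
  list.\<close>

lemma comparison_map_bvec:
  assumes "\<sigma> \<in> koszul_basis n k" "k \<ge> 1"
  shows "comparison_map n mul L1 k (bvec \<sigma>) = gen_prod \<sigma>"
proof -
  let ?xs = "map (\<lambda>r. L1 (bvec {r})) (sorted_list_of_set \<sigma>)"
  have \<sigma>: "finite \<sigma>" "\<sigma> \<subseteq> {1..n}" "card \<sigma> = k"
    using assms(1) by (auto simp: koszul_basis_def intro: finite_subset)
  have "\<sigma> \<noteq> {}" using \<sigma> assms(2) by auto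
  then have ne: "sorted_list_of_set \<sigma> \<noteq> []" using \<sigma>(1) by simp
  have "hd (sorted_list_of_set \<sigma>) \<in> {1..n}"
    using hd_in_set[OF ne] \<sigma> by auto
  then have "mul 0 1 (bvec u) (hd ?xs) = hd ?xs"
    unfolding hd_map[OF ne] by (intro mul_unit_left L1_gen_mem)
  then have eq: "gen_prod \<sigma> = left_product mul 1 (hd ?xs) (tl ?xs)"
    unfolding gen_prod_def using ne by (cases "sorted_list_of_set \<sigma>") simp_all
  show ?thesis
  proof (cases "k = 1")
    case True
    then obtain r where "\<sigma> = {r}" using \<sigma>(3) by (metis card_1_singletonE)
    then show ?thesis using eq True by (simp add: comparison_map_def)
  next
    case False
    then show ?thesis
      using assms(1) eq by (simp add: comparison_map_def lin_ext_bvec finite_koszul_basis Let_def)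
  qed
qed

lemma linear_comparison_map:
  assumes "k \<ge> 1"
  shows "linear_on (koszul_basis n k) (B k) (comparison_map n mul L1 k)"
proof (cases "k = 1")
  case True
  then show ?thesis using L1(1) by (simp add: comparison_map_def)
next
  case False
  have "linear_on (koszul_basis n k) (B k) (lin_ext (koszul_basis n k) gen_prod)"
  proof (rule linear_on_lin_ext)
    fix \<sigma> assume "\<sigma> \<in> koszul_basis n k"
    then show "gen_prod \<sigma> \<in> free_on (B k)"
      using gen_prod_mem[of \<sigma>] by (auto simp: koszul_basis_def intro: finite_subset)
  qed
  then show ?thesis
  proof (rule linear_on_cong)
    fix x :: "nat set \<Rightarrow> 'a"
    have "gen_prod \<sigma> = (let xs = map (\<lambda>r. L1 (bvec {r})) (sorted_list_of_set \<sigma>)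
              in left_product mul 1 (hd xs) (tl xs))" if "\<sigma> \<in> koszul_basis n k" for \<sigma>
      using comparison_map_bvec[OF that assms] that False
      by (simp add: comparison_map_def lin_ext_bvec finite_koszul_basis)
    then show "comparison_map n mul L1 k x = lin_ext (koszul_basis n k) gen_prod x"
      using False unfolding comparison_map_def lin_ext_def by (simp cong: sum.cong)
  qed
qed

text \<open>The squares of the comparison map from degree 2 on; the one in degree 1 is
  \<open>d_1_L1\<close>. By linearity it suffices to treat basis vectors, where
  \<open>d_gen_prod\<close> applies.\<close>

lemma d_comparison_map:
  assumes "k \<ge> 1" "x \<in> free_on (koszul_basis n (Suc k))"
  shows "d (Suc k) (comparison_map n mul L1 (Suc k) x) = comparison_map n mul L1 k (koszul_op n g x)"
proof (rule linear_on_eqI[OF finite_koszul_basis, where C = "B k"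
      and f = "\<lambda>x. d (Suc k) (comparison_map n mul L1 (Suc k) x)"
      and h = "\<lambda>x. comparison_map n mul L1 k (koszul_op n g x)"])
  show "linear_on (koszul_basis n (Suc k)) (B k) (\<lambda>x. d (Suc k) (comparison_map n mul L1 (Suc k) x))"
    using linear_on_comp[OF linear_comparison_map linear_d, of "Suc k"] by simp
  show "linear_on (koszul_basis n (Suc k)) (B k) (\<lambda>x. comparison_map n mul L1 k (koszul_op n g x))"
    using linear_on_koszul_op[of n "Suc k" g] by (intro linear_on_comp[OF _ linear_comparison_map[OF assms(1)]]) simp
  fix \<sigma> assume \<sigma>: "\<sigma> \<in> koszul_basis n (Suc k)"
  then have fin: "finite \<sigma>" "\<sigma> \<subseteq> {1..n}" "card \<sigma> = Suc k"
    by (auto simp: koszul_basis_def intro: finite_subset)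
  have "comparison_map n mul L1 k (koszul_op n g (bvec \<sigma>)) =
      (\<Sum>r\<in>\<sigma>. ((-1) ^ card {s \<in> \<sigma>. s < r} * g r) \<odot> comparison_map n mul L1 k (bvec (\<sigma> - {r})))"
    unfolding koszul_op_bvec[OF \<sigma>]
    using koszul_basis_remove[OF \<sigma>]
    by (intro linear_on_sum[OF linear_comparison_map[OF assms(1)]] bvec_in_free_on) simp
  also have "\<dots> = (\<Sum>r\<in>\<sigma>. ((-1) ^ card {s \<in> \<sigma>. s < r} * g r) \<odot> gen_prod (\<sigma> - {r}))"
    using koszul_basis_remove[OF \<sigma>] assms(1) by (intro sum.cong) (simp_all add: comparison_map_bvec)
  also have "\<dots> = d (Suc k) (gen_prod \<sigma>)"
    using d_gen_prod[OF fin(1,2)] fin(3) by simp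
  finally show "d (Suc k) (comparison_map n mul L1 (Suc k) (bvec \<sigma>)) =
      comparison_map n mul L1 k (koszul_op n g (bvec \<sigma>))"
    using \<sigma> by (simp add: comparison_map_bvec)
qed (rule assms(2))

text \<open>The factor f_s has a nonzero coefficient at {r} only for s = r, and by
  \<open>removal_sign_eq\<close> the remaining sign is the one in \<open>contract\<close>.\<close>

lemma Phi_contract:
  assumes "k \<ge> 1" "x \<in> free_on (koszul_basis n (Suc k))" "r \<in> {1..n}"
  shows "Phi n mul L1 (Suc k) x (b, {r}) = comparison_map n mul L1 k (contract r x) b"
proof -
  let ?L = "comparison_map n mul L1 k"
  have lin: "linear_on (koszul_basis n (Suc k)) (B k) (\<lambda>x. ?L (contract r x))"
    by (rule linear_on_comp[OF linear_on_contract linear_comparison_map[OF assms(1)]])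
  have "Phi n mul L1 (Suc k) x (b, {r}) = (\<Sum>\<sigma>\<in>koszul_basis n (Suc k). x \<sigma> *
      (\<Sum>s\<in>\<sigma>. of_int (removal_sign s \<sigma>) * (?L (bvec (\<sigma> - {s})) b * bvec {s} {r})))"
    by (simp add: Phi_def lin_ext_apply sum_fun_apply smul_def tens_def)
  also have "\<dots> = (\<Sum>\<sigma>\<in>koszul_basis n (Suc k). x \<sigma> * ?L (contract r (bvec \<sigma>)) b)"
  proof (rule sum.cong)
    fix \<sigma> assume \<sigma>: "\<sigma> \<in> koszul_basis n (Suc k)"
    then have fin: "finite \<sigma>" by (auto simp: koszul_basis_def intro: finite_subset)
    have "(\<Sum>s\<in>\<sigma>. of_int (removal_sign s \<sigma>) * (?L (bvec (\<sigma> - {s})) b * bvec {s} {r})) =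
        (\<Sum>s\<in>\<sigma>. if s = r then of_int (removal_sign r \<sigma>) * ?L (bvec (\<sigma> - {r})) b else 0)"
      by (rule sum.cong) (auto simp: bvec_def)
    also have "\<dots> = ?L (contract r (bvec \<sigma>)) b"
    proof (cases "r \<in> \<sigma>")
      case True
      have "?L ((-1) ^ card {s \<in> \<sigma>. r < s} \<odot> bvec (\<sigma> - {r})) =
          (-1) ^ card {s \<in> \<sigma>. r < s} \<odot> ?L (bvec (\<sigma> - {r}))"
        using koszul_basis_remove[OF \<sigma> True]
        by (intro linear_on_smul[OF linear_comparison_map[OF assms(1)]] bvec_in_free_on) simp
      then show ?thesis
        using True fin by (simp add: contract_bvec removal_sign_eq smul_def)
    next
      case False
      then show ?thesis
        using fin linear_on_zero[OF linear_comparison_map[OF assms(1)]] by (simp add: contract_bvec_notin)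
    qed
    finally show "x \<sigma> * (\<Sum>s\<in>\<sigma>. of_int (removal_sign s \<sigma>) * (?L (bvec (\<sigma> - {s})) b * bvec {s} {r})) =
        x \<sigma> * ?L (contract r (bvec \<sigma>)) b"
      by simp
  qed simp
  also have "\<dots> = ?L (contract r x) b"
    by (rule linear_on_expand[OF finite_koszul_basis lin assms(2), symmetric])
  finally show ?thesis .
qed

lemma linear_Phi:
  assumes "k \<ge> 1"
  shows "linear_on (koszul_basis n (Suc k)) (B k \<times> koszul_basis n 1) (Phi n mul L1 (Suc k))"
  unfolding Phi_def
proof (rule linear_on_lin_ext)
  fix \<sigma> assume \<sigma>: "\<sigma> \<in> koszul_basis n (Suc k)"
  show "(\<Sum>r\<in>\<sigma>. of_int (removal_sign r \<sigma>) \<odot>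
        tens (comparison_map n mul L1 (Suc k - 1) (bvec (\<sigma> - {r}))) (bvec {r}))
      \<in> free_on (B k \<times> koszul_basis n 1)"
  proof (intro free_on_sum free_on_smul)
    fix r assume r: "r \<in> \<sigma>"
    then have "comparison_map n mul L1 k (bvec (\<sigma> - {r})) \<in> free_on (B k)"
      using linear_on_mem[OF linear_comparison_map[OF assms]] koszul_basis_remove[OF \<sigma> r]
      by (simp add: bvec_in_free_on)
    moreover have "bvec {r} \<in> free_on (koszul_basis n 1)"
      using r \<sigma> by (intro bvec_in_free_on) (auto simp: koszul_basis_def)
    ultimately show "tens (comparison_map n mul L1 (Suc k - 1) (bvec (\<sigma> - {r}))) (bvec {r})
        \<in> free_on (B k \<times> koszul_basis n 1)"
      unfolding diff_Suc_1 by (rule tens_mem)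
  qed
qed

end

section \<open>The morphism and its cone\<close>

lemma lin_ext_add: "lin_ext A \<phi> (x + y) = lin_ext A \<phi> x + lin_ext A \<phi> y"
  by (rule ext) (simp add: lin_ext_apply distrib_right sum.distrib)

lemma lin_ext_smul: "lin_ext A \<phi> (c \<odot> x) = c \<odot> lin_ext A \<phi> x"
  by (rule ext) (simp add: lin_ext_apply smul_def sum_distrib_left mult.assoc)

lemma koszul_op_empty: "koszul_op n g y {} = (\<Sum>r\<in>{1..n}. g r * y {r})"
  by (simp add: koszul_op_def)

text \<open>Extends \<open>koszul_op_contract\<close> to all indices: outside the basis of K_k, in
  particular at infinite sets, both sides are 0.\<close>

lemma contract_koszul_op:
  assumes "x \<in> free_on (koszul_basis n (Suc (Suc k)))"
  shows "koszul_op n g (contract r x) = contract r (koszul_op n g x)"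
proof
  fix \<tau>
  show "koszul_op n g (contract r x) \<tau> = contract r (koszul_op n g x) \<tau>"
  proof (cases "\<tau> \<in> koszul_basis n k")
    case True
    then show ?thesis
      by (intro koszul_op_contract) (auto simp: koszul_basis_def intro: finite_subset)
  next
    case False
    then show ?thesis
      using koszul_op_free_on[OF contract_free_on[OF assms]] contract_free_on[OF koszul_op_free_on[OF assms]]
      by (simp add: free_on_def)
  qed
qed

section \<open>Mapping cones\<close>

lemma free_on_cone_basis:
  "z \<in> free_on (cone_basis BS BT j) \<longleftrightarrow>
    z \<circ> Inl \<in> free_on (BT j) \<and> z \<circ> Inr \<in> free_on (if j = 0 then {} else BS (j - 1))"
proof
  assume "z \<in> free_on (cone_basis BS BT j)"
  then show "z \<circ> Inl \<in> free_on (BT j) \<and> z \<circ> Inr \<in> free_on (if j = 0 then {} else BS (j - 1))"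
    by (auto simp: free_on_def cone_basis_def)
next
  assume *: "z \<circ> Inl \<in> free_on (BT j) \<and> z \<circ> Inr \<in> free_on (if j = 0 then {} else BS (j - 1))"
  have "z p = 0" if "p \<notin> cone_basis BS BT j" for p
    using * that by (cases p) (auto simp: free_on_def cone_basis_def split: if_splits)
  then show "z \<in> free_on (cone_basis BS BT j)"
    by (simp add: free_on_def)
qed

lemma case_sum_comp: "case_sum x y \<circ> Inl = x" "case_sum x y \<circ> Inr = y"
  by (simp_all add: fun_eq_iff)

text \<open>Applied twice to (t, s), the differential has the T component d \<phi> s - \<phi> d s,
  whose minus sign comes from the sign on the source; it vanishes because \<phi> commutes with the
  differentials.\<close>

lemma free_complex_cone:
  fixes BS :: "nat \<Rightarrow> 's set" and BT :: "nat \<Rightarrow> 't set"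
    and dS :: "nat \<Rightarrow> ('s \<Rightarrow> 'a::comm_ring_1) \<Rightarrow> ('s \<Rightarrow> 'a)"
  assumes "complex_morphism BS dS BT dT \<phi>"
  shows "free_complex (cone_basis BS BT) (cone_diff dS dT \<phi>)"
proof -
  have S: "finite (BS i)" "linear_on (BS i) (BS (i - 1)) (dS i)"
      "x \<in> free_on (BS 0) \<Longrightarrow> dS 0 x = 0" "x \<in> free_on (BS (i + 1)) \<Longrightarrow> dS i (dS (i + 1) x) = 0"
    and T: "finite (BT i)" "linear_on (BT i) (BT (i - 1)) (dT i)"
      "y \<in> free_on (BT (i + 1)) \<Longrightarrow> dT i (dT (i + 1) y) = 0"
    and \<phi>: "linear_on (BS i) (BT i) (\<phi> i)"
      "i \<ge> 1 \<Longrightarrow> x \<in> free_on (BS i) \<Longrightarrow> dT i (\<phi> i x) = \<phi> (i - 1) (dS i x)" for i x y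
    using assms unfolding complex_morphism_def free_complex_def by blast+
  let ?B = "cone_basis BS BT" and ?d = "cone_diff dS dT \<phi>"
  have fin: "finite (?B i)" for i
    using S(1) T(1) by (simp add: cone_basis_def)
  have split: "z = case_sum (z \<circ> Inl) (z \<circ> Inr)" for z :: "'t + 's \<Rightarrow> 'a"
    by (simp add: fun_eq_iff split: sum.split)
  have comp_add: "(z + w) \<circ> f = (z \<circ> f) + (w \<circ> f)" and comp_smul: "(c \<odot> z) \<circ> f = c \<odot> (z \<circ> f)"
    for z w :: "'t + 's \<Rightarrow> 'a" and f :: "'e \<Rightarrow> 't + 's" and c
    by (simp_all add: fun_eq_iff smul_def)
  have lin: "linear_on (?B j) (?B (j - 1)) (?d j)" for j
  proof (cases j)
    case 0
    then show ?thesis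
      by (auto simp: linear_on_def cone_diff_def free_on_zero)
  next
    case (Suc i)
    have mem: "z \<circ> Inl \<in> free_on (BT (Suc i))" "z \<circ> Inr \<in> free_on (BS i)"
      if "z \<in> free_on (?B (Suc i))" for z :: "'t + 's \<Rightarrow> 'a"
      using that by (auto simp: free_on_cone_basis)
    have d: "?d (Suc i) z = case_sum (dT (Suc i) (z \<circ> Inl) + \<phi> i (z \<circ> Inr)) (- dS i (z \<circ> Inr))" for z
      by (simp add: cone_diff_def)
    show ?thesis
      unfolding Suc linear_on_def
    proof (intro conjI ballI allI subsetI)
      fix y assume "y \<in> ?d (Suc i) ` free_on (?B (Suc i))"
      then obtain z where z: "z \<in> free_on (?B (Suc i))" "y = ?d (Suc i) z" by blast
      have "dT (Suc i) (z \<circ> Inl) + \<phi> i (z \<circ> Inr) \<in> free_on (BT i)"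
        using linear_on_mem[OF T(2)[of "Suc i"]] linear_on_mem[OF \<phi>(1)] mem[OF z(1)]
        by (intro free_on_add) auto
      \<comment> \<open>For i = 0 the target has no S part. Truncated subtraction makes
        \<open>dS 0\<close> a map from S_0 to itself, but it is 0.\<close>
      moreover have "- dS i (z \<circ> Inr) \<in> free_on (if i = 0 then {} else BS (i - 1))"
        using linear_on_mem[OF S(2)[of i]] S(3) mem[OF z(1)] by (auto intro!: free_on_uminus simp: free_on_zero)
      ultimately show "y \<in> free_on (?B (Suc i - 1))"
        by (simp add: z(2) d free_on_cone_basis case_sum_comp)
    next
      fix x y :: "'t + 's \<Rightarrow> 'a" assume "x \<in> free_on (?B (Suc i))" "y \<in> free_on (?B (Suc i))"
      note xy = mem[OF this(1)] mem[OF this(2)]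
      show "?d (Suc i) (x + y) = ?d (Suc i) x + ?d (Suc i) y"
        unfolding d comp_add linear_on_add[OF T(2) xy(1,3)] linear_on_add[OF \<phi>(1) xy(2,4)]
          linear_on_add[OF S(2) xy(2,4)]
        by (auto simp: fun_eq_iff split: sum.split)
    next
      fix c and x :: "'t + 's \<Rightarrow> 'a" assume "x \<in> free_on (?B (Suc i))"
      note x = mem[OF this]
      show "?d (Suc i) (c \<odot> x) = c \<odot> ?d (Suc i) x"
        unfolding d comp_smul linear_on_smul[OF T(2) x(1)] linear_on_smul[OF \<phi>(1) x(2)]
          linear_on_smul[OF S(2) x(2)]
        by (auto simp: fun_eq_iff smul_def distrib_left split: sum.split)
    qed
  qed
  have dd: "?d j (?d (j + 1) z) = 0" if "z \<in> free_on (?B (j + 1))" for j z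
  proof (cases j)
    case (Suc i)
    have t: "z \<circ> Inl \<in> free_on (BT (j + 1))" and s: "z \<circ> Inr \<in> free_on (BS j)"
      using that by (auto simp: free_on_cone_basis)
    have "dT j (dT (j + 1) (z \<circ> Inl) + \<phi> j (z \<circ> Inr)) + \<phi> (j - 1) (- dS j (z \<circ> Inr)) = 0"
    proof -
      have "dT j (dT (j + 1) (z \<circ> Inl) + \<phi> j (z \<circ> Inr)) =
          dT j (dT (j + 1) (z \<circ> Inl)) + dT j (\<phi> j (z \<circ> Inr))"
        using linear_on_mem[OF T(2)[of "j + 1"] t] linear_on_mem[OF \<phi>(1) s] linear_on_add[OF T(2)]
        by simp
      moreover have "\<phi> (j - 1) (- dS j (z \<circ> Inr)) = - \<phi> (j - 1) (dS j (z \<circ> Inr))"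
        by (rule linear_on_uminus[OF \<phi>(1) linear_on_mem[OF S(2) s]])
      ultimately show ?thesis using T(3)[OF t] \<phi>(2)[OF _ s] Suc by simp
    qed
    moreover have "- dS (j - 1) (- dS j (z \<circ> Inr)) = 0"
      using linear_on_uminus[OF S(2) linear_on_mem[OF S(2) s]] S(4)[of "z \<circ> Inr" "j - 1"] s Suc
      by simp
    ultimately show ?thesis
      using Suc by (simp add: cone_diff_def case_sum_comp) (auto simp: fun_eq_iff split: sum.split)
  qed (simp add: cone_diff_def)
  show ?thesis
    unfolding free_complex_def using fin lin dd by (auto simp: cone_diff_def)
qed

section \<open>The target complex, slice by slice\<close>

context dg_resolution
begin

text \<open>The F-coefficient of x at the basis element \<tau> of K_1. It is used for arbitrary
  \<tau>; outside the basis it is 0 by \<open>slice_notin\<close>.\<close>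

abbreviation "slice \<tau> x \<equiv> (\<lambda>a. x (Some (a, \<tau>)))"

lemma target_comp_Some:
  assumes "j \<ge> 1" "x \<in> free_on (target_basis n B j)"
  shows "x \<circ> Some \<in> free_on (B j \<times> koszul_basis n 1)"
  using assms by (auto simp: free_on_def target_basis_def)

lemma slice_mem:
  assumes "j \<ge> 1" "x \<in> free_on (target_basis n B j)"
  shows "slice \<tau> x \<in> free_on (B j)"
  using target_comp_Some[OF assms] by (simp add: free_on_def)

lemma slice_notin:
  assumes "j \<ge> 1" "x \<in> free_on (target_basis n B j)" "\<tau> \<notin> koszul_basis n 1"
  shows "slice \<tau> x = 0"
  using target_comp_Some[OF assms(1,2)] assms(3) by (simp add: free_on_def fun_eq_iff)

lemma free_on_target_basisI:
  assumes "j \<ge> 1" "x None = 0" "\<And>\<tau>. \<tau> \<in> koszul_basis n 1 \<Longrightarrow> slice \<tau> x \<in> free_on (B j)"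
    "\<And>\<tau>. \<tau> \<notin> koszul_basis n 1 \<Longrightarrow> slice \<tau> x = 0"
  shows "x \<in> free_on (target_basis n B j)"
proof -
  have "x p = 0" if p: "p \<notin> Some ` (B j \<times> koszul_basis n 1)" for p
  proof (cases p)
    case (Some q)
    obtain b \<tau> where q: "q = (b, \<tau>)" by fastforce
    then have "b \<notin> B j \<or> \<tau> \<notin> koszul_basis n 1" using p Some by auto
    moreover have "slice \<tau> x b = 0" if "\<tau> \<notin> koszul_basis n 1"
      using assms(4)[OF that] by (metis zero_fun_apply)
    ultimately show ?thesis using assms(3)[of \<tau>] Some q by (auto simp: free_on_def)
  qed (simp add: assms(2))
  then show ?thesis using assms(1) by (auto simp: free_on_def target_basis_def)
qed

text \<open>Reduces the target in degrees at least 2 to copies of F. There is no condition on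
  \<tau>, since both sides are 0 outside the basis of K_1.\<close>

lemma slice_target_diff:
  assumes "j \<ge> 2" "x \<in> free_on (target_basis n B j)"
  shows "slice \<tau> (target_diff n g u B d j x) = d j (slice \<tau> x)"
proof -
  have j: "j \<ge> 1" using assms(1) by simp
  have "slice \<tau> (target_diff n g u B d j x) = (if \<tau> \<in> koszul_basis n 1 then d j (slice \<tau> x) else 0)"
    using assms(1) tensor_map_id_apply[OF finite_B finite_koszul_basis linear_d target_comp_Some[OF j assms(2)]]
    by (auto simp: target_diff_def)
  then show ?thesis
    using slice_notin[OF j assms(2), of \<tau>] linear_on_zero[OF linear_d, of j] by auto
qed

lemma target_diff_None: "j \<ge> 2 \<Longrightarrow> target_diff n g u B d j x None = 0"
  by (simp add: target_diff_def)

text \<open>The vector is the image of x under d_1^F \<otimes> 1, read in K_1 through the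
  identification of F_0 with the ring.\<close>

lemma d_1_slices_mem:
  assumes "x \<in> free_on (target_basis n B 1)"
  shows "(\<lambda>\<tau>. d 1 (slice \<tau> x) u) \<in> free_on (koszul_basis n 1)"
  using slice_notin[OF _ assms] linear_on_zero[OF linear_d, of 1] by (simp add: free_on_def)

text \<open>Factors d_1^F \<otimes> d_1^K as d_1^K after d_1^F \<otimes> 1. A degree-one cycle of
  the target thus yields a cycle of K_1, to which Koszul exactness applies.\<close>

lemma target_diff_1:
  assumes "x \<in> free_on (target_basis n B 1)"
  shows "target_diff n g u B d 1 x None = - koszul_op n g (\<lambda>\<tau>. d 1 (slice \<tau> x) u) {}"
proof -
  have "target_diff n g u B d 1 x None =
      - (\<Sum>c\<in>koszul_basis n 1. d 1 (slice c x) u * koszul_diff n g 1 (bvec c) {})"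
    using tensor_map_apply[OF finite_B finite_koszul_basis linear_d target_comp_Some[OF _ assms]]
    by (simp add: target_diff_def)
  also have "\<dots> = - (\<Sum>c\<in>koszul_basis n 1. d 1 (slice c x) u * koszul_op n g (bvec c) {})"
    by (simp only: koszul_diff_eq_koszul_op[OF bvec_in_free_on] cong: sum.cong)
  also have "\<dots> = - koszul_op n g (\<lambda>\<tau>. d 1 (slice \<tau> x) u) {}"
    using linear_on_expand[OF finite_koszul_basis linear_on_koszul_op d_1_slices_mem[OF assms]] by simp
  finally show ?thesis .
qed

lemma target_diff_mem:
  assumes "x \<in> free_on (target_basis n B j)"
  shows "target_diff n g u B d j x \<in> free_on (target_basis n B (j - 1))"
proof -
  consider "j = 0" | "j = 1" | "j \<ge> 2" by linarith
  then show ?thesis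
  proof cases
    case 1
    then show ?thesis by (simp add: target_diff_def free_on_zero)
  next
    case 2
    have "p \<notin> target_basis n B 0 \<Longrightarrow> target_diff n g u B d 1 x p = 0" for p
      by (cases p) (auto simp: target_basis_def target_diff_def)
    then show ?thesis using 2 by (simp add: free_on_def)
  next
    case 3
    show ?thesis
    proof (rule free_on_target_basisI)
      show "j - 1 \<ge> 1" "target_diff n g u B d j x None = 0" using 3 by (simp_all add: target_diff_None)
    qed (use 3 assms slice_notin[of j x] slice_mem[of j x] linear_on_mem[OF linear_d] linear_on_zero[OF linear_d]
        in \<open>auto simp: slice_target_diff\<close>)
  qed
qed

lemma linear_target_diff: "linear_on (target_basis n B j) (target_basis n B (j - 1)) (target_diff n g u B d j)"
  unfolding linear_on_def
proof (intro conjI ballI allI)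
  show "target_diff n g u B d j ` free_on (target_basis n B j) \<subseteq> free_on (target_basis n B (j - 1))"
    using target_diff_mem by blast
next
  fix x y :: "('b \<times> nat set) option \<Rightarrow> 'a"
  have comp: "(x + y) \<circ> Some = (x \<circ> Some) + (y \<circ> Some)" by (simp add: fun_eq_iff)
  show "target_diff n g u B d j (x + y) = target_diff n g u B d j x + target_diff n g u B d j y"
    unfolding target_diff_def tensor_map_def comp lin_ext_add
    by (auto simp: fun_eq_iff split: option.split)
next
  fix c and x :: "('b \<times> nat set) option \<Rightarrow> 'a"
  have comp: "(c \<odot> x) \<circ> Some = c \<odot> (x \<circ> Some)" by (simp add: fun_eq_iff smul_def)
  show "target_diff n g u B d j (c \<odot> x) = c \<odot> target_diff n g u B d j x"
    unfolding target_diff_def tensor_map_def comp lin_ext_smul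
    by (auto simp: fun_eq_iff smul_def[of c] split: option.split)
qed

lemma target_eqI:
  assumes "x None = y None" "\<And>\<tau>. slice \<tau> x = slice \<tau> y"
  shows "x = y"
proof
  fix p
  show "x p = y p"
  proof (cases p)
    case (Some q)
    then show ?thesis
      using fun_cong[OF assms(2)[of "snd q"], of "fst q"] by simp
  qed (simp add: assms(1))
qed

lemma free_complex_target: "free_complex (target_basis n B) (target_diff n g u B d)"
  unfolding free_complex_def
proof (intro conjI allI ballI)
  show "finite (target_basis n B i)" for i
    using finite_B finite_koszul_basis by (simp add: target_basis_def)
  show "target_diff n g u B d i (target_diff n g u B d (i + 1) x) = 0"
    if x: "x \<in> free_on (target_basis n B (i + 1))" for i x
  proof -
    consider "i = 0" | "i = 1" | "i \<ge> 2" by linarith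
    then show ?thesis
    proof cases
      case 1
      then show ?thesis by (simp add: target_diff_def)
    next
      case 2
      let ?y = "target_diff n g u B d 2 x"
      have x: "x \<in> free_on (target_basis n B 2)" using x 2 by (simp add: numeral_2_eq_2)
      have "d 1 (slice \<tau> ?y) = 0" for \<tau>
        using d_d[of "slice \<tau> x" 1] slice_mem[OF _ x] slice_target_diff[OF _ x, of \<tau>] by (simp add: numeral_2_eq_2)
      then have "target_diff n g u B d 1 ?y None = - koszul_op n g 0 {}"
        using target_diff_1[of ?y] target_diff_mem[OF x] by (simp add: zero_fun_def)
      then have "target_diff n g u B d 1 ?y = 0"
        by (intro target_eqI) (simp_all add: koszul_op_zero target_diff_def fun_eq_iff)
      then show ?thesis using 2 by (simp add: numeral_2_eq_2)
    next
      case 3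
      show ?thesis
      proof (rule target_eqI)
        show "slice \<tau> (target_diff n g u B d i (target_diff n g u B d (i + 1) x)) = slice \<tau> 0" for \<tau>
          using 3 target_diff_mem[OF x] slice_target_diff[OF _ x, of \<tau>] d_d[of "slice \<tau> x" i] slice_mem[OF _ x]
          by (simp add: slice_target_diff fun_eq_iff)
      qed (use 3 in \<open>simp add: target_diff_None\<close>)
    qed
  qed
  show "target_diff n g u B d 0 x = 0" for x by (simp add: target_diff_def)
qed (rule linear_target_diff)

section \<open>The truncated Koszul complex\<close>

lemma source_diff_eq:
  assumes "j \<ge> 2" "x \<in> free_on (source_basis n j)"
  shows "source_diff n g j x = koszul_op n g x"
  using assms by (simp add: source_diff_def source_basis_def koszul_diff_eq_koszul_op)

lemma linear_source_diff: "linear_on (source_basis n j) (source_basis n (j - 1)) (source_diff n g j)"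
proof (cases "j \<ge> 2")
  case True
  then show ?thesis
    using linear_on_koszul_diff[of n "j + 1" g] by (simp add: source_basis_def source_diff_def)
next
  case False
  then show ?thesis
    using linear_on_0 by (simp add: source_diff_def)
qed

lemma free_complex_source: "free_complex (source_basis n) (source_diff n g)"
  unfolding free_complex_def
proof (intro conjI allI ballI)
  show "finite (source_basis n i)" for i
    by (simp add: source_basis_def finite_koszul_basis)
  show "source_diff n g i (source_diff n g (i + 1) x) = 0"
    if x: "x \<in> free_on (source_basis n (i + 1))" for i x
  proof (cases "i \<ge> 2")
    case True
    have "koszul_op n g (koszul_op n g x) = 0"
    proof
      fix \<tau>
      have x: "x \<in> free_on (koszul_basis n (Suc (Suc i)))" using x by (simp add: source_basis_def)
      have i: "Suc (i - 1) = i" using True by simp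
      have mem: "koszul_op n g (koszul_op n g x) \<in> free_on (koszul_basis n i)"
        using koszul_op_free_on[OF koszul_op_free_on[OF x]] .
      show "koszul_op n g (koszul_op n g x) \<tau> = 0 \<tau>"
      proof (cases "finite \<tau>")
        case False
        then have "\<tau> \<notin> koszul_basis n i" by (auto simp: koszul_basis_def dest: finite_subset)
        then show ?thesis using mem by (simp add: free_on_def)
      qed (simp add: koszul_op_koszul_op)
    qed
    then show ?thesis
      using True x linear_on_mem[OF linear_source_diff x] by (simp add: source_diff_eq)
  next
    case False
    then show ?thesis by (simp add: source_diff_def)
  qed
  show "source_diff n g 0 x = 0" for x by (simp add: source_diff_def)
qed (rule linear_source_diff)

section \<open>The maps \<Phi> as a morphism of complexes\<close>

lemma Phi_morphism_None: "Phi_morphism n mul L1 j x None = 0"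
  by (simp add: Phi_morphism_def)

lemma slice_Phi_morphism:
  assumes "j \<ge> 1" "x \<in> free_on (koszul_basis n (Suc j))" "r \<in> {1..n}"
  shows "slice {r} (Phi_morphism n mul L1 j x) = comparison_map n mul L1 j (contract r x)"
  using assms Phi_contract[OF assms] by (auto simp: Phi_morphism_def)

lemma slice_Phi_morphism_notin:
  assumes "j \<ge> 1" "x \<in> free_on (koszul_basis n (Suc j))" "\<tau> \<notin> koszul_basis n 1"
  shows "slice \<tau> (Phi_morphism n mul L1 j x) = 0"
  using assms(1,3) linear_on_mem[OF linear_Phi[OF assms(1)] assms(2)]
  by (auto simp: Phi_morphism_def free_on_def fun_eq_iff)

lemma linear_Phi_morphism: "linear_on (source_basis n j) (target_basis n B j) (Phi_morphism n mul L1 j)"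
proof (cases "j = 0")
  case True
  then show ?thesis
    by (simp add: linear_on_def Phi_morphism_def free_on_zero image_subset_iff)
next
  case False
  note lin = linear_Phi[of j]
  have s: "source_basis n j = koszul_basis n (Suc j)" using False by (simp add: source_basis_def)
  show ?thesis
    unfolding linear_on_def s
  proof (intro conjI ballI allI subsetI)
    fix y assume "y \<in> Phi_morphism n mul L1 j ` free_on (koszul_basis n (Suc j))"
    then obtain x where x: "x \<in> free_on (koszul_basis n (Suc j))" "y = Phi_morphism n mul L1 j x" by blast
    have "y p = 0" if "p \<notin> Some ` (B j \<times> koszul_basis n 1)" for p
      using that linear_on_mem[OF lin x(1)] False x(2)
      by (cases p) (auto simp: Phi_morphism_def free_on_def)
    then show "y \<in> free_on (target_basis n B j)"
      using False by (simp add: free_on_def target_basis_def)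
  next
    fix x y :: "nat set \<Rightarrow> 'a"
    assume "x \<in> free_on (koszul_basis n (Suc j))" "y \<in> free_on (koszul_basis n (Suc j))"
    then show "Phi_morphism n mul L1 j (x + y) = Phi_morphism n mul L1 j x + Phi_morphism n mul L1 j y"
      using False linear_on_add[OF lin] by (auto simp: Phi_morphism_def fun_eq_iff split: option.split)
  next
    fix c and x :: "nat set \<Rightarrow> 'a"
    assume "x \<in> free_on (koszul_basis n (Suc j))"
    then show "Phi_morphism n mul L1 j (c \<odot> x) = c \<odot> Phi_morphism n mul L1 j x"
      using False linear_on_smul[OF lin] by (auto simp: Phi_morphism_def fun_eq_iff smul_def split: option.split)
  qed
qed

text \<open>The coefficient of d^K x at f_r is the contraction of d^K x by f_r, with sign exponent
  0. Contraction may be moved inside d^K, and d_1^K of the contraction is d_1^F L_1 of it.\<close>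

lemma d_1_slice_Phi_morphism:
  assumes "x \<in> free_on (koszul_basis n 2)"
  shows "(\<lambda>\<tau>. d 1 (slice \<tau> (Phi_morphism n mul L1 1 x)) u) = koszul_op n g x"
proof
  fix \<tau>
  have x: "x \<in> free_on (koszul_basis n (Suc 1))" using assms by (simp add: numeral_2_eq_2)
  show "d 1 (slice \<tau> (Phi_morphism n mul L1 1 x)) u = koszul_op n g x \<tau>"
  proof (cases "\<tau> \<in> koszul_basis n 1")
    case True
    then obtain r where r: "\<tau> = {r}" "r \<in> {1..n}" unfolding koszul_basis_1 by blast
    have "slice \<tau> (Phi_morphism n mul L1 1 x) = L1 (contract r x)"
      using slice_Phi_morphism[OF _ x r(2)] r(1) by (simp add: comparison_map_def)
    then have "d 1 (slice \<tau> (Phi_morphism n mul L1 1 x)) u = koszul_op n g (contract r x) {}"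
      using d_1_L1[OF contract_free_on[OF x]] by (simp add: smul_def bvec_def)
    then show ?thesis
      by (simp add: koszul_op_contract r(1)) (simp add: contract_def)
  next
    case False
    then show ?thesis
      using slice_Phi_morphism_notin[OF _ x False] koszul_op_free_on[OF x, of g] linear_on_zero[OF linear_d, of 1]
      by (simp add: free_on_def)
  qed
qed

text \<open>In degree 1 the source differential is 0, and the other side is the composite - d_1^K
  d_2^K. In higher degrees the equation is checked on slices, where it combines the chain map
  property of L with the commutation of d^K and contractions.\<close>

lemma Phi_morphism_chain:
  assumes "j \<ge> 1" "x \<in> free_on (source_basis n j)"
  shows "target_diff n g u B d j (Phi_morphism n mul L1 j x) = Phi_morphism n mul L1 (j - 1) (source_diff n g j x)"
proof (cases "j = 1")
  case True
  have x: "x \<in> free_on (koszul_basis n 2)" using assms True by (simp add: source_basis_def numeral_2_eq_2)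
  have "target_diff n g u B d 1 (Phi_morphism n mul L1 1 x) None = - koszul_op n g (koszul_op n g x) {}"
    using target_diff_1 linear_on_mem[OF linear_Phi_morphism assms(2)] d_1_slice_Phi_morphism[OF x] True by simp
  then have "target_diff n g u B d 1 (Phi_morphism n mul L1 1 x) = 0"
    by (intro target_eqI) (simp_all add: koszul_op_koszul_op target_diff_def fun_eq_iff)
  then show ?thesis using True by (simp add: Phi_morphism_def)
next
  case False
  then obtain i where i: "j = Suc i" "i \<ge> 1" using assms(1) by (cases j) auto
  have x: "x \<in> free_on (koszul_basis n (Suc (Suc i)))" using assms(2) i by (simp add: source_basis_def)
  note mem = linear_on_mem[OF linear_Phi_morphism assms(2)]
  have Dx: "koszul_op n g x \<in> free_on (koszul_basis n (Suc i))" by (rule koszul_op_free_on[OF x])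
  have sd: "source_diff n g j x = koszul_op n g x" using source_diff_eq[OF _ assms(2)] i by simp
  show ?thesis
  proof (rule target_eqI)
    show "target_diff n g u B d j (Phi_morphism n mul L1 j x) None =
        Phi_morphism n mul L1 (j - 1) (source_diff n g j x) None"
      using i by (simp add: target_diff_None Phi_morphism_None)
    fix \<tau>
    have eq: "slice \<tau> (target_diff n g u B d j (Phi_morphism n mul L1 j x)) =
        d j (slice \<tau> (Phi_morphism n mul L1 j x))"
      using slice_target_diff[OF _ mem] i by simp
    show "slice \<tau> (target_diff n g u B d j (Phi_morphism n mul L1 j x)) =
        slice \<tau> (Phi_morphism n mul L1 (j - 1) (source_diff n g j x))"
    proof (cases "\<tau> \<in> koszul_basis n 1")
      case True
      then obtain r where r: "\<tau> = {r}" "r \<in> {1..n}" unfolding koszul_basis_1 by blast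
      have "d (Suc i) (slice {r} (Phi_morphism n mul L1 (Suc i) x)) =
          comparison_map n mul L1 i (contract r (koszul_op n g x))"
        using slice_Phi_morphism[OF _ x r(2)] d_comparison_map[OF i(2) contract_free_on[OF x]]
          contract_koszul_op[OF x] by simp
      then show ?thesis
        unfolding eq using slice_Phi_morphism[OF i(2) Dx r(2)] i(1) r(1) sd by simp
    next
      case False
      then show ?thesis
        unfolding eq using slice_Phi_morphism_notin[OF _ x False] slice_Phi_morphism_notin[OF i(2) Dx False]
          i(1) sd linear_on_zero[OF linear_d, of j] by simp
    qed
  qed
qed

lemma complex_morphism_Phi:
  "complex_morphism (source_basis n) (source_diff n g) (target_basis n B) (target_diff n g u B d)
    (Phi_morphism n mul L1)"
  unfolding complex_morphism_def
  using free_complex_source free_complex_target linear_Phi_morphism Phi_morphism_chain by blast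

end

section \<open>Exactness of the cone in positive degrees\<close>

context dg_resolution
begin

text \<open>Exactness of F in every slice. In degree 1 the hypothesis asks that d_1^F \<otimes> 1
  kill x, which is stronger than being a cycle of the target: the homology there need not
  vanish.\<close>

lemma target_exact:
  assumes "j \<ge> 1" "x \<in> free_on (target_basis n B j)" "\<And>\<tau>. d j (slice \<tau> x) = 0"
  shows "\<exists>y\<in>free_on (target_basis n B (Suc j)). target_diff n g u B d (Suc j) y = x"
proof -
  have "\<exists>w. w \<in> free_on (B (Suc j)) \<and> d (Suc j) w = slice \<tau> x" for \<tau>
    using d_exact[OF assms(1) slice_mem[OF assms(1,2)] assms(3)] by blast
  then obtain w where w: "\<And>\<tau>. w \<tau> \<in> free_on (B (Suc j))" "\<And>\<tau>. d (Suc j) (w \<tau>) = slice \<tau> x"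
    by metis
  \<comment> \<open>The chosen lifts \<open>w \<tau>\<close> may be nonzero outside the basis of
    K_1, where they are cut off.\<close>
  define y where "y = case_option 0 (\<lambda>(b, \<tau>). if \<tau> \<in> koszul_basis n 1 then w \<tau> b else 0)"
  have slice_y: "slice \<tau> y = (if \<tau> \<in> koszul_basis n 1 then w \<tau> else 0)" for \<tau>
    by (auto simp: y_def)
  have y: "y \<in> free_on (target_basis n B (Suc j))"
  proof (rule free_on_target_basisI)
    show "y None = 0" by (simp add: y_def)
  qed (use w(1) slice_y in auto)
  have "target_diff n g u B d (Suc j) y = x"
  proof (rule target_eqI)
    have "x None = 0"
      using assms(1,2) by (auto simp: free_on_def target_basis_def)
    then show "target_diff n g u B d (Suc j) y None = x None"
      using assms(1) by (simp add: target_diff_None)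
    show "slice \<tau> (target_diff n g u B d (Suc j) y) = slice \<tau> x" for \<tau>
      using slice_target_diff[OF _ y, of \<tau>] assms(1) slice_notin[OF assms(1,2), of \<tau>] w(2)[of \<tau>]
        slice_y[of \<tau>] linear_on_zero[OF linear_d, of "Suc j"] by auto
  qed
  then show ?thesis using y by blast
qed

abbreviation "cone_B \<equiv> cone_basis (source_basis n) (target_basis n B)"

abbreviation "cone_d \<equiv> cone_diff (source_diff n g) (target_diff n g u B d) (Phi_morphism n mul L1)"

lemma cone_d_Suc:
  "cone_d (Suc j) z = case_sum
    (target_diff n g u B d (Suc j) (z \<circ> Inl) + Phi_morphism n mul L1 j (z \<circ> Inr)) (- source_diff n g j (z \<circ> Inr))"
  by (simp add: cone_diff_def)

lemma koszul_exact:
  assumes "regular_sequence n g" "x \<in> free_on (koszul_basis n (Suc k))" "koszul_op n g x = 0"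
  obtains y where "y \<in> free_on (koszul_basis n (Suc (Suc k)))" "koszul_op n g y = x"
  using koszul_op_exact[OF _ assms(2,3)] assms(1) unfolding regular_sequence_def by blast

lemma slice_diff: "slice \<tau> (x - y) = slice \<tau> x - slice \<tau> y"
  by (simp add: fun_eq_iff)

lemma slice_add: "slice \<tau> (x + y) = slice \<tau> x + slice \<tau> y"
  by (simp add: fun_eq_iff)

text \<open>The source part s' of the preimage is determined by the Koszul complex: its boundary
  must cancel s, and for i = 0 it must make d_1^F \<otimes> 1 agree on t and \<Phi> s'. What remains
  of t is a cycle in every slice and is lifted by \<open>target_exact\<close>. Note that s has
  source degree i, so s lies in K_(i+1), and s = 0 for i = 0.\<close>

lemma cone_exact:
  assumes reg: "regular_sequence n g" and z: "z \<in> free_on (cone_B (Suc i))" "cone_d (Suc i) z = 0"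
  shows "\<exists>y\<in>free_on (cone_B (Suc (Suc i))). cone_d (Suc (Suc i)) y = z"
proof -
  define t s where "t = z \<circ> Inl" and "s = z \<circ> Inr"
  have split: "z = case_sum t s"
    by (simp add: t_def s_def fun_eq_iff split: sum.split)
  have t: "t \<in> free_on (target_basis n B (Suc i))" and s: "s \<in> free_on (source_basis n i)"
    using z(1) by (auto simp: free_on_cone_basis t_def s_def)
  have eqs: "target_diff n g u B d (Suc i) t + Phi_morphism n mul L1 i s = 0" "source_diff n g i s = 0"
  proof -
    have "case_sum (target_diff n g u B d (Suc i) t + Phi_morphism n mul L1 i s) (- source_diff n g i s) = 0"
      using z(2) by (simp only: cone_d_Suc t_def s_def)
    from fun_cong[OF this, of "Inl _"] fun_cong[OF this, of "Inr _"]
    show "target_diff n g u B d (Suc i) t + Phi_morphism n mul L1 i s = 0" "source_diff n g i s = 0"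
      by (auto simp: fun_eq_iff)
  qed
  have "\<exists>t'\<in>free_on (target_basis n B (Suc (Suc i))). \<exists>s'\<in>free_on (source_basis n (Suc i)).
      target_diff n g u B d (Suc (Suc i)) t' + Phi_morphism n mul L1 (Suc i) s' = t \<and>
      - source_diff n g (Suc i) s' = s"
  proof (cases i)
    case 0
    \<comment> \<open>The image of t under d_1^F \<otimes> 1; the cycle condition on t makes it a
      cycle of K_1.\<close>
    define w where "w = (\<lambda>\<tau>. d 1 (slice \<tau> t) u)"
    have t: "t \<in> free_on (target_basis n B 1)" using t 0 by simp
    have w: "w \<in> free_on (koszul_basis n (Suc 0))"
      using d_1_slices_mem[OF t] by (simp add: w_def)
    have "koszul_op n g w {} = 0"
      using target_diff_1[OF t] eqs(1) 0 fun_cong[OF eqs(1), of None]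
      by (simp add: w_def Phi_morphism_def)
    moreover have "koszul_op n g w \<in> free_on {{}}"
      using koszul_op_free_on[OF w] by (simp add: koszul_basis_0)
    ultimately have "koszul_op n g w \<tau> = 0" for \<tau>
      by (cases "\<tau> = {}") (simp_all add: free_on_def)
    then have "koszul_op n g w = 0" by (simp add: fun_eq_iff)
    from koszul_exact[OF reg w this] obtain s'
      where s': "s' \<in> free_on (koszul_basis n 2)" "koszul_op n g s' = w"
      by (metis numeral_2_eq_2)
    have sb: "s' \<in> free_on (source_basis n (Suc i))"
      using s'(1) 0 by (simp add: source_basis_def numeral_2_eq_2)
    have P: "Phi_morphism n mul L1 1 s' \<in> free_on (target_basis n B 1)"
      using linear_on_mem[OF linear_Phi_morphism sb] 0 by simp
    have "d 1 (slice \<tau> (t - Phi_morphism n mul L1 1 s')) = 0" for \<tau>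
    proof -
      have st: "slice \<tau> t \<in> free_on (B 1)" and sP: "slice \<tau> (Phi_morphism n mul L1 1 s') \<in> free_on (B 1)"
        using slice_mem t P by auto
      have "d 1 (slice \<tau> (t - Phi_morphism n mul L1 1 s')) =
          d 1 (slice \<tau> t) - d 1 (slice \<tau> (Phi_morphism n mul L1 1 s'))"
        unfolding slice_diff by (rule linear_on_diff[OF linear_d st sP])
      moreover have "d 1 (slice \<tau> (Phi_morphism n mul L1 1 s')) u = w \<tau>"
        using fun_cong[OF d_1_slice_Phi_morphism[OF s'(1)], of \<tau>] s'(2) by simp
      ultimately have "d 1 (slice \<tau> (t - Phi_morphism n mul L1 1 s')) u = 0"
        by (simp add: w_def)
      moreover have "d 1 (slice \<tau> (t - Phi_morphism n mul L1 1 s')) \<in> free_on (B 0)"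
        using linear_on_mem[OF linear_d[of 1] slice_mem[OF _ free_on_diff[OF t P]]] by simp
      ultimately show ?thesis
        using free_on_B_0 by fastforce
    qed
    from target_exact[OF le_refl free_on_diff[OF t P] this] obtain t'
      where "t' \<in> free_on (target_basis n B (Suc 1))"
        "target_diff n g u B d (Suc 1) t' = t - Phi_morphism n mul L1 1 s'" by blast
    moreover have "s = 0" using s 0 by (simp add: source_basis_def free_on_def fun_eq_iff)
    ultimately show ?thesis
      using sb 0 by (intro bexI[of _ t'] bexI[of _ s']) (auto simp: source_diff_def)
  next
    case (Suc i')
    have s': "s \<in> free_on (koszul_basis n (Suc (Suc i')))"
      using s Suc by (simp add: source_basis_def)
    \<comment> \<open>For s in K_2 this is not contained in \<open>eqs(2)\<close>, since the source
      differential ends there. It follows by applying d_1^F \<otimes> 1 to \<open>eqs(1)\<close>,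
      which kills the boundary of t and turns \<Phi> s into d^K s.\<close>
    have "koszul_op n g s = 0"
    proof (cases i')
      case 0
      have t: "t \<in> free_on (target_basis n B 2)" and s2: "s \<in> free_on (koszul_basis n 2)"
        using t s' Suc 0 by (simp_all add: numeral_2_eq_2)
      have T: "target_diff n g u B d 2 t \<in> free_on (target_basis n B 1)"
        using target_diff_mem[OF t] by simp
      have P: "Phi_morphism n mul L1 1 s \<in> free_on (target_basis n B 1)"
        using linear_on_mem[OF linear_Phi_morphism s] Suc 0 by simp
      have "d 1 (slice \<tau> (Phi_morphism n mul L1 1 s)) = 0" for \<tau>
      proof -
        have "target_diff n g u B d 2 t + Phi_morphism n mul L1 1 s = 0"
          using eqs(1) Suc 0 by (simp add: numeral_2_eq_2)
        then have "slice \<tau> (target_diff n g u B d 2 t + Phi_morphism n mul L1 1 s) = 0"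
          by (simp only: zero_fun_def)
        then have "0 = d 1 (slice \<tau> (target_diff n g u B d 2 t + Phi_morphism n mul L1 1 s))"
          using linear_on_zero[OF linear_d, of 1] by (simp only:)
        also have "\<dots> = d 1 (slice \<tau> (target_diff n g u B d 2 t)) + d 1 (slice \<tau> (Phi_morphism n mul L1 1 s))"
          unfolding slice_add by (intro linear_on_add[OF linear_d] slice_mem T P) auto
        also have "d 1 (slice \<tau> (target_diff n g u B d 2 t)) = 0"
          using d_d[of "slice \<tau> t" 1] slice_mem[OF _ t] slice_target_diff[OF _ t, of \<tau>]
          by (simp add: numeral_2_eq_2)
        finally show ?thesis by (simp only: add_0_left)
      qed
      then show ?thesis
        using d_1_slice_Phi_morphism[OF s2] by (simp add: fun_eq_iff)
    next
      case (Suc i'')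
      then show ?thesis
        using source_diff_eq[OF _ s] eqs(2) \<open>i = Suc i'\<close> by simp
    qed
    from koszul_exact[OF reg s' this] obtain s2
      where s2: "s2 \<in> free_on (koszul_basis n (Suc (Suc i)))" "koszul_op n g s2 = s"
      using Suc by blast
    \<comment> \<open>The cone differential is - d on the source, hence the sign of the
      preimage.\<close>
    have m: "- s2 \<in> free_on (source_basis n (Suc i))"
      using free_on_uminus[OF s2(1)] by (simp add: source_basis_def)
    have sd: "source_diff n g (Suc i) (- s2) = - s"
      using source_diff_eq[OF _ m] linear_on_uminus[OF linear_on_koszul_op s2(1)] s2(2) Suc by simp
    let ?t = "t - Phi_morphism n mul L1 (Suc i) (- s2)"
    have P: "Phi_morphism n mul L1 (Suc i) (- s2) \<in> free_on (target_basis n B (Suc i))"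
      by (rule linear_on_mem[OF linear_Phi_morphism m])
    have t'': "?t \<in> free_on (target_basis n B (Suc i))"
      by (rule free_on_diff[OF t P])
    have "target_diff n g u B d (Suc i) ?t =
        target_diff n g u B d (Suc i) t - Phi_morphism n mul L1 i (- s)"
      using linear_on_diff[OF linear_target_diff t P] Phi_morphism_chain[OF _ m] sd by simp
    also have "\<dots> = 0"
      using linear_on_uminus[OF linear_Phi_morphism s] eqs(1) by simp
    \<comment> \<open>Here \<open>Suc i\<close> is at least 2, so the target differential acts as
      d^F on every slice.\<close>
    finally have cycle: "d (Suc i) (slice \<tau> ?t) = 0" for \<tau>
      using slice_target_diff[OF _ t'', of \<tau>] Suc by (simp add: fun_eq_iff)
    have "1 \<le> Suc i" by simp
    from target_exact[OF this t'' cycle] obtain t'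
      where "t' \<in> free_on (target_basis n B (Suc (Suc i)))" "target_diff n g u B d (Suc (Suc i)) t' = ?t"
      by blast
    then show ?thesis
      using m sd by (intro bexI[of _ t'] bexI[of _ "- s2"] conjI) simp_all
  qed
  then obtain t' s' where ts: "t' \<in> free_on (target_basis n B (Suc (Suc i)))" "s' \<in> free_on (source_basis n (Suc i))"
      "target_diff n g u B d (Suc (Suc i)) t' + Phi_morphism n mul L1 (Suc i) s' = t"
      "- source_diff n g (Suc i) s' = s"
    by blast
  show ?thesis
  proof (intro bexI)
    show "cone_d (Suc (Suc i)) (case_sum t' s') = z"
      by (simp only: cone_d_Suc case_sum_comp ts split)
    show "case_sum t' s' \<in> free_on (cone_B (Suc (Suc i)))"
      using ts by (simp add: free_on_cone_basis case_sum_comp)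
  qed
qed

section \<open>The image of the cone in degree 0\<close>

lemma cone_d_1_Inl_None:
  assumes "z \<in> free_on (cone_B 1)"
  shows "cone_d 1 z (Inl None) = - (\<Sum>r\<in>{1..n}. g r * d 1 (slice {r} (z \<circ> Inl)) u)"
proof -
  have "z \<circ> Inl \<in> free_on (target_basis n B 1)"
    using assms by (simp add: free_on_cone_basis)
  from target_diff_1[OF this] show ?thesis
    by (simp add: cone_diff_def Phi_morphism_def koszul_op_empty)
qed

text \<open>One coefficient in \<open>I\<close> for each generator, matching the n slices of an
  element of F_1 \<otimes> K_1. Such sums form an ideal containing all products.\<close>

lemma ideal_mult_gen:
  assumes "is_ideal I" "v \<in> ideal_mult (ideal_gen (g ` {1..n})) I"
  shows "\<exists>c. range c \<subseteq> I \<and> v = (\<Sum>r\<in>{1..n}. g r * c r)"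
proof -
  note ideal = assms(1)[unfolded module.subspace_def[OF module_mult]]
  let ?S = "{v. \<exists>c. range c \<subseteq> I \<and> v = (\<Sum>r\<in>{1..n}. g r * c r)}"
  have "ideal_mult (ideal_gen (g ` {1..n})) I \<subseteq> ?S"
    unfolding ideal_mult_def
  proof (rule module.span_minimal[OF module_mult])
    show "{x * y |x y. x \<in> ideal_gen (g ` {1..n}) \<and> y \<in> I} \<subseteq> ?S"
    proof safe
      fix x y assume "x \<in> ideal_gen (g ` {1..n})" and y: "y \<in> I"
      then obtain c where "x = (\<Sum>r\<in>{1..n}. g r * c r)"
        using ideal_gen_imageE[OF finite_atLeastAtMost] by blast
      then have "x * y = (\<Sum>r\<in>{1..n}. g r * (c r * y))"
        by (simp add: sum_distrib_right mult.assoc)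
      moreover have "range (\<lambda>r. c r * y) \<subseteq> I" using ideal y by blast
      ultimately show "\<exists>c. range c \<subseteq> I \<and> x * y = (\<Sum>r\<in>{1..n}. g r * c r)" by blast
    qed
    show "is_ideal ?S"
      unfolding module.subspace_def[OF module_mult]
    proof (intro conjI ballI allI)
      show "0 \<in> ?S" using ideal by (auto intro!: exI[of _ "\<lambda>_. 0"])
    next
      fix x y assume "x \<in> ?S" "y \<in> ?S"
      then obtain c c' where c: "range c \<subseteq> I" "range c' \<subseteq> I"
          "x = (\<Sum>r\<in>{1..n}. g r * c r)" "y = (\<Sum>r\<in>{1..n}. g r * c' r)" by auto
      then have "x + y = (\<Sum>r\<in>{1..n}. g r * (c r + c' r))"
        by (simp add: sum.distrib distrib_left)
      moreover have "range (\<lambda>r. c r + c' r) \<subseteq> I" using ideal c(1,2) by blast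
      ultimately show "x + y \<in> ?S" by blast
    next
      fix b x assume "x \<in> ?S"
      then obtain c where c: "range c \<subseteq> I" "x = (\<Sum>r\<in>{1..n}. g r * c r)" by auto
      then have "b * x = (\<Sum>r\<in>{1..n}. g r * (b * c r))"
        by (simp add: sum_distrib_left mult.left_commute)
      moreover have "range (\<lambda>r. b * c r) \<subseteq> I" using ideal c(1) by blast
      ultimately show "b * x \<in> ?S" by blast
    qed
  qed
  then show ?thesis using assms(2) by blast
qed

lemma cone_B_0: "cone_B 0 = {Inl None}"
  by (simp add: cone_basis_def target_basis_def)

lemma linear_cone_d: "linear_on (cone_B i) (cone_B (i - 1)) (cone_d i)"
  using free_complex_cone[OF complex_morphism_Phi] by (simp add: free_complex_def)

lemmas cone_d_mem = linear_on_mem[OF linear_cone_d]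

text \<open>The slices of an element of F_1 \<otimes> K_1 can be chosen independently and d_1 maps
  F_1 onto I, so the image consists of all sums of g_r c_r with c_r in I.\<close>

lemma cone_image:
  assumes I: "is_ideal I"
  shows "cone_d 1 ` free_on (cone_B 1) =
    {x \<in> free_on {Inl None}. x (Inl None) \<in> ideal_mult (ideal_gen (g ` {1..n})) I}"
    (is "?L = ?R")
proof (intro subset_antisym subsetI)
  fix x assume "x \<in> ?L"
  then obtain z where z: "z \<in> free_on (cone_B 1)" "x = cone_d 1 z" by blast
  have "x \<in> free_on {Inl None}"
    using cone_d_mem[OF z(1)] z(2) by (simp add: cone_B_0)
  moreover have "g r * d 1 (slice {r} (z \<circ> Inl)) u \<in> ideal_mult (ideal_gen (g ` {1..n})) I"
    if "r \<in> {1..n}" for r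
  proof -
    have "z \<circ> Inl \<in> free_on (target_basis n B 1)"
      using z(1) by (simp add: free_on_cone_basis)
    then have "d 1 (slice {r} (z \<circ> Inl)) u \<in> I"
      using d_1_image slice_mem by blast
    moreover have "g r \<in> ideal_gen (g ` {1..n})"
      using that by (intro module.span_base[OF module_mult]) auto
    ultimately show ?thesis
      unfolding ideal_mult_def by (intro module.span_base[OF module_mult]) auto
  qed
  then have "x (Inl None) \<in> ideal_mult (ideal_gen (g ` {1..n})) I"
    unfolding z(2) cone_d_1_Inl_None[OF z(1)] ideal_mult_def
    by (intro module.span_neg[OF module_mult] module.span_sum[OF module_mult])
  ultimately show "x \<in> ?R" by simp
next
  fix x assume x: "x \<in> ?R"
  then obtain c where c: "range c \<subseteq> I" "x (Inl None) = (\<Sum>r\<in>{1..n}. g r * c r)"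
    using ideal_mult_gen[OF I] by blast
  \<comment> \<open>The negative is lifted because the target differential in degree 1 carries a
    minus sign.\<close>
  have "\<exists>w. w \<in> free_on (B 1) \<and> d 1 w u = - c r" for r
  proof -
    have "- c r \<in> I" using c(1) module.subspace_neg[OF module_mult I] by blast
    then have "(- c r) \<odot> bvec u \<in> d 1 ` free_on (B 1)"
      unfolding d_1_image by (simp add: free_on_def smul_def bvec_def)
    then obtain w where w: "(- c r) \<odot> bvec u = d 1 w" "w \<in> free_on (B 1)" by (rule imageE)
    have "d 1 w u = - c r" using fun_cong[OF w(1), of u] by (simp add: smul_def bvec_def)
    then show ?thesis using w(2) by blast
  qed
  then obtain w where w: "\<And>r. w r \<in> free_on (B 1)" "\<And>r. d 1 (w r) u = - c r" by metis
  define y where "y = case_option 0 (\<lambda>(b, \<tau>). if \<tau> \<in> koszul_basis n 1 then w (the_elem \<tau>) b else 0)"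
  define z :: "('b \<times> nat set) option + nat set \<Rightarrow> 'a" where "z = case_sum y 0"
  have "y \<in> free_on (target_basis n B 1)"
  proof (rule free_on_target_basisI)
    show "y None = 0" by (simp add: y_def)
  qed (use w(1) in \<open>auto simp: y_def\<close>)
  then have z: "z \<in> free_on (cone_B 1)"
    by (simp add: z_def free_on_cone_basis case_sum_comp free_on_zero)
  have "slice {r} y = w r" if "r \<in> {1..n}" for r
    using that by (simp add: y_def koszul_basis_def)
  then have "cone_d 1 z (Inl None) = x (Inl None)"
    unfolding cone_d_1_Inl_None[OF z] c(2) using w(2)
    by (simp add: z_def case_sum_comp sum_negf)
  moreover have "cone_d 1 z \<in> free_on {Inl None}"
    using cone_d_mem[OF z] by (simp add: cone_B_0)
  ultimately have "cone_d 1 z p = x p" for p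
    using x by (cases "p = Inl None") (simp_all add: free_on_def)
  then have "cone_d 1 z = x" ..
  then show "x \<in> ?L" using z by blast
qed

lemma free_resolution_cone:
  assumes "regular_sequence n g" "is_ideal I"
  shows "free_resolution (Inl None) cone_B cone_d (ideal_mult (ideal_gen (g ` {1..n})) I)"
  unfolding free_resolution_def
proof (intro conjI allI impI)
  show complex: "free_complex cone_B cone_d"
    by (rule free_complex_cone[OF complex_morphism_Phi])
  show "cone_B 0 = {Inl None}"
    by (rule cone_B_0)
  show "cone_d 1 ` free_on (cone_B 1) =
      {x \<in> free_on {Inl None}. x (Inl None) \<in> ideal_mult (ideal_gen (g ` {1..n})) I}"
    by (rule cone_image[OF assms(2)])
  fix i :: nat assume "i \<ge> 1"
  then obtain i' where i: "i = Suc i'" by (cases i) auto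
  show "cone_d (i + 1) ` free_on (cone_B (i + 1)) = {x \<in> free_on (cone_B i). cone_d i x = 0}"
  proof (intro subset_antisym subsetI)
    fix x assume "x \<in> cone_d (i + 1) ` free_on (cone_B (i + 1))"
    then obtain z where z: "z \<in> free_on (cone_B (i + 1))" "x = cone_d (i + 1) z" by blast
    have "cone_d i (cone_d (i + 1) z) = 0"
      using complex z(1) unfolding free_complex_def by blast
    then show "x \<in> {x \<in> free_on (cone_B i). cone_d i x = 0}"
      using cone_d_mem[OF z(1)] z(2) by simp
  next
    fix x assume "x \<in> {x \<in> free_on (cone_B i). cone_d i x = 0}"
    then have "\<exists>y\<in>free_on (cone_B (Suc (Suc i'))). cone_d (Suc (Suc i')) y = x"
      using cone_exact[OF assms(1), of x i'] i by simp
    then show "x \<in> cone_d (i + 1) ` free_on (cone_B (i + 1))"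
      using i by auto
  qed
qed

end

section \<open>Minimality\<close>

text \<open>Together with \<open>span_ideal_free_on_apply\<close> this makes minimality a condition
  on the coefficients of the values of the differentials. The vector is the combination of the basis
  vectors with its own coefficients.\<close>

lemma mem_span_ideal_free_on:
  assumes "finite A" "y \<in> free_on A" "\<And>b. y b \<in> M"
  shows "y \<in> fun_module.span {r \<odot> x | r x. r \<in> M \<and> x \<in> free_on A}"
proof -
  have "lin_ext A bvec y \<in> fun_module.span {r \<odot> x | r x. r \<in> M \<and> x \<in> free_on A}"
    unfolding lin_ext_def
  proof (intro fun_module.span_sum fun_module.span_base)
    fix a assume "a \<in> A"
    from bvec_in_free_on[OF this]
    show "y a \<odot> bvec a \<in> {r \<odot> x | r x. r \<in> M \<and> x \<in> free_on A}"
      by (intro CollectI exI[of _ "y a"] exI[of _ "bvec a"] conjI refl assms(3))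
  qed
  then show ?thesis
    unfolding lin_ext_bvec_self[OF assms(1,2)] .
qed

lemma span_ideal_free_on_apply:
  assumes "is_ideal M" "y \<in> fun_module.span {r \<odot> x | r x. r \<in> M \<and> x \<in> free_on A}"
  shows "y b \<in> M"
proof -
  note ideal = assms(1)[unfolded module.subspace_def[OF module_mult]]
  have "fun_module.span {r \<odot> x | r x. r \<in> M \<and> x \<in> free_on A} \<subseteq> {y. \<forall>b. y b \<in> M}"
  proof (rule fun_module.span_minimal)
    show "{r \<odot> x | r x. r \<in> M \<and> x \<in> free_on A} \<subseteq> {y. \<forall>b. y b \<in> M}"
      using ideal by (auto simp: smul_def) (metis mult.commute)
    show "fun_module.subspace {y. \<forall>b. y b \<in> M}"
      using ideal by (auto simp: fun_module.subspace_def smul_def)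
  qed
  then show ?thesis using assms(2) by blast
qed

lemma ideal_mult_subset: "is_ideal M \<Longrightarrow> ideal_mult M J \<subseteq> M"
  unfolding ideal_mult_def
  by (intro module.span_minimal[OF module_mult])
    (auto simp: mult.commute dest: module.subspace_scale[OF module_mult])

context dg_resolution
begin

lemma cone_d_Some:
  assumes "i \<ge> 1" "z \<in> free_on (cone_B (Suc i))" "r \<in> {1..n}"
  shows "cone_d (Suc i) z (Inl (Some (b, {r}))) =
    d (Suc i) (slice {r} (z \<circ> Inl)) b + comparison_map n mul L1 i (contract r (z \<circ> Inr)) b"
proof -
  have t: "z \<circ> Inl \<in> free_on (target_basis n B (Suc i))" and s: "z \<circ> Inr \<in> free_on (koszul_basis n (Suc i))"
    using assms(1,2) by (auto simp: free_on_cone_basis source_basis_def)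
  show ?thesis
    using fun_cong[OF slice_target_diff[OF _ t, of "{r}"], of b] assms(1)
      fun_cong[OF slice_Phi_morphism[OF assms(1) s assms(3)], of b]
    by (simp add: cone_d_Suc)
qed

lemma comparison_map_apply:
  assumes "k \<ge> 1" "y \<in> free_on (koszul_basis n k)"
  shows "comparison_map n mul L1 k y b = (\<Sum>\<sigma>\<in>koszul_basis n k. y \<sigma> * gen_prod \<sigma> b)"
  unfolding linear_on_expand[OF finite_koszul_basis linear_comparison_map[OF assms(1)] assms(2)]
  using assms(1) by (intro sum.cong) (simp_all add: comparison_map_bvec)

lemma cone_d_Inr:
  assumes "z \<in> free_on (cone_B (Suc i))"
  shows "cone_d (Suc i) z (Inr \<tau>) = (if i \<ge> 2 then - koszul_op n g (z \<circ> Inr) \<tau> else 0)"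
proof -
  have "z \<circ> Inr \<in> free_on (source_basis n i)"
    using assms by (simp add: free_on_cone_basis)
  then show ?thesis
    using source_diff_eq[of i] by (auto simp: cone_d_Suc) (simp add: source_diff_def)
qed

lemma cone_B_cases:
  assumes "p \<in> cone_B (Suc i)"
  obtains b r where "p = Inl (Some (b, {r}))" "b \<in> B (Suc i)" "r \<in> {1..n}"
  | \<sigma> where "p = Inr \<sigma>" "\<sigma> \<in> source_basis n i"
  using assms that unfolding cone_basis_def target_basis_def koszul_basis_1 by auto

text \<open>Three kinds of coefficients occur: those of d^F, which is minimal; the g_r, which lie in
  M I and hence in M; and those of \<Phi>, which come from products of the L_1(f_r).\<close>

lemma minimal_complex_cone:
  assumes M: "is_ideal M" and min: "minimal_complex M B d"
    and a: "ideal_gen (g ` {1..n}) \<subseteq> ideal_mult M I" and I: "is_ideal I"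
  shows "minimal_complex M cone_B cone_d"
proof -
  note ideal = M[unfolded module.subspace_def[OF module_mult]]
  have scale: "c * x \<in> M" "x * c \<in> M" if "x \<in> M" for c x
    using ideal that by (auto simp: mult.commute)
  note sum_M = module.subspace_sum[OF module_mult M] and neg_M = module.subspace_neg[OF module_mult M]
  have d_M: "d i x b \<in> M" if "i \<ge> 1" "x \<in> free_on (B i)" for i x b
    by (rule span_ideal_free_on_apply[OF M]) (use min that in \<open>auto simp: minimal_complex_def\<close>)
  have g: "g r \<in> ideal_mult M I" if "r \<in> {1..n}" for r
    using a module.span_base[OF module_mult, of "g r" "g ` {1..n}"] that by blast
  then have g_M: "g r \<in> M" if "r \<in> {1..n}" for r
    using ideal_mult_subset[OF M] that by blast
  \<comment> \<open>The ideal d_1(M F_1), viewed in the ring through the basis element u.\<close>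
  let ?S = "{v. \<exists>y\<in>free_on (B 1). (\<forall>b. y b \<in> M) \<and> d 1 y = v \<odot> bvec u}"
  have "ideal_mult M I \<subseteq> ?S"
    unfolding ideal_mult_def
  proof (rule module.span_minimal[OF module_mult])
    show "{x * y |x y. x \<in> M \<and> y \<in> I} \<subseteq> ?S"
    proof safe
      fix x y assume x: "x \<in> M" and "y \<in> I"
      then have "y \<odot> bvec u \<in> d 1 ` free_on (B 1)"
        unfolding d_1_image by (simp add: free_on_def smul_def bvec_def)
      then obtain w where w: "y \<odot> bvec u = d 1 w" "w \<in> free_on (B 1)" by (rule imageE)
      have "d 1 (x \<odot> w) = (x * y) \<odot> bvec u"
        unfolding linear_on_smul[OF linear_d w(2)] w(1)[symmetric] by simp
      moreover have "(x \<odot> w) b \<in> M" for b using scale x by (simp add: smul_def)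
      ultimately show "\<exists>v\<in>free_on (B 1). (\<forall>b. v b \<in> M) \<and> d 1 v = (x * y) \<odot> bvec u"
        using free_on_smul[OF w(2)] by blast
    qed
    show "is_ideal ?S"
      unfolding module.subspace_def[OF module_mult]
    proof (intro conjI ballI allI)
      show "0 \<in> ?S"
        using ideal linear_on_zero[OF linear_d, of 1] by (auto intro!: bexI[of _ 0] free_on_zero)
    next
      fix v v' assume "v \<in> ?S" "v' \<in> ?S"
      then obtain y y' where y: "y \<in> free_on (B 1)" "\<forall>b. y b \<in> M" "d 1 y = v \<odot> bvec u"
          "y' \<in> free_on (B 1)" "\<forall>b. y' b \<in> M" "d 1 y' = v' \<odot> bvec u" by blast
      have "d 1 (y + y') = (v + v') \<odot> bvec u"
        unfolding linear_on_add[OF linear_d y(1,4)] y(3,6) by (simp add: fun_module.scale_left_distrib)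
      moreover have "\<forall>b. (y + y') b \<in> M" using y ideal by simp
      ultimately show "v + v' \<in> ?S" using free_on_add[OF y(1,4)] by blast
    next
      fix c v assume "v \<in> ?S"
      then obtain y where y: "y \<in> free_on (B 1)" "\<forall>b. y b \<in> M" "d 1 y = v \<odot> bvec u" by blast
      have "d 1 (c \<odot> y) = (c * v) \<odot> bvec u"
        unfolding linear_on_smul[OF linear_d y(1)] y(3) by simp
      moreover have "\<forall>b. (c \<odot> y) b \<in> M" using y scale by (simp add: smul_def)
      ultimately show "c * v \<in> ?S" using free_on_smul[OF y(1)] by blast
    qed
  qed
  have L1_M: "L1 (bvec {r}) b \<in> M" if r: "r \<in> {1..n}" for r b
  proof -
    obtain y where y: "y \<in> free_on (B 1)" "\<forall>b. y b \<in> M" "d 1 y = g r \<odot> bvec u"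
      using \<open>ideal_mult M I \<subseteq> ?S\<close> g[OF r] by blast
    have "d 1 (L1 (bvec {r}) - y) = 0"
      unfolding linear_on_diff[OF linear_d L1_gen_mem[OF r] y(1)] y(3) d_L1_gen[OF r] by simp
    then obtain w where w: "w \<in> free_on (B (Suc 1))" "d (Suc 1) w = L1 (bvec {r}) - y"
      using d_exact[OF le_refl free_on_diff[OF L1_gen_mem[OF r] y(1)]] by blast
    have "(L1 (bvec {r}) - y) b \<in> M"
      unfolding w(2)[symmetric] by (rule d_M) (use w(1) in auto)
    moreover have "y b \<in> M" using y(2) by blast
    ultimately have "(L1 (bvec {r}) - y) b + y b \<in> M" using ideal by blast
    then show ?thesis by simp
  qed
  \<comment> \<open>Expanding the last multiplication in its second argument gives every summand a
    coefficient of L_1(f_m) as a factor. The empty product is the unit and is excluded.\<close>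
  have gen_prod_M: "gen_prod \<sigma> b \<in> M" if "finite \<sigma>" "\<sigma> \<subseteq> {1..n}" "\<sigma> \<noteq> {}" for \<sigma> b
    using that
  proof (induction \<sigma> rule: finite_linorder_max_induct)
    case (insert m \<tau>)
    then have m: "m \<in> {1..n}" and mem: "gen_prod \<tau> \<in> free_on (B (card \<tau>))"
      using gen_prod_mem[OF insert.hyps(1)] by auto
    show ?case
      unfolding gen_prod_insert[OF insert.hyps]
        linear_on_expand[OF finite_B linear_mul_right[OF mem] L1_gen_mem[OF m]]
      by (intro sum_M scale(2) L1_M m)
  qed simp
  have kop_M: "koszul_op n g x \<tau> \<in> M" for x \<tau>
    unfolding koszul_op_def by (intro sum_M scale g_M) auto
  have cone_M: "cone_d (Suc i) z p \<in> M" if z: "z \<in> free_on (cone_B (Suc i))" for i z p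
  proof (cases "p \<in> cone_B i")
    case False
    then show ?thesis using cone_d_mem[OF z] ideal by (simp add: free_on_def)
  next
    case True
    show ?thesis
    proof (cases i)
      case 0
      then have "p = Inl None" using True by (simp add: cone_B_0)
      then show ?thesis
        using cone_d_1_Inl_None[of z] z 0 by (auto intro!: neg_M sum_M scale(2) g_M)
    next
      case (Suc j)
      have t: "z \<circ> Inl \<in> free_on (target_basis n B (Suc i))"
        and s: "z \<circ> Inr \<in> free_on (koszul_basis n (Suc i))"
        using z Suc by (simp_all add: free_on_cone_basis source_basis_def)
      from True show ?thesis
        unfolding Suc
      proof (cases rule: cone_B_cases)
        case (1 b r)
        have "comparison_map n mul L1 i (contract r (z \<circ> Inr)) b \<in> M"
        proof (subst comparison_map_apply[OF _ contract_free_on[OF s]])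
          show "(\<Sum>\<sigma>\<in>koszul_basis n i. contract r (z \<circ> Inr) \<sigma> * gen_prod \<sigma> b) \<in> M"
          proof (intro sum_M scale(1) gen_prod_M)
            fix \<sigma> assume "\<sigma> \<in> koszul_basis n i"
            then show "finite \<sigma>" "\<sigma> \<subseteq> {1..n}" "\<sigma> \<noteq> {}"
              using Suc by (auto simp: koszul_basis_def intro: finite_subset)
          qed
        qed (use Suc in simp)
        moreover have "d (Suc i) (slice {r} (z \<circ> Inl)) b \<in> M"
          by (rule d_M[OF _ slice_mem[OF _ t]]) simp_all
        ultimately show "cone_d (Suc (Suc j)) z p \<in> M"
          using cone_d_Some[OF _ z 1(3), of b] 1(1) Suc ideal by simp
      next
        case (2 \<sigma>)
        then show "cone_d (Suc (Suc j)) z p \<in> M"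
          using cone_d_Inr[OF z, of \<sigma>] Suc kop_M[THEN neg_M] ideal by simp
      qed
    qed
  qed
  show ?thesis
    unfolding minimal_complex_def
  proof (intro allI impI subsetI)
    fix i :: nat and y assume "i \<ge> 1" and y: "y \<in> cone_d i ` free_on (cone_B i)"
    then obtain j z where i: "i = Suc j" and z: "z \<in> free_on (cone_B (Suc j))" "y = cone_d (Suc j) z"
      by (cases i) auto
    have fin: "finite (cone_B (i - 1))"
      using free_complex_cone[OF complex_morphism_Phi] by (simp add: free_complex_def)
    show "y \<in> fun_module.span {r \<odot> x |r x. r \<in> M \<and> x \<in> free_on (cone_B (i - 1))}"
      by (rule mem_span_ideal_free_on[OF fin]) (use cone_M[OF z(1)] cone_d_mem[OF z(1)] z(2) i in simp_all)
  qed
qed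

end

section \<open>Gradings\<close>

text \<open>Collects the closure properties of the pieces \<open>homog k N X j\<close> on which the
  degree counts rest. That 1 has degree 0 makes basis vectors homogeneous.\<close>

locale ring_grading =
  fixes H :: "int \<Rightarrow> 'a::comm_ring_1 set"
  assumes H_zero: "0 \<in> H j" and H_add: "x \<in> H j \<Longrightarrow> y \<in> H j \<Longrightarrow> x + y \<in> H j"
    and H_uminus: "x \<in> H j \<Longrightarrow> - x \<in> H j" and H_one: "1 \<in> H 0"
    and H_mult: "x \<in> H i \<Longrightarrow> y \<in> H j \<Longrightarrow> x * y \<in> H (i + j)"
begin

lemma H_sum: "(\<And>i. i \<in> A \<Longrightarrow> f i \<in> H j) \<Longrightarrow> sum f A \<in> H j"
  by (induction A rule: infinite_finite_induct) (auto simp: H_zero H_add)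

lemma H_sign: "x \<in> H j \<Longrightarrow> (-1) ^ m * x \<in> H j"
  by (induction m) (auto simp: H_uminus)

lemma H_mult_eq: "x \<in> H i \<Longrightarrow> y \<in> H j \<Longrightarrow> i + j = l \<Longrightarrow> x * y \<in> H l"
  using H_mult by blast

lemma homog_vec_apply: "x \<in> homog_vec H A \<delta> j \<Longrightarrow> b \<in> A \<Longrightarrow> x b \<in> H (j - \<delta> b)"
  by (simp add: homog_vec_def)

lemma contract_homog_vec:
  assumes "x \<in> homog_vec H (koszul_basis n (Suc k)) (koszul_degree e) p" "r \<in> {1..n}"
  shows "contract r x \<in> homog_vec H (koszul_basis n k) (koszul_degree e) (p - e r)"
  unfolding homog_vec_def
proof (intro CollectI conjI ballI)
  show "contract r x \<in> free_on (koszul_basis n k)"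
    using assms(1) by (intro contract_free_on) (simp add: homog_vec_def)
  fix \<tau> assume \<tau>: "\<tau> \<in> koszul_basis n k"
  show "contract r x \<tau> \<in> H (p - e r - koszul_degree e \<tau>)"
  proof (cases "r \<in> \<tau>")
    case False
    have fin: "finite \<tau>" using \<tau> by (auto simp: koszul_basis_def intro: finite_subset)
    have "insert r \<tau> \<in> koszul_basis n (Suc k)"
      using \<tau> assms(2) False fin by (simp add: koszul_basis_def)
    from homog_vec_apply[OF assms(1) this]
    have "x (insert r \<tau>) \<in> H (p - e r - koszul_degree e \<tau>)"
      using False fin by (simp add: koszul_degree_def algebra_simps)
    then show ?thesis
      using False by (simp add: contract_def H_sign)
  qed (simp add: contract_def H_zero)
qed

text \<open>Removing r lowers the degree of the index by e r, which multiplication by g_r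
  restores.\<close>

lemma koszul_op_homog:
  assumes "x \<in> homog_vec H (koszul_basis n (Suc k)) (koszul_degree e) p" "\<tau> \<in> koszul_basis n k"
    "\<forall>r\<in>{1..n}. g r \<in> H (e r)"
  shows "koszul_op n g x \<tau> \<in> H (p - koszul_degree e \<tau>)"
  unfolding koszul_op_def
proof (intro H_sum H_sign)
  fix r assume r: "r \<in> {1..n} - \<tau>"
  have fin: "finite \<tau>" using assms(2) by (auto simp: koszul_basis_def intro: finite_subset)
  have "insert r \<tau> \<in> koszul_basis n (Suc k)"
    using assms(2) r fin by (simp add: koszul_basis_def)
  from homog_vec_apply[OF assms(1) this] show "g r * x (insert r \<tau>) \<in> H (p - koszul_degree e \<tau>)"
    using r fin assms(3) by (intro H_mult_eq[of _ "e r"]) (auto simp: koszul_degree_def)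
qed

end

text \<open>Exponents add under multiplication and coefficients stay in the subfield. A single
  monomial is written as a sum over all exponents of its degree with coefficient 0 elsewhere; this
  needs \<open>E j\<close> to be finite, since a sum over an infinite set would be 0.\<close>

lemma ring_grading_homog:
  fixes k :: "'a::comm_ring_1 set"
  assumes "subfield k"
  shows "ring_grading (homog k N X)"
proof -
  define E where "E j = {\<alpha>. \<alpha> \<in> exponents N \<and> int (\<Sum>i = 1..N. \<alpha> i) = j}" for j
  have k: "0 \<in> k" "1 \<in> k" "\<And>x y. x \<in> k \<Longrightarrow> y \<in> k \<Longrightarrow> x - y \<in> k" "\<And>x y. x \<in> k \<Longrightarrow> y \<in> k \<Longrightarrow> x * y \<in> k"
    using assms by (auto simp: subfield_def)
  have k_neg: "- x \<in> k" if "x \<in> k" for x using k(3)[OF k(1) that] by simp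
  have k_add: "x + y \<in> k" if "x \<in> k" "y \<in> k" for x y using k(3)[OF that(1) k_neg[OF that(2)]] by simp
  have homog: "homog k N X j = {\<Sum>\<alpha>\<in>E j. c \<alpha> * monomial N X \<alpha> | c. range c \<subseteq> k}" for j
    by (simp add: homog_def E_def)
  have homogI: "(\<Sum>\<alpha>\<in>E j. c \<alpha> * monomial N X \<alpha>) \<in> homog k N X j" if "range c \<subseteq> k" for c j
    using that unfolding homog by blast
  have fin: "finite (E j)" for j
  proof (rule finite_subset)
    show "E j \<subseteq> {\<alpha>. \<forall>i. (i \<in> {1..N} \<longrightarrow> \<alpha> i \<in> {..nat j}) \<and> (i \<notin> {1..N} \<longrightarrow> \<alpha> i = 0)}"
    proof safe
      fix \<alpha> i assume \<alpha>: "\<alpha> \<in> E j" and i: "i \<in> {1..N}"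
      have "\<alpha> i \<le> (\<Sum>i = 1..N. \<alpha> i)" using i by (intro member_le_sum) auto
      moreover have "nat j = (\<Sum>i = 1..N. \<alpha> i)"
        using \<alpha> unfolding E_def by (metis (mono_tags, lifting) mem_Collect_eq nat_int)
      ultimately show "\<alpha> i \<le> nat j" by simp
    qed (auto simp: E_def exponents_def)
  qed (rule finite_set_of_finite_funs; simp)
  have zero: "0 \<in> homog k N X j" for j
    unfolding homog using k(1) by (auto intro!: exI[of _ "\<lambda>_. 0"])
  have add: "x + y \<in> homog k N X j" if xy: "x \<in> homog k N X j" "y \<in> homog k N X j" for x y j
  proof -
    obtain c c' where c: "range c \<subseteq> k" "range c' \<subseteq> k"
        "x = (\<Sum>\<alpha>\<in>E j. c \<alpha> * monomial N X \<alpha>)" "y = (\<Sum>\<alpha>\<in>E j. c' \<alpha> * monomial N X \<alpha>)"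
      using xy unfolding homog by blast
    then have "x + y = (\<Sum>\<alpha>\<in>E j. (c \<alpha> + c' \<alpha>) * monomial N X \<alpha>)"
      by (simp add: sum.distrib distrib_right)
    moreover have "range (\<lambda>\<alpha>. c \<alpha> + c' \<alpha>) \<subseteq> k" using c k_add by blast
    ultimately show ?thesis using homogI[of "\<lambda>\<alpha>. c \<alpha> + c' \<alpha>" j] by simp
  qed
  have sum: "sum f A \<in> homog k N X j" if "\<And>i. i \<in> A \<Longrightarrow> f i \<in> homog k N X j" for f :: "'x \<Rightarrow> 'a" and A j
    using that by (induction A rule: infinite_finite_induct) (auto simp: zero add)
  have single: "c * monomial N X \<gamma> \<in> homog k N X j" if "c \<in> k" "\<gamma> \<in> E j" for c \<gamma> j
  proof -
    have "(\<Sum>\<alpha>\<in>E j. (if \<alpha> = \<gamma> then c else 0) * monomial N X \<alpha>) =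
        (\<Sum>\<alpha>\<in>E j. if \<alpha> = \<gamma> then c * monomial N X \<gamma> else 0)"
      by (rule sum.cong) auto
    also have "\<dots> = c * monomial N X \<gamma>" using that(2) fin by simp
    finally show ?thesis
      unfolding homog using that(1) k(1) by (intro CollectI exI[of _ "\<lambda>\<alpha>. if \<alpha> = \<gamma> then c else 0"]) auto
  qed
  show ?thesis
  proof
    show "- x \<in> homog k N X j" if x: "x \<in> homog k N X j" for x j
    proof -
      obtain c where c: "range c \<subseteq> k" "x = (\<Sum>\<alpha>\<in>E j. c \<alpha> * monomial N X \<alpha>)"
        using x unfolding homog by blast
      then have "- x = (\<Sum>\<alpha>\<in>E j. (- c \<alpha>) * monomial N X \<alpha>)" by (simp add: sum_negf)
      moreover have "range (\<lambda>\<alpha>. - c \<alpha>) \<subseteq> k" using c k_neg by blast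
      ultimately show ?thesis using homogI[of "\<lambda>\<alpha>. - c \<alpha>" j] by simp
    qed
    show "1 \<in> homog k N X 0"
      using single[OF k(2), of "\<lambda>_. 0" 0] by (simp add: monomial_def E_def exponents_def)
    show "x * y \<in> homog k N X (i + j)" if x: "x \<in> homog k N X i" and y: "y \<in> homog k N X j" for x y i j
    proof -
      obtain c c' where c: "range c \<subseteq> k" "range c' \<subseteq> k"
          "x = (\<Sum>\<alpha>\<in>E i. c \<alpha> * monomial N X \<alpha>)" "y = (\<Sum>\<beta>\<in>E j. c' \<beta> * monomial N X \<beta>)"
        using x y unfolding homog by blast
      have "x * y = (\<Sum>\<alpha>\<in>E i. \<Sum>\<beta>\<in>E j. (c \<alpha> * c' \<beta>) * monomial N X (\<lambda>i. \<alpha> i + \<beta> i))"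
        unfolding c(3,4) sum_product monomial_def by (simp add: power_add prod.distrib mult_ac)
      also have "\<dots> \<in> homog k N X (i + j)"
      proof (intro sum single)
        fix \<alpha> \<beta> assume "\<alpha> \<in> E i" "\<beta> \<in> E j"
        then show "(\<lambda>i. \<alpha> i + \<beta> i) \<in> E (i + j)"
          by (auto simp: E_def exponents_def sum.distrib)
        show "c \<alpha> * c' \<beta> \<in> k" using c(1,2) k(4) by blast
      qed
      finally show ?thesis .
    qed
  qed (use zero add in auto)
qed

text \<open>The summand of F_i \<otimes> K_1 at f_r is shifted by e r, and so is contraction by f_r.
  As L_i(f_\<sigma>) has the degree of f_\<sigma>, both contributions to the r-th slice have the
  same degree.\<close>

lemma (in dg_resolution) graded_complex_cone:
  assumes grading: "ring_grading H"
    and F: "graded_complex H B \<delta> d" "\<delta> 0 u = 0"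
    and g: "\<forall>r\<in>{1..n}. g r \<in> H (e r)"
    and L1_deg: "degree_preserving H (koszul_basis n 1) (koszul_degree e) (B 1) (\<delta> 1) L1"
    and mul_deg: "graded_product H B \<delta> mul"
  shows "graded_complex H cone_B (cone_degree (\<lambda>j. koszul_degree e) (target_degree \<delta> e)) cone_d"
proof -
  interpret ring_grading H by (rule grading)
  have d_deg: "d i x b \<in> H (p - \<delta> (i - 1) b)" if "i \<ge> 1" "x \<in> homog_vec H (B i) (\<delta> i) p" "b \<in> B (i - 1)" for i x p b
  proof (rule homog_vec_apply[OF _ that(3)])
    show "d i x \<in> homog_vec H (B (i - 1)) (\<delta> (i - 1)) p"
      using F(1) that(1,2) unfolding graded_complex_def degree_preserving_def by blast
  qed
  have bvec_deg: "bvec a \<in> homog_vec H A \<epsilon> (\<epsilon> a)" if "a \<in> A" for a A and \<epsilon> :: "'c \<Rightarrow> int"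
    using bvec_in_free_on[OF that] H_one H_zero by (simp add: homog_vec_def) (simp add: bvec_def)
  have gen_prod_deg: "gen_prod \<sigma> \<in> homog_vec H (B (card \<sigma>)) (\<delta> (card \<sigma>)) (koszul_degree e \<sigma>)"
    if "finite \<sigma>" "\<sigma> \<subseteq> {1..n}" for \<sigma>
    using that
  proof (induction \<sigma> rule: finite_linorder_max_induct)
    case empty
    then show ?case
      using bvec_deg[of u "B 0" "\<delta> 0"] F(2) by (simp add: gen_prod_empty koszul_degree_def B_0)
  next
    case (insert m \<tau>)
    then have m: "m \<notin> \<tau>" "m \<in> {1..n}" by auto
    have "bvec {m} \<in> homog_vec H (koszul_basis n 1) (koszul_degree e) (koszul_degree e {m})"
      using m(2) by (intro bvec_deg) (simp add: koszul_basis_def)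
    then have "L1 (bvec {m}) \<in> homog_vec H (B 1) (\<delta> 1) (koszul_degree e {m})"
      using L1_deg unfolding degree_preserving_def by blast
    moreover have "gen_prod \<tau> \<in> homog_vec H (B (card \<tau>)) (\<delta> (card \<tau>)) (koszul_degree e \<tau>)"
      using insert by simp
    ultimately have "mul (card \<tau>) 1 (gen_prod \<tau>) (L1 (bvec {m})) \<in>
        homog_vec H (B (card \<tau> + 1)) (\<delta> (card \<tau> + 1)) (koszul_degree e \<tau> + koszul_degree e {m})"
      using mul_deg unfolding graded_product_def by blast
    then show ?case
      using insert.hyps m(1) by (simp add: gen_prod_insert koszul_degree_def add.commute)
  qed
  have comp_deg: "comparison_map n mul L1 i y b \<in> H (p - \<delta> i b)"
    if "i \<ge> 1" "y \<in> homog_vec H (koszul_basis n i) (koszul_degree e) p" "b \<in> B i" for i y p b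
  proof (subst comparison_map_apply[OF that(1)])
    show "y \<in> free_on (koszul_basis n i)" using that(2) by (simp add: homog_vec_def)
    show "(\<Sum>\<sigma>\<in>koszul_basis n i. y \<sigma> * gen_prod \<sigma> b) \<in> H (p - \<delta> i b)"
    proof (rule H_sum)
      fix \<sigma> assume \<sigma>: "\<sigma> \<in> koszul_basis n i"
      then have "gen_prod \<sigma> \<in> homog_vec H (B i) (\<delta> i) (koszul_degree e \<sigma>)"
        using gen_prod_deg[of \<sigma>] by (auto simp: koszul_basis_def intro: finite_subset)
      from homog_vec_apply[OF this that(3)] homog_vec_apply[OF that(2) \<sigma>]
      show "y \<sigma> * gen_prod \<sigma> b \<in> H (p - \<delta> i b)"
        by (rule_tac H_mult_eq) auto
    qed
  qed
  let ?\<epsilon> = "cone_degree (\<lambda>j. koszul_degree e) (target_degree \<delta> e)"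
  have "cone_d (Suc i) z \<in> homog_vec H (cone_B i) (?\<epsilon> i) p"
    if hz: "z \<in> homog_vec H (cone_B (Suc i)) (?\<epsilon> (Suc i)) p" for i z p
    unfolding homog_vec_def
  proof (intro CollectI conjI ballI)
    have z: "z \<in> free_on (cone_B (Suc i))" using hz by (simp add: homog_vec_def)
    then show "cone_d (Suc i) z \<in> free_on (cone_B i)" using cone_d_mem[OF z] by simp
    have t: "z \<circ> Inl \<in> free_on (target_basis n B (Suc i))" using z by (simp add: free_on_cone_basis)
    have slice_deg: "slice {r} (z \<circ> Inl) \<in> homog_vec H (B (Suc i)) (\<delta> (Suc i)) (p - e r)" if r: "r \<in> {1..n}" for r
      unfolding homog_vec_def
    proof (intro CollectI conjI ballI)
      show "slice {r} (z \<circ> Inl) \<in> free_on (B (Suc i))" using slice_mem[OF _ t] by simp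
      fix b assume "b \<in> B (Suc i)"
      then have "Inl (Some (b, {r})) \<in> cone_B (Suc i)"
        using r by (auto simp: cone_basis_def target_basis_def koszul_basis_def)
      from homog_vec_apply[OF hz this] show "slice {r} (z \<circ> Inl) b \<in> H (p - e r - \<delta> (Suc i) b)"
        by (simp add: cone_degree_def target_degree_def koszul_degree_def algebra_simps)
    qed
    have s_deg: "z \<circ> Inr \<in> homog_vec H (koszul_basis n (Suc i)) (koszul_degree e) p" if i: "i \<ge> 1"
      unfolding homog_vec_def
    proof (intro CollectI conjI ballI)
      show "z \<circ> Inr \<in> free_on (koszul_basis n (Suc i))"
        using z i by (simp add: free_on_cone_basis source_basis_def)
      fix \<sigma> assume "\<sigma> \<in> koszul_basis n (Suc i)"
      then have "Inr \<sigma> \<in> cone_B (Suc i)"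
        using i by (auto simp: cone_basis_def source_basis_def)
      from homog_vec_apply[OF hz this] show "(z \<circ> Inr) \<sigma> \<in> H (p - koszul_degree e \<sigma>)"
        by (simp add: cone_degree_def)
    qed
    fix c assume c: "c \<in> cone_B i"
    show "cone_d (Suc i) z c \<in> H (p - ?\<epsilon> i c)"
    proof (cases i)
      case 0
      \<comment> \<open>As u has degree 0, d_1 of the slice has degree p - e r, and g_r makes up the
        difference.\<close>
      have "g r * d 1 (slice {r} (z \<circ> Inl)) u \<in> H p" if r: "r \<in> {1..n}" for r
        using d_deg[OF _ slice_deg[OF r], of u] r g 0 F(2) B_0
        by (intro H_mult_eq[of _ "e r" _ "p - e r"]) auto
      moreover have "c = Inl None" using c 0 by (simp add: cone_B_0)
      ultimately show ?thesis
        using cone_d_1_Inl_None[of z] z 0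
        by (auto simp: cone_degree_def target_degree_def intro!: H_uminus H_sum)
    next
      case (Suc j)
      then have i: "i \<ge> 1" by simp
      from c show ?thesis
        unfolding Suc
      proof (cases rule: cone_B_cases)
        case (1 b r)
        have "d (Suc i) (slice {r} (z \<circ> Inl)) b \<in> H (p - e r - \<delta> i b)"
          using d_deg[OF _ slice_deg[OF 1(3)], of b] 1(2) Suc by simp
        moreover have "comparison_map n mul L1 i (contract r (z \<circ> Inr)) b \<in> H (p - e r - \<delta> i b)"
          using comp_deg[OF i contract_homog_vec[OF s_deg[OF i] 1(3)]] 1(2) Suc by simp
        ultimately have "cone_d (Suc i) z c \<in> H (p - e r - \<delta> i b)"
          using cone_d_Some[OF i z 1(3), of b] 1(1) H_add by simp
        then show "cone_d (Suc (Suc j)) z c \<in> H (p - ?\<epsilon> (Suc j) c)"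
          using 1(1) Suc by (simp add: cone_degree_def target_degree_def koszul_degree_def algebra_simps)
      next
        case (2 \<sigma>)
        have "cone_d (Suc i) z c \<in> H (p - koszul_degree e \<sigma>)"
        proof (cases "i \<ge> 2")
          case True
          then have "\<sigma> \<in> koszul_basis n i" using 2(2) Suc by (simp add: source_basis_def)
          from koszul_op_homog[OF s_deg[OF i] this g] show ?thesis
            using cone_d_Inr[OF z, of \<sigma>] 2(1) True H_uminus by simp
        next
          case False
          then show ?thesis using cone_d_Inr[OF z, of \<sigma>] 2(1) H_zero by simp
        qed
        then show "cone_d (Suc (Suc j)) z c \<in> H (p - ?\<epsilon> (Suc j) c)"
          using 2(1) Suc by (simp add: cone_degree_def)
      qed
    qed
  qed
  then show ?thesis
    unfolding graded_complex_def degree_preserving_def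
    by (metis (no_types, lifting) One_nat_def Suc_le_D diff_Suc_1 image_subsetI)
qed

text \<open>In the graded setting the resolution should itself be graded. This is the last conjunct,
  stated for all degrees \<delta> and e with respect to which F, the generators, \<open>L1\<close>
  and the product are homogeneous.\<close>

theorem theorem4p8:
  fixes \<mm> I \<aa> :: "'a::comm_ring_1 set"
    and k :: "'a set" and N :: nat and X :: "nat \<Rightarrow> 'a"
    and n :: nat and g :: "nat \<Rightarrow> 'a"
    and u :: 'b and B :: "nat \<Rightarrow> 'b set" and d :: "nat \<Rightarrow> ('b \<Rightarrow> 'a) \<Rightarrow> ('b \<Rightarrow> 'a)"
    and mul :: "nat \<Rightarrow> nat \<Rightarrow> ('b \<Rightarrow> 'a) \<Rightarrow> ('b \<Rightarrow> 'a) \<Rightarrow> ('b \<Rightarrow> 'a)"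
    and L1 :: "(nat set \<Rightarrow> 'a) \<Rightarrow> ('b \<Rightarrow> 'a)"
  assumes setting:
      "regular_local_ring \<mm> \<or>
       (polynomial_ring k N X \<and> \<mm> = ideal_gen (X ` {1..N}) \<and>
        homogeneous_ideal k N X I \<and> homogeneous_ideal k N X \<aa>)"
    and I: "is_ideal I" "I \<noteq> UNIV"
    and a: "regular_sequence n g" "minimally_generates n g \<aa>" "\<aa> \<subseteq> I"
    and F: "minimal_free_resolution \<mm> u B d I"
    and product: "dg_product u B d mul"
    and L1: "linear_on (koszul_basis n 1) (B 1) L1"
      "\<forall>x\<in>free_on (koszul_basis n 1). d 1 (L1 x) u = koszul_diff n g 1 x {}"
  shows "complex_morphism (source_basis n) (source_diff n g)
           (target_basis n B) (target_diff n g u B d) (Phi_morphism n mul L1) \<and>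
         free_resolution (Inl None)
           (cone_basis (source_basis n) (target_basis n B))
           (cone_diff (source_diff n g) (target_diff n g u B d) (Phi_morphism n mul L1))
           (ideal_mult \<aa> I) \<and>
         (\<aa> \<subseteq> ideal_mult \<mm> I \<longrightarrow>
          minimal_free_resolution \<mm> (Inl None)
           (cone_basis (source_basis n) (target_basis n B))
           (cone_diff (source_diff n g) (target_diff n g u B d) (Phi_morphism n mul L1))
           (ideal_mult \<aa> I)) \<and>
         (polynomial_ring k N X \<longrightarrow>
          (\<forall>\<delta> e.
            graded_complex (homog k N X) B \<delta> d \<and> \<delta> 0 u = 0 \<and>
            (\<forall>r\<in>{1..n}. g r \<in> homog k N X (e r)) \<and>
            degree_preserving (homog k N X) (koszul_basis n 1) (koszul_degree e) (B 1) (\<delta> 1) L1 \<and>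
            graded_product (homog k N X) B \<delta> mul \<longrightarrow>
            graded_complex (homog k N X)
              (cone_basis (source_basis n) (target_basis n B))
              (cone_degree (\<lambda>j. koszul_degree e) (target_degree \<delta> e))
              (cone_diff (source_diff n g) (target_diff n g u B d) (Phi_morphism n mul L1))))"
proof -
  interpret dg_resolution n g u B d mul L1 I
    using F product L1 by unfold_locales (simp_all add: minimal_free_resolution_def)
  have gen: "\<aa> = ideal_gen (g ` {1..n})"
    using a(2) by (simp add: minimally_generates_def)
  have M: "is_ideal \<mm>"
    using setting module.subspace_span[OF module_mult]
    by (auto simp: regular_local_ring_def maximal_ideal_def)
  have resolution: "free_resolution (Inl None) cone_B cone_d (ideal_mult \<aa> I)"
    unfolding gen by (rule free_resolution_cone[OF a(1) I(1)])
  moreover have "minimal_complex \<mm> cone_B cone_d" if "\<aa> \<subseteq> ideal_mult \<mm> I"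
    using minimal_complex_cone[OF M _ _ I(1)] F that unfolding gen minimal_free_resolution_def by blast
  moreover have "ring_grading (homog k N X)" if "polynomial_ring k N X"
    using that by (intro ring_grading_homog) (simp add: polynomial_ring_def)
  ultimately show ?thesis
    using complex_morphism_Phi graded_complex_cone unfolding minimal_free_resolution_def by blast
qed

end
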